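(* Let $\Omega\subset\mathbb{R}^n$ and $\tilde\Omega\Subset\Omega$ be bounded domains that are symmetric with respect to the hyperplane $\{x_1=0\}$, and let $c\in L^\infty(\Omega^+)$. Suppose that $u\in C^{2s+\alpha}(\Omega)\cap\mathscr A_s(\mathbb{R}^n)$ for some $\alpha>0$ with $2s+\alpha$ not an integer, that $u\geq 0$ in $\mathbb{R}^n_+$, and that $$(-\Delta)^s u+cu=0\quad\text{in }\Omega^+ .$$ Then there exists $C>0$ depending only on $\Omega$, $\tilde\Omega$, $\|c\|_{L^\infty(\Omega^+)}$, $n$ and $s$ such that $$\sup_{x\in\tilde\Omega^+}\frac{u(x)}{x_1}\leq C\inf_{x\in\tilde\Omega^+}\frac{u(x)}{x_1}.$$ Moreover, $\inf_{\tilde\Omega^+}\frac{u(x)}{x_1}$ and $\sup_{\tilde\Omega^+}\frac{u(x)}{x_1}$ are comparable to $\|u\|_{\mathscr A_s(\mathbb{R}^n)}$: there is $C>1$ with the same dependence such that $C^{-1}\|u\|_{\mathscr A_s(\mathbb{R}^n)}\leq \inf_{\tilde\Omega^+}\frac{u(x)}{x_1}\le\sup_{\tilde\Omega^+}\frac{u(x)}{x_1}\leq C\|u\|_{\mathscr A_s(\mathbb{R}^n)}$.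
   Context: Fix $n\geq1$ and $s\in(0,1)$. For $x\in\mathbb{R}^n$ write $x=(x_1,x')$ and $x_\ast=(-x_1,x')$. A function $u:\mathbb{R}^n\to\mathbb{R}$ is antisymmetric if $u(x_\ast)=-u(x)$ for all $x$. Let $\mathbb{R}^n_+=\{x_1>0\}$ and, for $A\subset\mathbb{R}^n$, $A^+=A\cap\mathbb{R}^n_+$. $\mathscr A_s(\mathbb{R}^n)$ is the set of antisymmetric $u\in L^1_{loc}(\mathbb{R}^n)$ with $\|u\|_{\mathscr A_s(\mathbb{R}^n)}:=\int_{\mathbb{R}^n_+}\frac{x_1|u(x)|}{1+|x|^{n+2s+2}}\,dx<\infty$. For non-integer $\beta>0$, $C^\beta$ denotes $C^{k,\beta-k}$ with $k=\lfloor\beta\rfloor$. Let $c_{n,s}=\frac{s4^s\Gamma(\frac{n+2s}{2})}{\pi^{n/2}\Gamma(1-s)}$ (the usual normalising constant of the fractional Laplacian). For $u\in\mathscr A_s(\mathbb{R}^n)$ which is $C^{2s+\alpha}$ near a point $x\in\mathbb{R}^n_+$ ($\alpha>0$, $2s+\alpha\notin\mathbb{Z}$), the fractional Laplacian is defined by $$(-\Delta)^su(x)=c_{n,s}\lim_{\varepsilon\to0^+}\int_{\mathbb{R}^n_+\setminus B_\varepsilon(x)}\Big(\frac{1}{|x-y|^{n+2s}}-\frac{1}{|x_\ast-y|^{n+2s}}\Big)(u(x)-u(y))\,dy+\frac{c_{1,s}}{s}u(x)x_1^{-2s},$$ and the equation is understood pointwise with this definition. *)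

theory Defs
  imports "HOL-Analysis.Analysis"
begin

text \<open>Points of R^n are vectors real^'n; the distinguished "first" coordinate x_1 is
  the coordinate with index k (an arbitrary but fixed index of the finite type 'n).
  The dimension is n = CARD('n).\<close>

definition refl_pt :: "'n::finite \<Rightarrow> real^'n \<Rightarrow> real^'n" where
  "refl_pt k x = (\<chi> i. if i = k then - (x $ i) else x $ i)"

definition halfsp :: "'n::finite \<Rightarrow> (real^'n) set" where
  "halfsp k = {x. x $ k > 0}"

definition antisymmetric_fun :: "'n::finite \<Rightarrow> (real^'n \<Rightarrow> real) \<Rightarrow> bool" where
  "antisymmetric_fun k u \<longleftrightarrow> (\<forall>x. u (refl_pt k x) = - u x)"

definition locally_integrable :: "(real^'n::finite \<Rightarrow> real) \<Rightarrow> bool" where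
  "locally_integrable u \<longleftrightarrow> (\<forall>K. compact K \<longrightarrow> set_integrable lebesgue K u)"

definition As_weight :: "real \<Rightarrow> (real^'n::finite \<Rightarrow> real) \<Rightarrow> 'n \<Rightarrow> real^'n \<Rightarrow> real" where
  "As_weight s u k x = x $ k * \<bar>u x\<bar> / (1 + norm x powr (real CARD('n) + 2 * s + 2))"

definition As_norm :: "'n::finite \<Rightarrow> real \<Rightarrow> (real^'n \<Rightarrow> real) \<Rightarrow> real" where
  "As_norm k s u = (LINT x : halfsp k | lebesgue. As_weight s u k x)"

definition in_As :: "'n::finite \<Rightarrow> real \<Rightarrow> (real^'n \<Rightarrow> real) \<Rightarrow> bool" where
  "in_As k s u \<longleftrightarrow> antisymmetric_fun k u \<and> locally_integrable u \<and>
      set_integrable lebesgue (halfsp k) (As_weight s u k)"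

definition c_const :: "nat \<Rightarrow> real \<Rightarrow> real" where
  "c_const n s = s * 4 powr s * Gamma ((real n + 2 * s) / 2) / (pi powr (real n / 2) * Gamma (1 - s))"

fun dpart :: "'n::finite list \<Rightarrow> (real^'n \<Rightarrow> real) \<Rightarrow> real^'n \<Rightarrow> real" where
  "dpart [] f = f"
| "dpart (i # is) f = (\<lambda>x. frechet_derivative (dpart is f) (at x) (axis i 1))"

definition Ck_on :: "nat \<Rightarrow> (real^'n::finite) set \<Rightarrow> (real^'n \<Rightarrow> real) \<Rightarrow> bool" where
  "Ck_on m \<Omega> f \<longleftrightarrow>
     (\<forall>is. length is \<le> m \<longrightarrow> continuous_on \<Omega> (dpart is f)) \<and>
     (\<forall>is. length is < m \<longrightarrow> (\<forall>x\<in>\<Omega>. dpart is f differentiable (at x)))"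

definition Holder_on :: "nat \<Rightarrow> real \<Rightarrow> (real^'n::finite) set \<Rightarrow> (real^'n \<Rightarrow> real) \<Rightarrow> bool" where
  "Holder_on m g \<Omega> f \<longleftrightarrow> Ck_on m \<Omega> f \<and>
     (\<forall>is. length is \<le> m \<longrightarrow> bounded (dpart is f ` \<Omega>)) \<and>
     (\<forall>is. length is = m \<longrightarrow> (\<exists>L. \<forall>x\<in>\<Omega>. \<forall>y\<in>\<Omega>.
          \<bar>dpart is f x - dpart is f y\<bar> \<le> L * dist x y powr g))"

definition C_beta :: "real \<Rightarrow> (real^'n::finite) set \<Rightarrow> (real^'n \<Rightarrow> real) \<Rightarrow> bool" where
  "C_beta \<beta> \<Omega> f \<longleftrightarrow> Holder_on (nat \<lfloor>\<beta>\<rfloor>) (\<beta> - of_int \<lfloor>\<beta>\<rfloor>) \<Omega> f"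

definition frac_kernel :: "'n::finite \<Rightarrow> real \<Rightarrow> real^'n \<Rightarrow> real^'n \<Rightarrow> real" where
  "frac_kernel k s x y =
     1 / norm (x - y) powr (real CARD('n) + 2 * s) - 1 / norm (refl_pt k x - y) powr (real CARD('n) + 2 * s)"

definition pv_integrand :: "'n::finite \<Rightarrow> real \<Rightarrow> (real^'n \<Rightarrow> real) \<Rightarrow> real^'n \<Rightarrow> real^'n \<Rightarrow> real" where
  "pv_integrand k s u x y = frac_kernel k s x y * (u x - u y)"

definition frac_lap_at :: "'n::finite \<Rightarrow> real \<Rightarrow> (real^'n \<Rightarrow> real) \<Rightarrow> real^'n \<Rightarrow> real \<Rightarrow> bool" where
  "frac_lap_at k s u x v \<longleftrightarrow>
     (\<forall>\<epsilon>>0. set_integrable lebesgue (halfsp k - ball x \<epsilon>) (pv_integrand k s u x)) \<and>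
     (\<exists>L. ((\<lambda>\<epsilon>. LINT y : halfsp k - ball x \<epsilon> | lebesgue. pv_integrand k s u x y)
             \<longlongrightarrow> L) (at_right 0) \<and>
          v = c_const CARD('n) s * L + c_const 1 s / s * u x * (x $ k) powr (- 2 * s))"

definition domain :: "(real^'n::finite) set \<Rightarrow> bool" where
  "domain \<Omega> \<longleftrightarrow> open \<Omega> \<and> connected \<Omega> \<and> \<Omega> \<noteq> {}"

definition symmetric_set :: "'n::finite \<Rightarrow> (real^'n) set \<Rightarrow> bool" where
  "symmetric_set k \<Omega> \<longleftrightarrow> (\<forall>x\<in>\<Omega>. refl_pt k x \<in> \<Omega>)"

definition in_Linf :: "(real^'n::finite) set \<Rightarrow> (real^'n \<Rightarrow> real) \<Rightarrow> bool" where
  "in_Linf S c \<longleftrightarrow> c \<in> borel_measurable (lebesgue_on S) \<and>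
     (\<exists>M. AE x in lebesgue. x \<in> S \<longrightarrow> \<bar>c x\<bar> \<le> M)"

definition Linf_norm :: "(real^'n::finite) set \<Rightarrow> (real^'n \<Rightarrow> real) \<Rightarrow> real" where
  "Linf_norm S c = Inf {M. M \<ge> 0 \<and> (AE x in lebesgue. x \<in> S \<longrightarrow> \<bar>c x\<bar> \<le> M)}"

end

theory Submission
  imports Defs "HOL-Probability.Distributions"
begin

text \<open>
  Write \<open>u = x\<^sub>1 v\<close>. The normalising constants are such that the operator annihilates the linear
  function \<open>x\<^sub>1\<close>, so for \<open>v\<close> the equation becomes a nonlocal equation with the positive kernel
  \<open>K(x,y) y\<^sub>1 / x\<^sub>1\<close>, where \<open>K\<close> is the difference of the two powers in the definition of the operator. This
  kernel is comparable to \<open>y\<^sub>1\<^sup>2 / (|x - y|^(n+2s) |x\<^sub>* - y|\<^sup>2)\<close>, which is why \<open>x\<^sub>1 |u|\<close> is the natural density.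
  Both bounds on \<open>u / x\<^sub>1\<close> are pointwise barrier arguments around a point \<open>p\<close>, with \<open>q\<close> a smooth function, even in
  \<open>x\<^sub>1\<close>, which measures the distance to \<open>p\<close>. For the lower bound, \<open>\<tau> x\<^sub>1 (b - q)\<^sub>+\<close> cannot
  exceed \<open>u\<close>: at a negative minimum of the difference the operator sees the whole mass of \<open>u\<close>, which
  forces the norm of \<open>u\<close> to be at most a multiple of \<open>\<tau>\<close>. For the upper bound, \<open>u\<close> cannot exceed
  \<open>\<tau> x\<^sub>1 (b - q)^(-n-2)\<close> once \<open>\<tau>\<close> is a large multiple of the norm: at a maximum \<open>x\<close> of the difference,
  the contribution of the complement of a ball of radius \<open>r = \<theta> (b - q(x))\<close> to \<open>u(x)\<close> is of order
  \<open>r^(-2s) u(x)\<close>, while the part inside the ball costs only \<open>\<theta>\<^sup>2 r^(-2s) u(x)\<close> and the mass of \<open>u\<close> outside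
  costs \<open>r^(-n-2s-2)\<close> times the norm.
\<close>

section \<open>Symmetries and radial integrals\<close>

text \<open>Every estimate has to carry the factor \<open>x $ k\<close>, uniformly up to the
  hyperplane; only then can it be divided out of the inequality at a contact point. This shapes
  \<open>qfun\<close>. Near \<open>x\<close>, a smooth cutoff contributes quadratic terms, for which
  the kernel supplies the factor, and a first-order term in \<open>y $ k - x $ k\<close>, for which
  the half space has no exact symmetry and only a bound without the factor is available. A function
  of \<open>(y $ k)\<^sup>2\<close> has a normal derivative proportional to \<open>x $ k\<close>,
  which restores it. The exponent n + 2 of the upper barrier is forced by scaling: the mass of
  \<open>u\<close> enters with r^(-n-2s-2), the gain is r^(-2s) times the barrier, and the quotient
  is r^(-n-2). Supremum and infimum are never compared directly: each is compared with the norm, and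
  the Harnack constant is the product of the two constants.\<close>

lemma vec_affine_preserves_lebesgue:
  fixes t :: "real^'n::finite" and cc :: "'n \<Rightarrow> real"
  assumes cc: "\<And>i. \<bar>cc i\<bar> = 1"
  defines "T \<equiv> \<lambda>y. (\<chi> i. t $ i + cc i * y $ i)"
  shows "T \<in> lebesgue \<rightarrow>\<^sub>M lebesgue" "distr lebesgue lebesgue T = lebesgue"
proof -
  define c where "c j = j \<bullet> (\<chi> i. cc i)" for j :: "real^'n"
  have c_axis: "c (axis i 1) = cc i" for i
    by (simp add: c_def inner_axis inner_commute)
  have c1: "\<bar>c j\<bar> = 1" if "j \<in> Basis" for j
    using that cc by (auto simp: Basis_vec_def c_axis)
  then have c0: "c j \<noteq> 0" if "j \<in> Basis" for j
    using that by fastforce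
  have Teq: "T = (\<lambda>y. t + (\<Sum>j\<in>Basis. (c j * (y \<bullet> j)) *\<^sub>R j))"
  proof (rule ext, rule euclidean_eqI)
    fix y b :: "real^'n" assume b: "b \<in> Basis"
    then obtain i where i: "b = axis i 1"
      by (auto simp: Basis_vec_def)
    have "(\<Sum>j\<in>Basis. (c j * (y \<bullet> j)) *\<^sub>R j) \<bullet> b = c b * (y \<bullet> b)"
      using b by (simp add: inner_sum_left inner_Basis if_distrib cong: if_cong)
    then show "T y \<bullet> b = (t + (\<Sum>j\<in>Basis. (c j * (y \<bullet> j)) *\<^sub>R j)) \<bullet> b"
      by (simp add: inner_add_left i c_axis T_def inner_axis)
  qed
  show "T \<in> lebesgue \<rightarrow>\<^sub>M lebesgue"
    unfolding Teq using c0 by (rule lebesgue_affine_measurable)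
  have "lebesgue = density (distr lebesgue lebesgue T) (\<lambda>_. (\<Prod>j\<in>Basis. \<bar>c j\<bar>))"
    unfolding Teq using c0 by (rule lebesgue_affine_euclidean)
  also have "\<dots> = distr lebesgue lebesgue T"
    using c1 by (simp add: density_1)
  finally show "distr lebesgue lebesgue T = lebesgue" by simp
qed

text \<open>The integral sees only the \<open>T\<close>-average of \<open>f\<close>, so the odd part
  drops out. This makes principal-value cancellation quantitative: \<open>f\<close> itself need only
  be integrable, while its average obeys a bound \<open>F\<close> that can be uniform in the
  cutoff.\<close>

lemma abs_integral_le_symmetrised:
  fixes f F :: "'a::euclidean_space \<Rightarrow> real"
  assumes T: "T \<in> M \<rightarrow>\<^sub>M M" "distr M M T = M"
    and f: "integrable M f" and F: "integrable M F"
    and le: "\<And>y. \<bar>f y + f (T y)\<bar> \<le> 2 * F y"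
  shows "\<bar>integral\<^sup>L M f\<bar> \<le> integral\<^sup>L M F"
proof -
  have fT: "integrable M (\<lambda>y. f (T y))"
    using f T integrable_distr[of T M M f] by simp
  have "integral\<^sup>L M (\<lambda>y. f (T y)) = integral\<^sup>L M f"
    using integral_distr[OF T(1), of f] T(2) f by simp
  then have "2 * integral\<^sup>L M f = integral\<^sup>L M (\<lambda>y. f y + f (T y))"
    using f fT by simp
  also have "\<bar>\<dots>\<bar> \<le> integral\<^sup>L M (\<lambda>y. 2 * F y)"
    using Bochner_Integration.integral_norm_bound_integral[of M "\<lambda>y. f y + f (T y)" "\<lambda>y. 2 * F y"] f fT F le by simp
  finally show ?thesis by simp
qed

text \<open>The exact version, for an average that is split further before it is estimated.\<close>

lemma integral_symmetrised:
  fixes f :: "'a::euclidean_space \<Rightarrow> real"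
  assumes T: "T \<in> M \<rightarrow>\<^sub>M M" "distr M M T = M" and f: "integrable M f"
  shows "integrable M (\<lambda>y. (f y + f (T y)) / 2)"
    "integral\<^sup>L M f = integral\<^sup>L M (\<lambda>y. (f y + f (T y)) / 2)"
proof -
  have fT: "integrable M (\<lambda>y. f (T y))"
    using f T integrable_distr[of T M M f] by simp
  have "integral\<^sup>L M (\<lambda>y. f (T y)) = integral\<^sup>L M f"
    using integral_distr[OF T(1), of f] T(2) f by simp
  then show "integral\<^sup>L M f = integral\<^sup>L M (\<lambda>y. (f y + f (T y)) / 2)"
    "integrable M (\<lambda>y. (f y + f (T y)) / 2)"
    using f fT by simp_all
qed

lemma nn_integral_powr_from_0:
  assumes "\<sigma> > 0" "r \<ge> 0"
  shows "(\<integral>\<^sup>+t. ennreal (indicator {0..r} t * t powr (\<sigma> - 1)) \<partial>lborel) = ennreal (r powr \<sigma> / \<sigma>)"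
  using nn_integral_has_integral_lebesgue[OF _ has_integral_powr_from_0[of "\<sigma> - 1" r]] assms by simp

lemma nn_integral_powr_to_inf:
  assumes "\<sigma> > 0" "r > 0"
  shows "(\<integral>\<^sup>+t. ennreal (indicator {r..} t * t powr (- \<sigma> - 1)) \<partial>lborel) = ennreal (r powr - \<sigma> / \<sigma>)"
  using nn_integral_has_integral_lebesgue[OF _ has_integral_powr_to_inf[of "- \<sigma> - 1" r]] assms by simp

lemma emeasure_ball_eq:
  assumes "r \<ge> 0"
  shows "emeasure lborel (ball (c::'a::euclidean_space) r) = ennreal (measure lborel (ball (0::'a) 1) * r powr DIM('a))"
proof -
  have "emeasure lborel (ball c r) = ennreal (measure lborel (ball c r))"
    by (rule emeasure_eq_ennreal_measure) (use emeasure_lborel_ball_finite[of c r] in auto)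
  also have "measure lborel (ball c r) = measure lborel (ball (0::'a) 1) * r powr DIM('a)"
    using content_ball_conv_unit_ball[OF assms, of c] assms
    by (cases "r = 0") (auto simp: powr_realpow)
  finally show ?thesis .
qed

text \<open>Layer cake: \<open>|h| ^ - b = b * (integral of t ^ (- b - 1) over t \<ge> |h|)\<close>.\<close>

lemma nn_integral_norm_powr_layer:
  fixes B :: "'a::euclidean_space set"
  assumes b: "b > 0" and [measurable]: "B \<in> sets borel" "w \<in> borel_measurable borel"
    and w: "\<And>h. w h \<ge> 0" and B0: "0 \<notin> B"
  shows "(\<integral>\<^sup>+h. ennreal (indicator B h * (w h * norm h powr - b)) \<partial>lborel) =
    (\<integral>\<^sup>+t. ennreal (b * (indicator {0..} t * t powr (- b - 1))) *
      (\<integral>\<^sup>+h. ennreal (indicator (B \<inter> cball 0 t) h * w h) \<partial>lborel) \<partial>lborel)"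
proof -
  have "(\<integral>\<^sup>+h. ennreal (indicator B h * (w h * norm h powr - b)) \<partial>lborel) =
    (\<integral>\<^sup>+h. ennreal (b * (indicator B h * w h)) * (\<integral>\<^sup>+t. ennreal (indicator {norm h..} t * t powr (- b - 1)) \<partial>lborel) \<partial>lborel)"
  proof (rule nn_integral_cong)
    fix h :: 'a
    show "ennreal (indicator B h * (w h * norm h powr - b)) =
      ennreal (b * (indicator B h * w h)) * (\<integral>\<^sup>+t. ennreal (indicator {norm h..} t * t powr (- b - 1)) \<partial>lborel)"
    proof (cases "h \<in> B")
      case True
      with B0 have "norm h > 0" by auto
      from nn_integral_powr_to_inf[OF b this] show ?thesis
        using b w by (simp add: ennreal_mult[symmetric] True)
    qed simp
  qed
  also have "\<dots> = (\<integral>\<^sup>+h. \<integral>\<^sup>+t. ennreal (b * (indicator B h * w h)) * ennreal (indicator {norm h..} t * t powr (- b - 1)) \<partial>lborel \<partial>lborel)"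
    by (intro nn_integral_cong nn_integral_cmult[symmetric]) (measurable)
  also have "\<dots> = (\<integral>\<^sup>+h. \<integral>\<^sup>+t. ennreal (b * (indicator {0..} t * t powr (- b - 1))) * ennreal (indicator (B \<inter> cball 0 t) h * w h) \<partial>lborel \<partial>lborel)"
    using b w by (intro nn_integral_cong) (auto simp: indicator_def ennreal_mult[symmetric] mult_ac dest: order_trans[OF norm_ge_zero])
  also have "\<dots> = (\<integral>\<^sup>+t. \<integral>\<^sup>+h. ennreal (b * (indicator {0..} t * t powr (- b - 1))) * ennreal (indicator (B \<inter> cball 0 t) h * w h) \<partial>lborel \<partial>lborel)"
  proof (rule lborel_pair.Fubini')
    have "Measurable.pred (lborel \<Otimes>\<^sub>M lborel) (\<lambda>x::real\<times>'a. norm (snd x) \<le> fst x)" by measurable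
    then show "(\<lambda>(t, h). ennreal (b * (indicator {0..} t * t powr (- b - 1))) * ennreal (indicator (B \<inter> cball 0 t) h * w h)) \<in> borel_measurable (lborel \<Otimes>\<^sub>M lborel)"
      unfolding indicator_def Int_iff mem_cball_0 by measurable
  qed
  also have "\<dots> = (\<integral>\<^sup>+t. ennreal (b * (indicator {0..} t * t powr (- b - 1))) *
      (\<integral>\<^sup>+h. ennreal (indicator (B \<inter> cball 0 t) h * w h) \<partial>lborel) \<partial>lborel)"
  proof (intro nn_integral_cong nn_integral_cmult)
    fix t :: real
    have [measurable]: "B \<inter> cball 0 t \<in> sets borel" by simp
    show "(\<lambda>h. ennreal (indicator (B \<inter> cball 0 t) h * w h)) \<in> borel_measurable lborel" by measurable
  qed
  finally show ?thesis .
qed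


text \<open>The layer formula needs a negative power, but \<open>\<sigma> - n\<close> can have
  either sign. Hence the power \<open>- n\<close> is layered and the power \<open>\<sigma>\<close>
  is kept as weight; on the layer of radius \<open>min t r\<close> it is at most
  \<open>(min t r) powr \<sigma>\<close>, and the volume supplies the rest.\<close>

lemma ball_radial_integral:
  fixes \<sigma> :: real
  assumes sg: "\<sigma> > 0"
  shows "\<exists>C>0. \<forall>r>0. set_integrable lebesgue (ball (0::'a::euclidean_space) r) (\<lambda>h. norm h powr (\<sigma> - DIM('a))) \<and>
     (LINT h : ball (0::'a) r | lebesgue. norm h powr (\<sigma> - DIM('a))) \<le> C * r powr \<sigma>"
proof -
  define n where "n = real DIM('a)"
  define w where "w = measure lborel (ball (0::'a) 1)"
  \<comment> \<open>The two summands are the layers of radius below and above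
    \<open>r\<close>.\<close>
  define C where "C = n * w * (1 / \<sigma> + 1 / n)"
  have n: "n > 0" by (simp add: n_def)
  have w: "w > 0" unfolding w_def using content_ball_pos[of 1 "0::'a"] by simp
  have C: "C > 0" using n w sg by (simp add: C_def add_pos_pos)
  \<comment> \<open>The origin is removed because the layer formula excludes it; restoring it
    changes nothing, since \<open>0 powr _\<close> is 0.\<close>
  have main: "(\<integral>\<^sup>+h. ennreal (indicator (ball 0 r - {0}) h * norm (h::'a) powr (\<sigma> - n)) \<partial>lborel) \<le> ennreal (C * r powr \<sigma>)"
    if r: "r > 0" for r
  proof -
    have "(\<integral>\<^sup>+h. ennreal (indicator (ball 0 r - {0}) h * norm (h::'a) powr (\<sigma> - n)) \<partial>lborel) =
        (\<integral>\<^sup>+h. ennreal (indicator (ball 0 r - {0}) h * (norm (h::'a) powr \<sigma> * norm h powr - n)) \<partial>lborel)"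
      by (simp add: powr_diff powr_minus field_simps)
    also have "\<dots> = (\<integral>\<^sup>+t. ennreal (n * (indicator {0..} t * t powr (- n - 1))) *
        (\<integral>\<^sup>+h. ennreal (indicator ((ball 0 r - {0}) \<inter> cball 0 t) h * norm (h::'a) powr \<sigma>) \<partial>lborel) \<partial>lborel)"
      by (rule nn_integral_norm_powr_layer) (use n in auto)
    also have "\<dots> \<le> (\<integral>\<^sup>+t. ennreal (n * w) * (ennreal (indicator {0..r} t * t powr (\<sigma> - 1)) +
        ennreal (r powr (\<sigma> + n)) * ennreal (indicator {r..} t * t powr (- n - 1))) \<partial>lborel)"
    proof (rule nn_integral_mono)
      fix t :: real
      show "ennreal (n * (indicator {0..} t * t powr (- n - 1))) *
        (\<integral>\<^sup>+h. ennreal (indicator ((ball 0 r - {0}) \<inter> cball 0 t) h * norm (h::'a) powr \<sigma>) \<partial>lborel)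
        \<le> ennreal (n * w) * (ennreal (indicator {0..r} t * t powr (\<sigma> - 1)) +
        ennreal (r powr (\<sigma> + n)) * ennreal (indicator {r..} t * t powr (- n - 1)))"
      proof (cases "t > 0")
        case False
        then show ?thesis by (cases "t = 0") auto
      next
        case t: True
        define m where "m = min t r"
        have m: "m > 0" using t r by (simp add: m_def)
        have "(\<integral>\<^sup>+h. ennreal (indicator ((ball 0 r - {0}) \<inter> cball 0 t) h * norm (h::'a) powr \<sigma>) \<partial>lborel)
          \<le> (\<integral>\<^sup>+h. ennreal (m powr \<sigma>) * indicator (cball 0 m) (h::'a) \<partial>lborel)"
          using sg by (intro nn_integral_mono)
            (auto simp: indicator_def m_def intro!: ennreal_leI powr_mono2)
        also have "\<dots> = ennreal (m powr \<sigma>) * emeasure lborel (cball (0::'a) m)"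
          by (simp add: nn_integral_cmult_indicator)
        also have "emeasure lborel (cball (0::'a) m) = emeasure lborel (ball (0::'a) m)"
          using content_cball_conv_ball[of "0::'a" m]
            emeasure_lborel_ball_finite[of "0::'a" m] emeasure_lborel_cball_finite[of "0::'a" m]
          by (simp add: emeasure_eq_ennreal_measure)
        also have "\<dots> = ennreal (w * m powr n)"
          using m by (simp add: emeasure_ball_eq w_def n_def)
        also have "ennreal (m powr \<sigma>) * ennreal (w * m powr n) = ennreal (w * m powr (\<sigma> + n))"
          using w by (simp add: ennreal_mult[symmetric] powr_add mult_ac)
        finally have I: "(\<integral>\<^sup>+h. ennreal (indicator ((ball 0 r - {0}) \<inter> cball 0 t) h * norm (h::'a) powr \<sigma>) \<partial>lborel)
            \<le> ennreal (w * m powr (\<sigma> + n))" .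
        have "ennreal (n * (indicator {0..} t * t powr (- n - 1))) *
          (\<integral>\<^sup>+h. ennreal (indicator ((ball 0 r - {0}) \<inter> cball 0 t) h * norm (h::'a) powr \<sigma>) \<partial>lborel)
          \<le> ennreal (n * (indicator {0..} t * t powr (- n - 1))) * ennreal (w * m powr (\<sigma> + n))"
          by (rule mult_left_mono[OF I]) simp
        also have "\<dots> = ennreal (n * w) * ennreal (t powr (- n - 1) * m powr (\<sigma> + n))"
          using n w t by (simp add: ennreal_mult[symmetric] mult_ac)
        also have "ennreal (t powr (- n - 1) * m powr (\<sigma> + n)) \<le>
          ennreal (indicator {0..r} t * t powr (\<sigma> - 1)) +
            ennreal (r powr (\<sigma> + n)) * ennreal (indicator {r..} t * t powr (- n - 1))"
        proof (cases "t \<le> r")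
          case True
          then have "t powr (- n - 1) * m powr (\<sigma> + n) = t powr (\<sigma> - 1)"
            by (simp add: m_def powr_add[symmetric])
          then show ?thesis using True t by simp
        next
          case False
          then show ?thesis using t by (simp add: m_def ennreal_mult[symmetric] mult_ac)
        qed
        finally show ?thesis by (simp add: mult_left_mono)
      qed
    qed
    also have "\<dots> = ennreal (n * w) * (ennreal (r powr \<sigma> / \<sigma>) + ennreal (r powr (\<sigma> + n)) * ennreal (r powr - n / n))"
      using sg n r nn_integral_powr_from_0[of \<sigma> r] nn_integral_powr_to_inf[of n r]
      by (simp add: nn_integral_cmult nn_integral_add)
    also have "\<dots> = ennreal (C * r powr \<sigma>)"
      using sg n w r by (simp add: C_def ennreal_mult[symmetric] ennreal_plus[symmetric] powr_add powr_minus field_simps del: ennreal_plus)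
    finally show ?thesis .
  qed
  show ?thesis
  proof (intro exI[of _ C] conjI allI impI)
    fix r :: real assume r: "r > 0"
    let ?f = "\<lambda>h::'a. indicator (ball 0 r) h * norm h powr (\<sigma> - n)"
    have "(\<integral>\<^sup>+h. ennreal (?f h) \<partial>lebesgue) = (\<integral>\<^sup>+h. ennreal (?f h) \<partial>lborel)"
      by (rule nn_integral_completion)
    also have "\<dots> = (\<integral>\<^sup>+h. ennreal (indicator (ball 0 r - {0}) h * norm (h::'a) powr (\<sigma> - n)) \<partial>lborel)"
      by (rule nn_integral_cong) (auto simp: indicator_def)
    finally have le: "(\<integral>\<^sup>+h. ennreal (?f h) \<partial>lebesgue) \<le> ennreal (C * r powr \<sigma>)"
      using main[OF r] by simp
    have [measurable]: "ball (0::'a) r \<in> sets borel" by simp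
    have meas: "?f \<in> borel_measurable lebesgue"
      by (intro measurable_completion) measurable
    have int: "integrable lebesgue ?f"
      by (rule integrableI_nonneg[OF meas]) (use le in \<open>auto intro: order_le_less_trans\<close>)
    then show "set_integrable lebesgue (ball (0::'a) r) (\<lambda>h. norm h powr (\<sigma> - DIM('a)))"
      by (simp add: set_integrable_def n_def)
    have "ennreal (integral\<^sup>L lebesgue ?f) \<le> ennreal (C * r powr \<sigma>)"
      using le nn_integral_eq_integral[OF int] by simp
    then show "(LINT h : ball (0::'a) r | lebesgue. norm h powr (\<sigma> - DIM('a))) \<le> C * r powr \<sigma>"
      using C by (simp add: set_lebesgue_integral_def n_def)
  qed (rule C)
qed

text \<open>Here the exponent is negative, so the whole power is layered with weight 1. Layers of
  radius below \<open>r\<close> miss the complement, and the others leave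
  \<open>t powr (- \<sigma> - 1)\<close>.\<close>

lemma ball_compl_radial_integrable:
  fixes \<sigma> r :: real
  assumes sg: "\<sigma> > 0" and r: "r > 0"
  shows "set_integrable lebesgue (- ball (0::'a::euclidean_space) r) (\<lambda>h. norm h powr (- \<sigma> - DIM('a)))"
proof -
  define n where "n = real DIM('a)"
  define w where "w = measure lborel (ball (0::'a) 1)"
  have n: "n > 0" by (simp add: n_def)
  have w: "w \<ge> 0" unfolding w_def by simp
  let ?f = "\<lambda>h::'a. indicator (- ball 0 r) h * norm h powr (- \<sigma> - n)"
  have "(\<integral>\<^sup>+h. ennreal (?f h) \<partial>lebesgue) = (\<integral>\<^sup>+h. ennreal (?f h) \<partial>lborel)"
    by (rule nn_integral_completion)
  also have "\<dots> = (\<integral>\<^sup>+h. ennreal (indicator (- ball 0 r) h * (1 * norm (h::'a) powr - (\<sigma> + n))) \<partial>lborel)"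
    by simp
  also have "\<dots> = (\<integral>\<^sup>+t. ennreal ((\<sigma> + n) * (indicator {0..} t * t powr (- (\<sigma> + n) - 1))) *
        (\<integral>\<^sup>+h. ennreal (indicator ((- ball 0 r) \<inter> cball (0::'a) t) h * 1) \<partial>lborel) \<partial>lborel)"
    by (rule nn_integral_norm_powr_layer) (use n sg r in auto)
  also have "\<dots> \<le> (\<integral>\<^sup>+t. ennreal ((\<sigma> + n) * w) * ennreal (indicator {r..} t * t powr (- \<sigma> - 1)) \<partial>lborel)"
  proof (rule nn_integral_mono)
    fix t :: real
    show "ennreal ((\<sigma> + n) * (indicator {0..} t * t powr (- (\<sigma> + n) - 1))) *
        (\<integral>\<^sup>+h. ennreal (indicator ((- ball 0 r) \<inter> cball (0::'a) t) h * 1) \<partial>lborel) \<le>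
      ennreal ((\<sigma> + n) * w) * ennreal (indicator {r..} t * t powr (- \<sigma> - 1))"
    proof (cases "t \<ge> r")
      case False
      then have "(- ball 0 r) \<inter> cball (0::'a) t = {}" by auto
      then show ?thesis by simp
    next
      case t: True
      have "(\<integral>\<^sup>+h. ennreal (indicator ((- ball 0 r) \<inter> cball (0::'a) t) h * 1) \<partial>lborel) \<le>
        (\<integral>\<^sup>+h. indicator (cball (0::'a) t) h \<partial>lborel)"
        by (intro nn_integral_mono) (auto simp: indicator_def)
      also have "\<dots> = emeasure lborel (cball (0::'a) t)" by simp
      also have "\<dots> = emeasure lborel (ball (0::'a) t)"
        using content_cball_conv_ball[of "0::'a" t]
            emeasure_lborel_ball_finite[of "0::'a" t] emeasure_lborel_cball_finite[of "0::'a" t]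
        by (simp add: emeasure_eq_ennreal_measure)
      also have "\<dots> = ennreal (w * t powr n)"
        using t r by (simp add: emeasure_ball_eq w_def n_def)
      finally have I: "(\<integral>\<^sup>+h. ennreal (indicator ((- ball 0 r) \<inter> cball (0::'a) t) h * 1) \<partial>lborel) \<le> ennreal (w * t powr n)" .
      have "ennreal ((\<sigma> + n) * (indicator {0..} t * t powr (- (\<sigma> + n) - 1))) *
        (\<integral>\<^sup>+h. ennreal (indicator ((- ball 0 r) \<inter> cball (0::'a) t) h * 1) \<partial>lborel) \<le>
        ennreal ((\<sigma> + n) * (indicator {0..} t * t powr (- (\<sigma> + n) - 1))) * ennreal (w * t powr n)"
        by (rule mult_left_mono[OF I]) simp
      also have "\<dots> = ennreal ((\<sigma> + n) * w * (t powr (- (\<sigma> + n) - 1) * t powr n))"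
        using t r n sg w by (simp add: ennreal_mult[symmetric] mult_ac)
      also have "t powr (- (\<sigma> + n) - 1) * t powr n = t powr (- \<sigma> - 1)"
        by (simp add: powr_add[symmetric])
      finally show ?thesis using t n sg w by (simp add: ennreal_mult[symmetric])
    qed
  qed
  also have "\<dots> = ennreal ((\<sigma> + n) * w) * ennreal (r powr - \<sigma> / \<sigma>)"
    using nn_integral_powr_to_inf[OF sg r] by (simp add: nn_integral_cmult)
  also have "\<dots> < \<infinity>" by (simp add: ennreal_mult_less_top)
  finally have le: "(\<integral>\<^sup>+h. ennreal (?f h) \<partial>lebesgue) < \<infinity>" .
  have [measurable]: "- ball (0::'a) r \<in> sets borel" by simp
  have meas: "?f \<in> borel_measurable lebesgue"
    by (intro measurable_completion) measurable
  have int: "integrable lebesgue ?f"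
    by (rule integrableI_nonneg[OF meas]) (use le in auto)
  then show ?thesis
    by (simp add: set_integrable_def n_def)
qed

section \<open>The antisymmetric kernel\<close>

lemma norm_sq_split:
  fixes x :: "real^'n::finite"
  shows "(norm x)\<^sup>2 = (x $ k)\<^sup>2 + (\<Sum>i\<in>UNIV - {k}. (x $ i)\<^sup>2)"
proof -
  have "(norm x)\<^sup>2 = (\<Sum>i\<in>UNIV. (x $ i)\<^sup>2)"
    by (simp add: norm_vec_def L2_set_def sum_nonneg)
  then show ?thesis by (simp add: sum.remove[of UNIV k])
qed

lemma abs_nth_le_norm: "\<bar>(x::real^'n::finite) $ i\<bar> \<le> norm x"
  by (rule component_le_norm_cart)

lemma norm_refl_pt [simp]: "norm (refl_pt k x) = norm (x::real^'n::finite)"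
proof -
  have "(norm (refl_pt k x))\<^sup>2 = (norm x)\<^sup>2"
    unfolding norm_sq_split[of _ k] by (simp add: refl_pt_def)
  then show ?thesis by simp
qed

lemma norm_refl_diff_sq:
  "(norm (refl_pt k x - y))\<^sup>2 = (norm (x - y))\<^sup>2 + 4 * x $ k * y $ k"
  unfolding norm_sq_split[of _ k] by (simp add: refl_pt_def power2_eq_square algebra_simps)

lemma norm_diff_le_refl_diff:
  assumes "x $ k \<ge> 0" "y $ k \<ge> 0"
  shows "norm (x - y) \<le> norm (refl_pt k x - y)"
  by (rule power2_le_imp_le) (use assms in \<open>simp_all add: norm_refl_diff_sq\<close>)

lemma nth_add_le_refl_diff: "x $ k + y $ k \<le> norm (refl_pt k x - y)"
  using abs_nth_le_norm[of "refl_pt k x - y" k] by (simp add: refl_pt_def)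

text \<open>Both cases bound \<open>D + r\<close> by \<open>2 * D\<close> times the larger of 1 and
  \<open>r\<close>. This turns powers of \<open>D + norm y\<close> into the denominator of the
  weight in \<open>As_norm\<close>.\<close>

lemma powr_sum_le:
  fixes D r p :: real
  assumes "D \<ge> 1" "r \<ge> 0" "p \<ge> 0"
  shows "(D + r) powr p \<le> (2 * D) powr p * (1 + r powr p)"
proof (cases "r \<le> 1")
  case True
  then have "(D + r) powr p \<le> (2 * D) powr p"
    using assms by (intro powr_mono2) auto
  also have "\<dots> \<le> (2 * D) powr p * (1 + r powr p)" by (simp add: mult_le_cancel_left1 )
  finally show ?thesis .
next
  case False
  have "1 * 1 \<le> D * r" using assms False by (intro mult_mono) auto
  moreover have "D * 1 \<le> D * r" "1 * r \<le> D * r" using assms False by (auto intro!: mult_left_mono mult_right_mono)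
  ultimately have "D + r \<le> 2 * D * r" by linarith
  then have "(D + r) powr p \<le> (2 * D * r) powr p"
    using assms by (intro powr_mono2) auto
  also have "\<dots> = (2 * D) powr p * r powr p" using assms by (simp add: powr_mult)
  also have "\<dots> \<le> (2 * D) powr p * (1 + r powr p)" by (simp add: algebra_simps)
  finally show ?thesis .
qed

text \<open>With t the quotient of the direct and the reflected distance, the kernel is
  \<open>(1 - t powr e) / a powr e\<close>, while \<open>1 - t\<^sup>2\<close> is
  \<open>4 * x $ k * y $ k / b\<^sup>2\<close>. As t is at most 1 and e lies between 1 and n + 2,
  the numerator lies between 1 - t and 1 - t^(n+2). Both compare with \<open>1 - t\<^sup>2\<close>,
  the second one by Bernoulli's inequality.\<close>

lemma frac_kernel_bounds:
  fixes x y :: "real^'n::finite"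
  assumes s: "0 < s" "s < 1" and x: "x $ k > 0" and y: "y $ k > 0" and xy: "x \<noteq> y"
  defines "e \<equiv> real CARD('n) + 2 * s"
  defines "P \<equiv> x $ k * y $ k / (norm (x - y) powr e * (norm (refl_pt k x - y))\<^sup>2)"
  shows "2 * P \<le> frac_kernel k s x y" "frac_kernel k s x y \<le> 4 * (real CARD('n) + 2) * P"
proof -
  define a where "a = norm (x - y)"
  define b where "b = norm (refl_pt k x - y)"
  define t where "t = a / b"
  define N where "N = CARD('n) + 2"
  have n1: "real CARD('n) \<ge> 1" by (simp add: Suc_le_eq)
  have a: "a > 0" using xy by (simp add: a_def)
  have ab: "a \<le> b" using norm_diff_le_refl_diff[of x k y] x y by (simp add: a_def b_def)
  have b: "b > 0" using a ab by simp
  have t: "0 < t" "t \<le> 1" using a b ab by (simp_all add: t_def)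
  have "frac_kernel k s x y = 1 / a powr e - 1 / b powr e"
    unfolding frac_kernel_def a_def b_def e_def ..
  then have K: "frac_kernel k s x y = (1 - t powr e) / a powr e"
    using a b by (simp add: t_def powr_divide field_simps)
  have "1 - t\<^sup>2 = (b\<^sup>2 - a\<^sup>2) / b\<^sup>2"
    using b by (simp add: t_def field_simps power2_eq_square)
  also have "\<dots> = 4 * x $ k * y $ k / b\<^sup>2"
    using norm_refl_diff_sq[of k x y] by (simp add: a_def b_def)
  finally have t2: "1 - t\<^sup>2 = 4 * x $ k * y $ k / b\<^sup>2" .
  have P: "P = (1 - t\<^sup>2) / 4 / a powr e"
    unfolding t2 by (simp add: P_def a_def[symmetric] b_def[symmetric])
  have "1 \<le> e" unfolding e_def using n1 s by linarith
  then have "t powr e \<le> t powr 1"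
    using t by (intro powr_mono') auto
  moreover have "1 - t\<^sup>2 \<le> 2 * (1 - t)"
    using zero_le_power2[of "t - 1"] by (simp add: power2_eq_square algebra_simps)
  ultimately have "(1 - t\<^sup>2) / 2 \<le> 1 - t powr e" using t by simp
  then have "(1 - t\<^sup>2) / 2 / a powr e \<le> (1 - t powr e) / a powr e"
    using a by (intro divide_right_mono) auto
  moreover have "2 * P = (1 - t\<^sup>2) / 2 / a powr e" unfolding P using a by (simp add: field_simps)
  ultimately show "2 * P \<le> frac_kernel k s x y" by (simp only: K)
  have "t powr real N \<le> t powr e"
    using t s by (intro powr_mono') (auto simp: e_def N_def)
  moreover have "t powr real N = t ^ N" using t by (simp add: powr_realpow)
  moreover have "1 + real N * (t - 1) \<le> t ^ N"
    using Bernoulli_inequality[of "t - 1" N] t by simp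
  moreover have "real N * (1 - t) \<le> real N * (1 - t\<^sup>2)"
    using t by (intro mult_left_mono) (auto simp: power2_eq_square mult_left_le)
  ultimately have "1 - t powr e \<le> real N * (1 - t\<^sup>2)"
    by (simp add: algebra_simps)
  then have "(1 - t powr e) / a powr e \<le> real N * (1 - t\<^sup>2) / a powr e"
    using a by (intro divide_right_mono) auto
  moreover have "4 * (real CARD('n) + 2) * P = real N * (1 - t\<^sup>2) / a powr e"
    unfolding P N_def using a by (simp add: field_simps)
  ultimately show "frac_kernel k s x y \<le> 4 * (real CARD('n) + 2) * P"
    by (simp only: K)
qed

context
  fixes k :: "'n::finite" and s :: real
  assumes s: "0 < s" "s < 1"
begin

lemma frac_kernel_nonneg:
  assumes "x $ k > 0" "y $ k > 0" "x \<noteq> y"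
  shows "0 \<le> frac_kernel k s x y"
proof -
  have "0 \<le> 2 * (x $ k * y $ k / (norm (x - y) powr (real CARD('n) + 2 * s) * (norm (refl_pt k x - y))\<^sup>2))"
    using assms by simp
  with frac_kernel_bounds(1)[OF s assms] show ?thesis by linarith
qed

text \<open>The weight \<open>y $ k\<close> joins the one in the kernel bound, and their product is
  at most the square of the reflected distance. What is left is the isotropic singular kernel with
  the factor \<open>x $ k\<close> in front.\<close>

lemma frac_kernel_nth_le:
  assumes x: "x $ k > 0" and y: "y $ k > 0" and xy: "x \<noteq> y"
  shows "frac_kernel k s x y * y $ k \<le> 4 * (real CARD('n) + 2) * x $ k * norm (x - y) powr (- 2 * s - real CARD('n))"
proof -
  define b where "b = norm (refl_pt k x - y)"
  have yb: "y $ k \<le> b" using nth_add_le_refl_diff[of x k y] x by (simp add: b_def)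
  have "frac_kernel k s x y * y $ k \<le> 4 * (real CARD('n) + 2) * (x $ k * y $ k / (norm (x - y) powr (real CARD('n) + 2 * s) * b\<^sup>2)) * y $ k"
    using frac_kernel_bounds(2)[OF s x y xy] y by (intro mult_right_mono) (auto simp: b_def)
  also have "\<dots> = 4 * (real CARD('n) + 2) * x $ k * norm (x - y) powr (- 2 * s - real CARD('n)) * ((y $ k)\<^sup>2 / b\<^sup>2)"
    using xy by (simp add: powr_minus powr_diff powr_add field_simps power2_eq_square)
  also have "\<dots> \<le> 4 * (real CARD('n) + 2) * x $ k * norm (x - y) powr (- 2 * s - real CARD('n)) * 1"
    using x y yb by (intro mult_left_mono) (auto simp: divide_le_eq power_mono)
  finally show ?thesis by simp
qed

text \<open>Replacing the reflected distance by the smaller direct one is harmless away from the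
  diagonal and exhibits the two extra powers of decay gained from the reflection.\<close>

lemma frac_kernel_le_far:
  assumes x: "x $ k > 0" and y: "y $ k > 0" and xy: "x \<noteq> y"
  shows "frac_kernel k s x y \<le> 4 * (real CARD('n) + 2) * x $ k * y $ k * norm (x - y) powr (- 2 * s - real CARD('n) - 2)"
proof -
  define a where "a = norm (x - y)"
  define b where "b = norm (refl_pt k x - y)"
  have a: "a > 0" using xy by (simp add: a_def)
  have ab: "a \<le> b" using norm_diff_le_refl_diff[of x k y] x y by (simp add: a_def b_def)
  have "frac_kernel k s x y \<le> 4 * (real CARD('n) + 2) * (x $ k * y $ k / (a powr (real CARD('n) + 2 * s) * b\<^sup>2))"
    using frac_kernel_bounds(2)[OF s x y xy] by (simp add: a_def b_def)
  also have "\<dots> \<le> 4 * (real CARD('n) + 2) * (x $ k * y $ k / (a powr (real CARD('n) + 2 * s) * a\<^sup>2))"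
    using a ab x y by (intro mult_left_mono divide_left_mono power_mono) auto
  also have "a powr (real CARD('n) + 2 * s) * a\<^sup>2 = a powr (real CARD('n) + 2 * s + 2)"
    using a by (simp add: powr_add powr_numeral)
  also have "4 * (real CARD('n) + 2) * (x $ k * y $ k / a powr (real CARD('n) + 2 * s + 2)) =
     4 * (real CARD('n) + 2) * x $ k * y $ k * a powr - (real CARD('n) + 2 * s + 2)"
    by (simp only: powr_minus divide_inverse mult.assoc)
  also have "- (real CARD('n) + 2 * s + 2) = - 2 * s - real CARD('n) - 2" by simp
  finally show ?thesis by (simp only: a_def mult.assoc)
qed

text \<open>Both distances are at most \<open>D + norm y\<close>. The bound is a multiple of the
  weight in \<open>As_norm\<close>, so from any point of a bounded set the operator sees the whole
  norm of \<open>u\<close>.\<close>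

lemma frac_kernel_lower:
  assumes x: "x $ k > 0" and y: "y $ k > 0" and xy: "x \<noteq> y" and D: "D \<ge> 1" "norm x \<le> D"
  shows "2 / (2 * D) powr (real CARD('n) + 2 * s + 2) * x $ k * y $ k / (1 + norm y powr (real CARD('n) + 2 * s + 2)) \<le> frac_kernel k s x y"
proof -
  define a where "a = norm (x - y)"
  define b where "b = norm (refl_pt k x - y)"
  define e where "e = real CARD('n) + 2 * s"
  have e: "e > 0" using s by (simp add: e_def add_pos_pos)
  have a: "a > 0" using xy by (simp add: a_def)
  have ab: "a \<le> b" using norm_diff_le_refl_diff[of x k y] x y by (simp add: a_def b_def)
  have bD: "b \<le> D + norm y" using norm_triangle_ineq4[of "refl_pt k x" y] D by (simp add: b_def)
  have "a powr e * b\<^sup>2 \<le> b powr e * b\<^sup>2"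
    using a ab e by (intro mult_right_mono powr_mono2) auto
  also have "\<dots> = b powr (e + 2)" using a ab by (simp add: powr_add powr_numeral)
  also have "\<dots> \<le> (D + norm y) powr (e + 2)" using a ab bD e by (intro powr_mono2) auto
  also have "\<dots> \<le> (2 * D) powr (e + 2) * (1 + norm y powr (e + 2))"
    using D e by (intro powr_sum_le) auto
  finally have le: "a powr e * b\<^sup>2 \<le> (2 * D) powr (e + 2) * (1 + norm y powr (e + 2))" .
  have pos: "a powr e * b\<^sup>2 > 0" using a ab by simp
  have "2 / (2 * D) powr (e + 2) * x $ k * y $ k / (1 + norm y powr (e + 2)) = 2 * (x $ k * y $ k / ((2 * D) powr (e + 2) * (1 + norm y powr (e + 2))))"
    by simp
  also have "\<dots> \<le> 2 * (x $ k * y $ k / (a powr e * b\<^sup>2))"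
    using x y pos le by (intro mult_left_mono divide_left_mono mult_pos_pos) (auto intro: order_less_le_trans add_pos_nonneg)
  also have "\<dots> \<le> frac_kernel k s x y"
    using frac_kernel_bounds(1)[OF s x y xy] by (simp add: a_def b_def e_def)
  finally show ?thesis by (simp add: e_def)
qed

end

lemma borel_measurable_nth [measurable]: "(\<lambda>y::real^'n::finite. y $ i) \<in> borel_measurable borel"
  by (intro borel_measurable_continuous_onI continuous_intros)

lemma halfsp_borel [measurable]: "halfsp k \<in> sets borel"
  unfolding halfsp_def by measurable

lemma frac_kernel_borel [measurable]: "(\<lambda>y. frac_kernel k s x y) \<in> borel_measurable borel"
  unfolding frac_kernel_def by measurable

lemma As_weight_nonneg: "y \<in> halfsp k \<Longrightarrow> As_weight s u k y \<ge> 0"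
  by (auto simp: As_weight_def halfsp_def)

lemma integral_reflect_vec:
  fixes f :: "real^'n::finite \<Rightarrow> real" and x :: "real^'n"
  assumes "integrable lebesgue f"
  shows "integrable lebesgue (\<lambda>y. f (x - y))" "integral\<^sup>L lebesgue (\<lambda>y. f (x - y)) = integral\<^sup>L lebesgue f"
proof -
  have T: "(\<lambda>y. x - y) \<in> lebesgue \<rightarrow>\<^sub>M lebesgue" "distr lebesgue lebesgue (\<lambda>y. x - y) = lebesgue"
    using vec_affine_preserves_lebesgue[of "\<lambda>_. -1" x] by (simp_all add: minus_vec_def)
  show "integrable lebesgue (\<lambda>y. f (x - y))"
    using assms T integrable_distr[of "\<lambda>y. x - y" lebesgue lebesgue f] by simp
  show "integral\<^sup>L lebesgue (\<lambda>y. f (x - y)) = integral\<^sup>L lebesgue f"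
    using integral_distr[OF T(1), of f] T(2) assms by simp
qed

lemma ball_radial_integral_at:
  fixes \<sigma> :: real
  assumes sg: "\<sigma> > 0"
  shows "\<exists>C>0. \<forall>r>0. \<forall>x::real^'n::finite. set_integrable lebesgue (ball x r) (\<lambda>y. norm (x - y) powr (\<sigma> - real CARD('n))) \<and>
     (LINT y : ball x r | lebesgue. norm (x - y) powr (\<sigma> - real CARD('n))) \<le> C * r powr \<sigma>"
proof -
  obtain C where C: "C > 0" and 1: "\<And>r. r > 0 \<Longrightarrow> set_integrable lebesgue (ball (0::real^'n) r) (\<lambda>h. norm h powr (\<sigma> - real CARD('n))) \<and>
     (LINT h : ball (0::real^'n) r | lebesgue. norm h powr (\<sigma> - real CARD('n))) \<le> C * r powr \<sigma>"
    using ball_radial_integral[OF sg, where 'a="real^'n"] by auto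
  have ind: "indicator (ball (0::real^'n) r) (x - y) = (indicator (ball x r) y :: real)" for r x y
    by (simp add: indicator_def dist_norm norm_minus_commute)
  show ?thesis
  proof (intro exI[of _ C] conjI allI impI C)
    fix r :: real and x :: "real^'n" assume r: "r > 0"
    show "set_integrable lebesgue (ball x r) (\<lambda>y. norm (x - y) powr (\<sigma> - real CARD('n)))"
      "(LINT y : ball x r | lebesgue. norm (x - y) powr (\<sigma> - real CARD('n))) \<le> C * r powr \<sigma>"
      using 1[OF r] integral_reflect_vec[of "\<lambda>h. indicator (ball (0::real^'n) r) h * norm h powr (\<sigma> - real CARD('n))" x]
      by (simp_all add: set_integrable_def set_lebesgue_integral_def ind)
  qed
qed

lemma ball_compl_radial_integral_at:
  fixes \<sigma> r :: real
  assumes sg: "\<sigma> > 0" and r: "r > 0"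
  shows "\<exists>C>0. \<forall>x::real^'n::finite. set_integrable lebesgue (- ball x r) (\<lambda>y. norm (x - y) powr (- \<sigma> - real CARD('n))) \<and>
     (LINT y : - ball x r | lebesgue. norm (x - y) powr (- \<sigma> - real CARD('n))) \<le> C"
proof -
  \<comment> \<open>The integral is the same for every centre; the 1 only makes the constant
    positive.\<close>
  define C where "C = 1 + (LINT h : - ball (0::real^'n) r | lebesgue. norm h powr (- \<sigma> - real CARD('n)))"
  have 1: "set_integrable lebesgue (- ball (0::real^'n) r) (\<lambda>h. norm h powr (- \<sigma> - real CARD('n)))"
    using ball_compl_radial_integrable[OF assms, where 'a="real^'n"] by auto
  have C: "C > 0" unfolding C_def set_lebesgue_integral_def by (intro add_pos_nonneg integral_nonneg_AE) auto
  have ind: "indicator (- ball (0::real^'n) r) (x - y) = (indicator (- ball x r) y :: real)" for r x y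
    by (simp add: indicator_def dist_norm norm_minus_commute)
  show ?thesis
  proof (intro exI[of _ C] conjI allI impI C)
    fix x :: "real^'n"
    show "set_integrable lebesgue (- ball x r) (\<lambda>y. norm (x - y) powr (- \<sigma> - real CARD('n)))"
      "(LINT y : - ball x r | lebesgue. norm (x - y) powr (- \<sigma> - real CARD('n))) \<le> C"
      using 1 integral_reflect_vec[of "\<lambda>h. indicator (- ball (0::real^'n) r) h * norm h powr (- \<sigma> - real CARD('n))" x]
      by (simp_all add: set_integrable_def set_lebesgue_integral_def ind C_def)
  qed
qed

section \<open>The normalising constant\<close>

lemma nn_integral_gauss:
  assumes "t > 0"
  shows "(\<integral>\<^sup>+y. ennreal (exp (- t * (c - y)\<^sup>2)) \<partial>lborel) = ennreal (sqrt (pi / t))"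
proof -
  have "has_bochner_integral lborel (\<lambda>x::real. exp (- x\<^sup>2)) (sqrt pi)"
    using has_bochner_integral_even_function[OF gaussian_moment_0] by simp
  then have I: "(\<integral>\<^sup>+x. ennreal (exp (- x\<^sup>2)) \<partial>lborel) = ennreal (sqrt pi)"
    by (subst nn_integral_eq_integral) (auto simp: has_bochner_integral_iff)
  have "(\<integral>\<^sup>+y. ennreal (exp (- y\<^sup>2)) \<partial>lborel) =
      ennreal \<bar>sqrt t\<bar> * (\<integral>\<^sup>+y. ennreal (exp (- (- sqrt t * c + sqrt t * y)\<^sup>2)) \<partial>lborel)"
    using assms by (intro nn_integral_real_affine) auto
  also have "(\<lambda>y. - (- sqrt t * c + sqrt t * y)\<^sup>2) = (\<lambda>y. - t * (c - y)\<^sup>2)"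
  proof
    fix y
    have "- sqrt t * c + sqrt t * y = - (sqrt t * (c - y))" by (simp add: algebra_simps)
    then show "- (- sqrt t * c + sqrt t * y)\<^sup>2 = - t * (c - y)\<^sup>2"
      using assms by (simp only: power2_minus power_mult_distrib) simp
  qed
  finally have "ennreal (sqrt pi) = ennreal (sqrt t) * (\<integral>\<^sup>+y. ennreal (exp (- t * (c - y)\<^sup>2)) \<partial>lborel)"
    using I assms by simp
  then have "ennreal (1 / sqrt t) * ennreal (sqrt pi) =
      (ennreal (1 / sqrt t) * ennreal (sqrt t)) * (\<integral>\<^sup>+y. ennreal (exp (- t * (c - y)\<^sup>2)) \<partial>lborel)"
    by (simp add: mult.assoc)
  moreover have "ennreal (1 / sqrt t) * ennreal (sqrt t) = 1"
    using assms by (simp add: ennreal_mult[symmetric])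
  ultimately show ?thesis
    using assms by (simp add: ennreal_mult[symmetric] real_sqrt_divide)
qed

lemma nn_integral_gamma_scaled:
  assumes p: "p > 0" and b: "b > 0"
  shows "(\<integral>\<^sup>+t. ennreal (indicator {0..} t * t powr (p - 1) * exp (- t * b)) \<partial>lborel) = ennreal (Gamma p * b powr - p)"
proof -
  have "ennreal (Gamma p) = (\<integral>\<^sup>+t. ennreal (indicator {0..} t * t powr (p - 1) / exp t) \<partial>lborel)"
    by (rule Gamma_conv_nn_integral_real[OF p])
  also have "\<dots> = ennreal \<bar>b\<bar> * (\<integral>\<^sup>+t. ennreal (indicator {0..} (0 + b * t) * (0 + b * t) powr (p - 1) / exp (0 + b * t)) \<partial>lborel)"
    using b by (intro nn_integral_real_affine) auto
  also have "\<dots> = ennreal b * (\<integral>\<^sup>+t. ennreal (b powr (p - 1)) * ennreal (indicator {0..} t * t powr (p - 1) * exp (- t * b)) \<partial>lborel)"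
    using b by (intro arg_cong2[where f="(*)"] nn_integral_cong)
      (auto simp: ennreal_mult[symmetric] indicator_def zero_le_mult_iff powr_mult exp_minus field_simps)
  also have "\<dots> = ennreal b * ennreal (b powr (p - 1)) * (\<integral>\<^sup>+t. ennreal (indicator {0..} t * t powr (p - 1) * exp (- t * b)) \<partial>lborel)"
    by (simp add: nn_integral_cmult mult.assoc)
  also have "ennreal b * ennreal (b powr (p - 1)) = ennreal (b powr p)"
    using b by (simp add: ennreal_mult[symmetric] powr_diff)
  finally have *: "ennreal (Gamma p) = ennreal (b powr p) * (\<integral>\<^sup>+t. ennreal (indicator {0..} t * t powr (p - 1) * exp (- t * b)) \<partial>lborel)" .
  have "ennreal (Gamma p * b powr - p) = ennreal (b powr - p) * ennreal (Gamma p)"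
    using p by (simp add: ennreal_mult[symmetric] Gamma_real_pos mult.commute order_less_imp_le)
  also have "\<dots> = (ennreal (b powr - p) * ennreal (b powr p)) * (\<integral>\<^sup>+t. ennreal (indicator {0..} t * t powr (p - 1) * exp (- t * b)) \<partial>lborel)"
    unfolding * by (simp add: mult.assoc)
  also have "ennreal (b powr - p) * ennreal (b powr p) = 1"
    using b by (simp add: ennreal_mult[symmetric] powr_minus)
  finally show ?thesis by simp
qed

text \<open>The Gaussian factorises over coordinates: coordinate \<open>k\<close> keeps its
  half-line, and each of the other n - 1 contributes \<open>sqrt (pi / t)\<close>.\<close>

lemma nn_integral_gauss_halfsp:
  fixes z :: "real^'n::finite"
  assumes t: "t > 0"
  shows "(\<integral>\<^sup>+y. ennreal (indicator (halfsp k) y * exp (- t * (norm (z - y))\<^sup>2)) \<partial>lborel) =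
    ennreal ((pi / t) powr ((real CARD('n) - 1) / 2)) *
      (\<integral>\<^sup>+a. ennreal (indicator {0<..} a * exp (- t * (z $ k - a)\<^sup>2)) \<partial>lborel)"
proof -
  define bk where "bk = (axis k 1 :: real^'n)"
  have bk: "bk \<in> Basis" by (simp add: bk_def axis_in_Basis_iff)
  define g where "g b a = (if b = bk then indicator {0<..} a else 1) * exp (- t * (z \<bullet> b - a)\<^sup>2)" for b :: "real^'n" and a :: real
  have prod: "indicator (halfsp k) y * exp (- t * (norm (z - y))\<^sup>2) = (\<Prod>b\<in>Basis. g b (y \<bullet> b))" for y
  proof -
    have "(norm (z - y))\<^sup>2 = (\<Sum>b\<in>Basis. (z \<bullet> b - y \<bullet> b)\<^sup>2)"
      unfolding power2_norm_eq_inner by (subst euclidean_inner) (simp add: inner_diff_left power2_eq_square)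
    then have 1: "exp (- t * (norm (z - y))\<^sup>2) = (\<Prod>b\<in>Basis. exp (- t * (z \<bullet> b - y \<bullet> b)\<^sup>2))"
      by (simp add: exp_sum[symmetric] sum_distrib_left sum_negf)
    have 2: "(\<Prod>b\<in>Basis. if b = bk then indicator {0<..} (y \<bullet> b) else 1) = (indicator {0<..} (y \<bullet> bk) :: real)"
      using bk by (simp add: prod.delta)
    show ?thesis
      unfolding g_def prod.distrib 1 2 by (simp add: bk_def inner_axis halfsp_def indicator_def)
  qed
  have "(\<integral>\<^sup>+y. ennreal (indicator (halfsp k) y * exp (- t * (norm (z - y))\<^sup>2)) \<partial>lborel) =
    (\<integral>\<^sup>+y. (\<Prod>b\<in>Basis. ennreal (g b (y \<bullet> b))) \<partial>lborel)"
    unfolding prod by (intro nn_integral_cong prod_ennreal[symmetric]) (auto simp: g_def)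
  also have "\<dots> = (\<Prod>b\<in>Basis. (\<integral>\<^sup>+a. ennreal (g b a) \<partial>lborel))"
    by (rule nn_integral_lborel_prod) (auto simp: g_def)
  also have "\<dots> = (\<integral>\<^sup>+a. ennreal (g bk a) \<partial>lborel) * (\<Prod>b\<in>Basis - {bk}. (\<integral>\<^sup>+a. ennreal (g b a) \<partial>lborel))"
    using bk by (simp add: prod.remove)
  also have "(\<Prod>b\<in>Basis - {bk}. (\<integral>\<^sup>+a. ennreal (g b a) \<partial>lborel)) = (\<Prod>b\<in>Basis - {bk}. ennreal (sqrt (pi / t)))"
    by (intro prod.cong refl) (use nn_integral_gauss[OF t] in \<open>auto simp: g_def\<close>)
  also have "\<dots> = ennreal (sqrt (pi / t) ^ (CARD('n) - 1))"
    using bk t by (simp add: card_Diff_singleton ennreal_power)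
  also have "sqrt (pi / t) ^ (CARD('n) - 1) = (pi / t) powr ((real CARD('n) - 1) / 2)"
  proof -
    have "sqrt (pi / t) ^ (CARD('n) - 1) = sqrt (pi / t) powr (real (CARD('n) - 1))"
      using t by (subst powr_realpow) auto
    also have "\<dots> = (pi / t) powr ((real CARD('n) - 1) / 2)"
      using t by (simp add: powr_half_sqrt[symmetric] powr_powr of_nat_diff Suc_le_eq)
    finally show ?thesis .
  qed
  also have "(\<lambda>a. ennreal (g bk a)) = (\<lambda>a. ennreal (indicator {0<..} a * exp (- t * (z $ k - a)\<^sup>2)))"
    by (simp add: g_def bk_def inner_axis)
  finally show ?thesis by (simp add: mult.commute)
qed

text \<open>Writing the power as a Gamma integral of Gaussians turns the integral over the half space into a
  product of one-dimensional ones.\<close>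

lemma nn_integral_powr_refl:
  fixes x :: "real^'n::finite"
  assumes s: "s > 0" and x: "x $ k > 0"
  defines "n \<equiv> real CARD('n)"
  shows "(\<integral>\<^sup>+y. ennreal (indicator (halfsp k) y * norm (refl_pt k x - y) powr - (n + 2 * s)) \<partial>lborel) =
    ennreal (pi powr ((n - 1) / 2) * Gamma (s + 1 / 2) / Gamma ((n + 2 * s) / 2) * (x $ k) powr (- 2 * s) / (2 * s))"
proof -
  define q where "q = (n + 2 * s) / 2"
  define z where "z = refl_pt k x"
  have n: "n \<ge> 1" by (simp add: n_def Suc_le_eq)
  have q: "q > 0" using n s by (simp add: q_def)
  have Gq: "Gamma q > 0" using q by (rule Gamma_real_pos)
  have Gs: "Gamma (s + 1/2) > 0" using s by (intro Gamma_real_pos) auto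
  have zk: "z $ k = - x $ k" by (simp add: z_def refl_pt_def)
  have pos: "norm (z - y) > 0" if "y \<in> halfsp k" for y
    using that x nth_add_le_refl_diff[of x k y] by (auto simp: halfsp_def z_def)
  let ?G = "\<lambda>t. indicator {0..} t * t powr (q - 1)"
  have "(\<integral>\<^sup>+y. ennreal (Gamma q * (indicator (halfsp k) y * norm (z - y) powr - (n + 2 * s))) \<partial>lborel) =
    (\<integral>\<^sup>+y. \<integral>\<^sup>+t. ennreal (indicator (halfsp k) y * (?G t * exp (- t * (norm (z - y))\<^sup>2))) \<partial>lborel \<partial>lborel)"
  proof (rule nn_integral_cong)
    fix y
    show "ennreal (Gamma q * (indicator (halfsp k) y * norm (z - y) powr - (n + 2 * s))) =
      (\<integral>\<^sup>+t. ennreal (indicator (halfsp k) y * (?G t * exp (- t * (norm (z - y))\<^sup>2))) \<partial>lborel)"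
    proof (cases "y \<in> halfsp k")
      case True
      have "((norm (z - y))\<^sup>2) powr - q = norm (z - y) powr - (n + 2 * s)"
      proof -
        have "((norm (z - y))\<^sup>2) powr - q = (norm (z - y) powr 2) powr - q"
          using pos[OF True] by (simp add: powr_numeral)
        also have "\<dots> = norm (z - y) powr (2 * - q)" by (rule powr_powr)
        also have "2 * - q = - (n + 2 * s)" by (simp add: q_def field_simps)
        finally show ?thesis .
      qed
      then show ?thesis
        using nn_integral_gamma_scaled[OF q, of "(norm (z - y))\<^sup>2"] pos[OF True] True by simp
    qed simp
  qed
  also have "\<dots> = (\<integral>\<^sup>+t. \<integral>\<^sup>+y. ennreal (indicator (halfsp k) y * (?G t * exp (- t * (norm (z - y))\<^sup>2))) \<partial>lborel \<partial>lborel)"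
    by (rule lborel_pair.Fubini') measurable
  also have "\<dots> = (\<integral>\<^sup>+t. \<integral>\<^sup>+a. ennreal (indicator {0<..} a * (pi powr ((n - 1) / 2) * (indicator {0..} t * t powr (s + 1 / 2 - 1) * exp (- t * (z $ k - a)\<^sup>2)))) \<partial>lborel \<partial>lborel)"
  \<comment> \<open>The Gaussian formula needs t > 0; the point 0 is a null set, and negative t are
    killed by the indicator.\<close>
  proof (rule nn_integral_cong_AE, rule AE_mp[OF AE_lborel_singleton[of 0]], intro always_eventually allI impI)
    fix t :: real assume t0: "t \<noteq> 0"
    show "(\<integral>\<^sup>+y. ennreal (indicator (halfsp k) y * (?G t * exp (- t * (norm (z - y))\<^sup>2))) \<partial>lborel) =
      (\<integral>\<^sup>+a. ennreal (indicator {0<..} a * (pi powr ((n - 1) / 2) * (indicator {0..} t * t powr (s + 1 / 2 - 1) * exp (- t * (z $ k - a)\<^sup>2)))) \<partial>lborel)"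
    proof (cases "t > 0")
      case False
      then show ?thesis using t0 by simp
    next
      case t: True
      have "(\<integral>\<^sup>+y. ennreal (indicator (halfsp k) y * (?G t * exp (- t * (norm (z - y))\<^sup>2))) \<partial>lborel) =
        (\<integral>\<^sup>+y. ennreal (t powr (q - 1)) * ennreal (indicator (halfsp k) y * exp (- t * (norm (z - y))\<^sup>2)) \<partial>lborel)"
        using t by (intro nn_integral_cong) (simp add: ennreal_mult[symmetric] mult_ac)
      also have "\<dots> = ennreal (t powr (q - 1)) * (ennreal ((pi / t) powr ((n - 1) / 2)) *
        (\<integral>\<^sup>+a. ennreal (indicator {0<..} a * exp (- t * (z $ k - a)\<^sup>2)) \<partial>lborel))"
        unfolding n_def nn_integral_gauss_halfsp[OF t, symmetric] by (rule nn_integral_cmult) measurable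
      also have "\<dots> = ennreal (t powr (q - 1) * (pi / t) powr ((n - 1) / 2)) *
        (\<integral>\<^sup>+a. ennreal (indicator {0<..} a * exp (- t * (z $ k - a)\<^sup>2)) \<partial>lborel)"
        by (simp add: ennreal_mult mult.assoc)
      \<comment> \<open>The n - 1 tangential Gaussians consume exactly the dimension, and the
        remaining exponent depends on s alone. This is why the constant of dimension one appears in
        the zero order term.\<close>
      also have "t powr (q - 1) * (pi / t) powr ((n - 1) / 2) = pi powr ((n - 1) / 2) * t powr (s + 1 / 2 - 1)"
      proof -
        have "t powr (q - 1) / t powr ((n - 1) / 2) = t powr (q - 1 - (n - 1) / 2)"
          by (simp add: powr_diff)
        also have "q - 1 - (n - 1) / 2 = s + 1 / 2 - 1" by (simp add: q_def field_simps)
        finally show ?thesis using t by (simp add: powr_divide field_simps)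
      qed
      also have "ennreal (pi powr ((n - 1) / 2) * t powr (s + 1 / 2 - 1)) *
         (\<integral>\<^sup>+a. ennreal (indicator {0<..} a * exp (- t * (z $ k - a)\<^sup>2)) \<partial>lborel) =
         (\<integral>\<^sup>+a. ennreal (pi powr ((n - 1) / 2) * t powr (s + 1 / 2 - 1)) * ennreal (indicator {0<..} a * exp (- t * (z $ k - a)\<^sup>2)) \<partial>lborel)"
        by (rule nn_integral_cmult[symmetric]) measurable
      finally show ?thesis
        using t by (simp add: ennreal_mult[symmetric] mult_ac)
    qed
  qed
  also have "\<dots> = (\<integral>\<^sup>+a. \<integral>\<^sup>+t. ennreal (indicator {0<..} a * (pi powr ((n - 1) / 2) * (indicator {0..} t * t powr (s + 1 / 2 - 1) * exp (- t * (z $ k - a)\<^sup>2)))) \<partial>lborel \<partial>lborel)"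
    by (rule lborel_pair.Fubini') measurable
  also have "\<dots> = (\<integral>\<^sup>+a. ennreal (pi powr ((n - 1) / 2) * Gamma (s + 1 / 2)) * ennreal (indicator {0<..} a * (x $ k + a) powr (- (2 * s) - 1)) \<partial>lborel)"
  proof (rule nn_integral_cong)
    fix a :: real
    show "(\<integral>\<^sup>+t. ennreal (indicator {0<..} a * (pi powr ((n - 1) / 2) * (indicator {0..} t * t powr (s + 1 / 2 - 1) * exp (- t * (z $ k - a)\<^sup>2)))) \<partial>lborel) =
      ennreal (pi powr ((n - 1) / 2) * Gamma (s + 1 / 2)) * ennreal (indicator {0<..} a * (x $ k + a) powr (- (2 * s) - 1))"
    proof (cases "a > 0")
      case a: True
      have sq: "(z $ k - a)\<^sup>2 = (x $ k + a)\<^sup>2" by (simp add: zk power2_eq_square algebra_simps)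
      have pw: "((x $ k + a)\<^sup>2) powr - (s + 1 / 2) = (x $ k + a) powr (- (2 * s) - 1)"
        using x a by (simp add: powr_numeral[symmetric] powr_powr algebra_simps del: powr_numeral)
      have "(\<integral>\<^sup>+t. ennreal (indicator {0<..} a * (pi powr ((n - 1) / 2) * (indicator {0..} t * t powr (s + 1 / 2 - 1) * exp (- t * (z $ k - a)\<^sup>2)))) \<partial>lborel) =
        (\<integral>\<^sup>+t. ennreal (pi powr ((n - 1) / 2)) * ennreal (indicator {0..} t * t powr (s + 1 / 2 - 1) * exp (- t * (x $ k + a)\<^sup>2)) \<partial>lborel)"
        unfolding sq using a by (intro nn_integral_cong) (simp add: ennreal_mult[symmetric])
      also have "\<dots> = ennreal (pi powr ((n - 1) / 2)) * ennreal (Gamma (s + 1 / 2) * ((x $ k + a)\<^sup>2) powr - (s + 1 / 2))"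
        using s x a nn_integral_gamma_scaled[of "s + 1 / 2" "(x $ k + a)\<^sup>2"] by (subst nn_integral_cmult) auto
      finally show ?thesis unfolding pw using a Gs by (simp add: ennreal_mult[symmetric] mult_ac)
    qed simp
  qed
  also have "\<dots> = ennreal (pi powr ((n - 1) / 2) * Gamma (s + 1 / 2)) * (\<integral>\<^sup>+a. ennreal (indicator {0<..} a * (x $ k + a) powr (- (2 * s) - 1)) \<partial>lborel)"
    by (rule nn_integral_cmult) measurable
  also have "(\<integral>\<^sup>+a. ennreal (indicator {0<..} a * (x $ k + a) powr (- (2 * s) - 1)) \<partial>lborel) = ennreal (x $ k powr - (2 * s) / (2 * s))"
  proof -
    have "ennreal (x $ k powr - (2 * s) / (2 * s)) = (\<integral>\<^sup>+a. ennreal (indicator {x $ k..} a * a powr (- (2 * s) - 1)) \<partial>lborel)"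
      using s x by (intro nn_integral_powr_to_inf[symmetric]) auto
    also have "\<dots> = ennreal \<bar>1\<bar> * (\<integral>\<^sup>+a. ennreal (indicator {x $ k..} (x $ k + 1 * a) * (x $ k + 1 * a) powr (- (2 * s) - 1)) \<partial>lborel)"
      by (rule nn_integral_real_affine) auto
    also have "\<dots> = (\<integral>\<^sup>+a. ennreal (indicator {0<..} a * (x $ k + a) powr (- (2 * s) - 1)) \<partial>lborel)"
      by (simp, rule nn_integral_cong_AE, rule AE_mp[OF AE_lborel_singleton[of 0]]) (auto simp: indicator_def)
    finally show ?thesis by simp
  qed
  finally have main: "(\<integral>\<^sup>+y. ennreal (Gamma q * (indicator (halfsp k) y * norm (z - y) powr - (n + 2 * s))) \<partial>lborel) =
    ennreal (pi powr ((n - 1) / 2) * Gamma (s + 1 / 2)) * ennreal (x $ k powr - (2 * s) / (2 * s))" .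
  have "(\<integral>\<^sup>+y. ennreal (indicator (halfsp k) y * norm (z - y) powr - (n + 2 * s)) \<partial>lborel) =
    (\<integral>\<^sup>+y. ennreal (1 / Gamma q) * ennreal (Gamma q * (indicator (halfsp k) y * norm (z - y) powr - (n + 2 * s))) \<partial>lborel)"
    using Gq by (intro nn_integral_cong) (simp add: ennreal_mult[symmetric])
  also have "\<dots> = ennreal (1 / Gamma q) * (\<integral>\<^sup>+y. ennreal (Gamma q * (indicator (halfsp k) y * norm (z - y) powr - (n + 2 * s))) \<partial>lborel)"
    by (rule nn_integral_cmult) measurable
  also have "\<dots> = ennreal (pi powr ((n - 1) / 2) * Gamma (s + 1 / 2) / Gamma q * (x $ k) powr (- 2 * s) / (2 * s))"
    unfolding main using Gq Gs s by (simp add: ennreal_mult[symmetric] mult_ac)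
  finally show ?thesis unfolding z_def q_def .
qed

lemma c_const_pos:
  assumes "0 < s" "s < 1"
  shows "c_const n s > 0"
  using assms by (simp add: c_const_def Gamma_real_pos)

text \<open>The zero order coefficient of the operator is twice the mass of the reflected kernel
  over the half space, times \<open>c_const CARD('n) s\<close>. The Gamma factors in n cancel, and
  \<open>s + 1 / 2\<close> is the Gamma argument \<open>(1 + 2 * s) / 2\<close> belonging to
  dimension one.\<close>

lemma integral_powr_refl:
  fixes x :: "real^'n::finite"
  assumes s: "0 < s" "s < 1" and x: "x $ k > 0"
  shows "set_integrable lebesgue (halfsp k) (\<lambda>y. norm (refl_pt k x - y) powr - (real CARD('n) + 2 * s))"
    and "2 * c_const CARD('n) s * (LINT y : halfsp k | lebesgue. norm (refl_pt k x - y) powr - (real CARD('n) + 2 * s)) =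
      c_const 1 s / s * (x $ k) powr (- 2 * s)"
proof -
  define n where "n = real CARD('n)"
  define I where "I = pi powr ((n - 1) / 2) * Gamma (s + 1 / 2) / Gamma ((n + 2 * s) / 2) * (x $ k) powr (- 2 * s) / (2 * s)"
  let ?f = "\<lambda>y. indicator (halfsp k) y * norm (refl_pt k x - y) powr - (n + 2 * s)"
  have n: "n \<ge> 1" by (simp add: n_def Suc_le_eq)
  have Gn: "Gamma ((n + 2 * s) / 2) > 0" using n s by (intro Gamma_real_pos) auto
  have Gs: "Gamma (s + 1/2) > 0" using s by (intro Gamma_real_pos) auto
  have G1: "Gamma (1 - s) > 0" using s by (intro Gamma_real_pos) auto
  have I0: "I \<ge> 0" using s Gn Gs by (simp add: I_def)
  have nn: "(\<integral>\<^sup>+y. ennreal (?f y) \<partial>lebesgue) = ennreal I"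
    using nn_integral_powr_refl[OF s(1) x] by (simp add: nn_integral_completion n_def I_def)
  have meas: "?f \<in> borel_measurable lebesgue"
    by (intro measurable_completion) measurable
  have int: "integrable lebesgue ?f"
    by (rule integrableI_nonneg[OF meas]) (use nn in auto)
  then show "set_integrable lebesgue (halfsp k) (\<lambda>y. norm (refl_pt k x - y) powr - (real CARD('n) + 2 * s))"
    by (simp add: set_integrable_def n_def)
  have "ennreal (integral\<^sup>L lebesgue ?f) = ennreal I"
    using nn nn_integral_eq_integral[OF int] by simp
  moreover have "integral\<^sup>L lebesgue ?f \<ge> 0" by (rule integral_nonneg_AE) auto
  ultimately have "integral\<^sup>L lebesgue ?f = I" using I0 by simp
  then have L: "(LINT y : halfsp k | lebesgue. norm (refl_pt k x - y) powr - (real CARD('n) + 2 * s)) = I"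
    by (simp add: set_lebesgue_integral_def n_def)
  have p: "pi powr ((n - 1) / 2) * pi powr (1 / 2) = pi powr (n / 2)"
    by (simp add: powr_add[symmetric] field_simps)
  have "2 * c_const CARD('n) s * I = s * 4 powr s / Gamma (1 - s) * (x $ k) powr (- 2 * s) / s * Gamma (s + 1/2) * (pi powr ((n - 1) / 2) / pi powr (n / 2))"
    using s Gn G1 unfolding c_const_def I_def n_def[symmetric] by (simp add: mult_ac)
  also have "pi powr ((n - 1) / 2) / pi powr (n / 2) = 1 / pi powr (1 / 2)"
    unfolding p[symmetric] by simp
  also have "s * 4 powr s / Gamma (1 - s) * (x $ k) powr (- 2 * s) / s * Gamma (s + 1/2) * (1 / pi powr (1 / 2)) = c_const 1 s / s * (x $ k) powr (- 2 * s)"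
    by (simp add: c_const_def add_divide_distrib add.commute mult_ac)
  finally show "2 * c_const CARD('n) s * (LINT y : halfsp k | lebesgue. norm (refl_pt k x - y) powr - (real CARD('n) + 2 * s)) =
      c_const 1 s / s * (x $ k) powr (- 2 * s)"
    unfolding L .
qed

section \<open>The operator applied to the linear function\<close>

lemma borel_imp_lebesgue_measurable:
  "f \<in> borel_measurable borel \<Longrightarrow> f \<in> borel_measurable (lebesgue :: 'a::euclidean_space measure)"
  by (simp add: measurable_completion)

lemma set_integrable_dominated:
  fixes f g :: "'a::euclidean_space \<Rightarrow> real"
  assumes g: "set_integrable lebesgue T g"
    and f: "f \<in> borel_measurable borel" and S: "S \<in> sets borel" "S \<subseteq> T"
    and le: "\<And>y. y \<in> S \<Longrightarrow> \<bar>f y\<bar> \<le> g y"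
    and nn: "\<And>y. y \<in> T \<Longrightarrow> 0 \<le> g y"
  shows "set_integrable lebesgue S f" "\<bar>LINT y : S | lebesgue. f y\<bar> \<le> (LINT y : T | lebesgue. g y)"
proof -
  note [measurable] = f S(1)
  have meas: "(\<lambda>y. indicator S y *\<^sub>R f y) \<in> borel_measurable lebesgue"
    by (intro borel_imp_lebesgue_measurable) measurable
  have bd: "\<bar>indicator S y *\<^sub>R f y\<bar> \<le> indicator T y *\<^sub>R g y" for y
    using le nn S by (auto simp: indicator_def)
  have i: "integrable lebesgue (\<lambda>y. indicator S y *\<^sub>R f y)"
    by (rule Bochner_Integration.integrable_bound[OF g[unfolded set_integrable_def] meas])
       (use bd in \<open>auto intro!: always_eventually intro: order_trans[OF _ abs_ge_self]\<close>)
  then show "set_integrable lebesgue S f" by (simp add: set_integrable_def)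
  show "\<bar>LINT y : S | lebesgue. f y\<bar> \<le> (LINT y : T | lebesgue. g y)"
    unfolding set_lebesgue_integral_def
    using Bochner_Integration.integral_norm_bound_integral[OF i g[unfolded set_integrable_def]] bd by simp
qed

lemma reflect_point_preserves:
  fixes x :: "real^'n::finite"
  shows "(\<lambda>y. 2 *\<^sub>R x - y) \<in> lebesgue \<rightarrow>\<^sub>M lebesgue" "distr lebesgue lebesgue (\<lambda>y. 2 *\<^sub>R x - y) = lebesgue"
proof -
  have eq: "(\<lambda>y. \<chi> i. (2 *\<^sub>R x) $ i + -1 * y $ i) = (\<lambda>y. 2 *\<^sub>R x - y)"
    by (simp add: vec_eq_iff fun_eq_iff)
  show "(\<lambda>y. 2 *\<^sub>R x - y) \<in> lebesgue \<rightarrow>\<^sub>M lebesgue" "distr lebesgue lebesgue (\<lambda>y. 2 *\<^sub>R x - y) = lebesgue"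
    using vec_affine_preserves_lebesgue[of "\<lambda>_. -1" "2 *\<^sub>R x"] unfolding eq by simp_all
qed

lemma refl_pt_preserves:
  fixes k :: "'n::finite"
  shows
  "refl_pt k \<in> lebesgue \<rightarrow>\<^sub>M lebesgue" "distr lebesgue lebesgue (refl_pt k) = lebesgue"
proof -
  have eq: "(\<lambda>y. \<chi> i. (0 :: real^'n::finite) $ i + (if i = k then -1 else 1) * y $ i) = refl_pt k"
    by (auto simp: vec_eq_iff fun_eq_iff refl_pt_def)
  show "refl_pt k \<in> lebesgue \<rightarrow>\<^sub>M lebesgue" "distr lebesgue lebesgue (refl_pt k) = lebesgue"
    using vec_affine_preserves_lebesgue[of "\<lambda>i. if i = k then -1 else 1" 0] unfolding eq by simp_all
qed

lemma refl_pt_refl_pt [simp]: "refl_pt k (refl_pt k x) = x"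
  by (simp add: refl_pt_def vec_eq_iff)

lemma refl_pt_nth: "refl_pt k x $ i = (if i = k then - x $ i else x $ i)"
  by (simp add: refl_pt_def)

lemma norm_refl_pt_swap: "norm (x - refl_pt k y) = norm (refl_pt k x - y)"
proof -
  have "refl_pt k (x - refl_pt k y) = refl_pt k x - y"
    by (simp add: refl_pt_def vec_eq_iff)
  then show ?thesis by (metis norm_refl_pt)
qed

lemma borel_measurable_refl_pt [measurable]: "refl_pt (k::'n::finite) \<in> borel_measurable borel"
proof -
  have "continuous_on UNIV (refl_pt k)"
    unfolding refl_pt_def
  proof (intro continuous_on_vec_lambda)
    fix i
    have "continuous_on UNIV (\<lambda>x::real^'n. x $ i)" by (intro continuous_intros)
    then show "continuous_on UNIV (\<lambda>x::real^'n. if i = k then - x $ i else x $ i)"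
      using continuous_on_minus[of UNIV "\<lambda>x::real^'n. x $ i"] by (cases "i = k") simp_all
  qed
  then show ?thesis by (rule borel_measurable_continuous_onI)
qed

lemma AE_nth_neq_0: "AE y in (lebesgue :: (real^'n::finite) measure). y $ k \<noteq> 0"
proof -
  have "negligible {y :: real^'n. y \<bullet> axis k 1 = 0}"
    by (rule negligible_standard_hyperplane) (simp add: axis_in_Basis_iff)
  then have "negligible {y :: real^'n. y $ k = 0}" by (simp add: inner_axis)
  then show ?thesis by (simp add: eventually_ae_filter negligible_iff_null_sets) blast
qed

context
  fixes k :: "'n::finite" and s :: real
  assumes s: "0 < s" "s < 1"
begin

text \<open>The direct power times a linear function is not integrable at infinity when 2s is at
  most 1. The reflected kernel rescues it: the difference gains \<open>x $ k * y $ k\<close> over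
  the squared distance, and outside the ball \<open>y $ k\<close> is at most
  \<open>x $ k / \<epsilon> + 1\<close> times the distance.\<close>

lemma kernel_nth_diff_integrable:
  assumes x: "x $ k > 0" and \<epsilon>: "\<epsilon> > 0"
  shows "set_integrable lebesgue (halfsp k - ball x \<epsilon>) (\<lambda>y. frac_kernel k s x y * (x $ k - y $ k))"
proof -
  define C where "C = 4 * (real CARD('n) + 2) * x $ k * (x $ k / \<epsilon> + 1)"
  have *: "set_integrable lebesgue (- ball x \<epsilon>) (\<lambda>y. C * norm (x - y) powr (- (2 * s) - real CARD('n)))"
    using ball_compl_radial_integral_at[of "2 * s" \<epsilon>, where 'n='n] s \<epsilon> by auto
  show ?thesis
  proof (rule set_integrable_dominated(1)[OF *])
    fix y assume y: "y \<in> halfsp k - ball x \<epsilon>"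
    define a where "a = norm (x - y)"
    have a: "a \<ge> \<epsilon>" using y by (simp add: a_def dist_norm)
    have yk: "y $ k > 0" and xy: "x \<noteq> y" using y \<epsilon> by (auto simp: halfsp_def)
    have h: "\<bar>x $ k - y $ k\<bar> \<le> a" using abs_nth_le_norm[of "x - y" k] by (simp add: a_def)
    have "x $ k * 1 \<le> x $ k * (a / \<epsilon>)" using x a \<epsilon> by (intro mult_left_mono) auto
    then have ya: "y $ k \<le> (x $ k / \<epsilon> + 1) * a" using h by (simp add: algebra_simps)
    have K: "0 \<le> frac_kernel k s x y" using frac_kernel_nonneg[OF s x yk xy] .
    have "\<bar>frac_kernel k s x y * (x $ k - y $ k)\<bar> = frac_kernel k s x y * \<bar>x $ k - y $ k\<bar>"
      using K by (simp add: abs_mult)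
    also have "\<dots> \<le> (4 * (real CARD('n) + 2) * x $ k * y $ k * a powr (- 2 * s - real CARD('n) - 2)) * a"
      using frac_kernel_le_far[OF s x yk xy] h K by (intro mult_mono) (auto simp: a_def)
    also have "\<dots> = (4 * (real CARD('n) + 2) * x $ k) * (y $ k * (a powr (- 2 * s - real CARD('n) - 2) * a))"
      by simp
    also have "\<dots> \<le> (4 * (real CARD('n) + 2) * x $ k) * (((x $ k / \<epsilon> + 1) * a) * (a powr (- 2 * s - real CARD('n) - 2) * a))"
      using x ya a \<epsilon> by (intro mult_left_mono mult_right_mono) auto
    also have "\<dots> = C * (a powr (- 2 * s - real CARD('n) - 2) * a\<^sup>2)"
      by (simp add: C_def power2_eq_square)
    also have "a powr (- 2 * s - real CARD('n) - 2) * a\<^sup>2 = a powr (- (2 * s) - real CARD('n))"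
      using a \<epsilon> by (simp add: powr_diff powr_numeral)
    finally show "\<bar>frac_kernel k s x y * (x $ k - y $ k)\<bar> \<le> C * norm (x - y) powr (- (2 * s) - real CARD('n))"
      by (simp add: a_def)
  qed (use x \<epsilon> in \<open>auto simp: C_def\<close>)
qed

text \<open>Over the whole space the power of the distance times \<open>x $ k - y $ k\<close> is odd
  about \<open>x\<close> and integrates to zero. Folding the lower half space up by
  \<open>refl_pt\<close> gives the direct power times \<open>x $ k - y $ k\<close> plus the
  reflected power times \<open>x $ k + y $ k\<close>, that is, the wanted integrand plus
  \<open>2 * x $ k\<close> times the reflected power. The only discrepancy lies in the small ball,
  where \<open>\<bar>x $ k - y $ k\<bar>\<close> is below \<open>\<epsilon>\<close>.\<close>

lemma kernel_nth_diff_integral: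
  fixes x :: "real^'n"
  assumes x: "x $ k > 0" and \<epsilon>: "\<epsilon> > 0" "\<epsilon> < x $ k"
  defines "J \<equiv> (LINT y : halfsp k | lebesgue. norm (refl_pt k x - y) powr - (real CARD('n) + 2 * s))"
  shows "\<bar>(LINT y : halfsp k - ball x \<epsilon> | lebesgue. frac_kernel k s x y * (x $ k - y $ k)) + 2 * x $ k * J\<bar> \<le> \<epsilon> * J"
proof -
  define e where "e = real CARD('n) + 2 * s"
  define H where "H = halfsp k"
  define B where "B = (\<lambda>y. norm (refl_pt k x - y) powr - e)"
  have e: "e > 0" using s by (simp add: e_def add_pos_pos)
  have [measurable]: "H \<in> sets borel" "ball x \<epsilon> \<in> sets borel" by (simp_all add: H_def)
  have [measurable]: "B \<in> borel_measurable borel" unfolding B_def by measurable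
  have Bi: "integrable lebesgue (\<lambda>y. indicator H y * B y)"
    using integral_powr_refl(1)[OF s x] by (simp add: set_integrable_def H_def B_def e_def)
  have J: "J = (\<integral>y. indicator H y * B y \<partial>lebesgue)"
    by (simp add: J_def set_lebesgue_integral_def H_def B_def e_def)
  have Kint: "integrable lebesgue (\<lambda>y. indicator (H - ball x \<epsilon>) y * (frac_kernel k s x y * (x $ k - y $ k)))"
    using kernel_nth_diff_integrable[OF x \<epsilon>(1)] by (simp add: set_integrable_def H_def)
  have ballH: "ball x \<epsilon> \<subseteq> H"
  proof
    fix y assume "y \<in> ball x \<epsilon>"
    then have "\<bar>x $ k - y $ k\<bar> < \<epsilon>" using abs_nth_le_norm[of "x - y" k] by (simp add: dist_norm)
    then show "y \<in> H" using \<epsilon> by (simp add: H_def halfsp_def)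
  qed
  \<comment> \<open>Subtracting the level \<open>R ^ - e\<close> from the power gives it bounded support, so that oddness applies in
    the whole space, and leaves the difference kernel between 0 and \<open>frac_kernel\<close>, so that dominated
    convergence applies as \<open>R\<close> tends to infinity.\<close>
  define A where "A R z = (if norm z \<ge> \<epsilon> then max 0 (norm z powr - e - real (Suc R) powr - e) else 0)" for R :: nat and z :: "real^'n"
  have [measurable]: "A R \<in> borel_measurable borel" for R unfolding A_def by measurable
  define F where "F R y = A R (x - y) * (x $ k - y $ k)" for R y
  have F_int: "integrable lebesgue (F R)" for R
  proof -
    define r where "r = real R"
    have "set_integrable lebesgue (ball x (r + 1)) (\<lambda>y. \<epsilon> powr - e * (r + 1))"
      unfolding set_integrable_def real_scaleR_def
      by (intro integrable_mult_left) (simp flip: lmeasurable_iff_integrable)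
    then have "set_integrable lebesgue UNIV (\<lambda>y. indicator (ball x (r + 1)) y * (\<epsilon> powr - e * (r + 1)))"
      by (simp add: set_integrable_def)
    then have "set_integrable lebesgue UNIV (F R)"
    proof (rule set_integrable_dominated(1))
      show "F R \<in> borel_measurable borel" unfolding F_def by measurable
      fix y
      show "\<bar>F R y\<bar> \<le> indicator (ball x (r + 1)) y * (\<epsilon> powr - e * (r + 1))"
      proof (cases "norm (x - y) \<ge> \<epsilon> \<and> norm (x - y) < r + 1")
        case True
        have "\<bar>A R (x - y)\<bar> \<le> norm (x - y) powr - e" using True by (auto simp: A_def)
        also have "\<dots> \<le> \<epsilon> powr - e" using True \<epsilon> e by (intro powr_mono2') auto
        finally have 1: "\<bar>A R (x - y)\<bar> \<le> \<epsilon> powr - e" .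
        have 2: "\<bar>x $ k - y $ k\<bar> \<le> r + 1" using abs_nth_le_norm[of "x - y" k] True by simp
        show ?thesis unfolding F_def abs_mult using True mult_mono[OF 1 2] by (simp add: dist_norm)
      next
        case False
        have "A R (x - y) = 0"
        proof (cases "norm (x - y) \<ge> \<epsilon>")
          case True
          then have "r + 1 \<le> norm (x - y)" using False by simp
          then have "norm (x - y) powr - e \<le> (r + 1) powr - e"
            using e by (intro powr_mono2') (auto simp: r_def)
          then show ?thesis by (simp add: A_def r_def add.commute)
        qed (simp add: A_def)
        then show ?thesis by (simp add: F_def r_def)
      qed
    qed (use r_def in auto)
    then show ?thesis by (simp add: set_integrable_def)
  qed
  have F0: "integral\<^sup>L lebesgue (F R) = 0" for R
  proof -
    have "\<bar>integral\<^sup>L lebesgue (F R)\<bar> \<le> integral\<^sup>L lebesgue (\<lambda>_::real^'n. 0::real)"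
    proof (rule abs_integral_le_symmetrised[OF reflect_point_preserves[of x] F_int])
      fix y
      have "norm (x - (2 *\<^sub>R x - y)) = norm (x - y)"
        using norm_minus_commute[of x y] by (simp add: scaleR_2 algebra_simps)
      then have "A R (x - (2 *\<^sub>R x - y)) = A R (x - y)" by (simp add: A_def)
      then show "\<bar>F R y + F R (2 *\<^sub>R x - y)\<bar> \<le> 2 * 0"
        by (simp add: F_def algebra_simps)
    qed simp
    then show ?thesis by simp
  qed
  \<comment> \<open>\<open>F R\<close> folded onto the half space; the second summand comes from the
    lower half.\<close>
  define G where "G R y = indicator H y * (A R (x - y) * (x $ k - y $ k) + A R (refl_pt k x - y) * (x $ k + y $ k))" for R y
  have G_meas: "G R \<in> borel_measurable lebesgue" for R
    unfolding G_def by (intro borel_imp_lebesgue_measurable) measurable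
  have G0: "integral\<^sup>L lebesgue (G R) = 0" for R
  proof -
    define F1 where "F1 y = indicator H y * F R y" for y
    define F2 where "F2 y = indicator H (refl_pt k y) * F R y" for y
    have "H \<in> sets lebesgue" by (rule sets_completionI_sets) simp
    then have i1: "integrable lebesgue F1"
      using integrable_mult_indicator[of H lebesgue "F R"] F_int by (simp add: F1_def[abs_def])
    have "integrable lebesgue (\<lambda>y. indicator H (refl_pt k y) * F R y)"
    proof (rule Bochner_Integration.integrable_bound[OF F_int[of R]])
      show "(\<lambda>y. indicator H (refl_pt k y) * F R y) \<in> borel_measurable lebesgue"
        unfolding F_def by (intro borel_imp_lebesgue_measurable) measurable
    qed (auto simp: indicator_def)
    then have i2: "integrable lebesgue F2" by (simp add: F2_def[abs_def])
    have "integral\<^sup>L lebesgue (F R) = integral\<^sup>L lebesgue (\<lambda>y. F1 y + F2 y)"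
    proof (rule integral_cong_AE)
      show "AE y in lebesgue. F R y = F1 y + F2 y"
        by (rule AE_mp[OF AE_nth_neq_0[of k]], intro always_eventually)
          (auto simp: F1_def F2_def H_def halfsp_def indicator_def refl_pt_nth)
    qed (use F_int i1 i2 in auto)
    then have "integral\<^sup>L lebesgue F1 + integral\<^sup>L lebesgue F2 = 0" using F0 i1 i2 by simp
    moreover have "integral\<^sup>L lebesgue F2 = integral\<^sup>L lebesgue (\<lambda>y. F2 (refl_pt k y))"
      using integral_distr[OF refl_pt_preserves(1)[of k], of F2] i2 refl_pt_preserves(2)[of k] by simp
    moreover have "integrable lebesgue (\<lambda>y. F2 (refl_pt k y))"
      using integrable_distr[OF refl_pt_preserves(1)[of k], of F2] i2 refl_pt_preserves(2)[of k] by simp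
    ultimately have "integral\<^sup>L lebesgue (\<lambda>y. F1 y + F2 (refl_pt k y)) = 0" using i1 by simp
    moreover have "(\<lambda>y. F1 y + F2 (refl_pt k y)) = G R"
    proof
      fix y
      have "A R (x - refl_pt k y) = A R (refl_pt k x - y)" by (simp add: A_def norm_refl_pt_swap)
      then show "F1 y + F2 (refl_pt k y) = G R y"
        by (simp add: F1_def F2_def G_def F_def refl_pt_nth algebra_simps)
    qed
    ultimately show ?thesis by simp
  qed
  \<comment> \<open>The pointwise limit of \<open>G R\<close>, with \<open>x $ k + y $ k\<close>
    written as \<open>2 * x $ k - (x $ k - y $ k)\<close>. Outside the ball the second part
    completes the kernel; inside it has no partner and remains as the error.\<close>
  define W where "W y = indicator (H - ball x \<epsilon>) y * (frac_kernel k s x y * (x $ k - y $ k)) -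
      indicator (ball x \<epsilon>) y * (B y * (x $ k - y $ k)) + 2 * x $ k * (indicator H y * B y)" for y
  have W_meas: "W \<in> borel_measurable lebesgue"
    unfolding W_def by (intro borel_imp_lebesgue_measurable) measurable
  have KB: "frac_kernel k s x y = norm (x - y) powr - e - B y" for y
    unfolding frac_kernel_def B_def e_def by (simp only: powr_minus divide_inverse mult_1_left)
  have far: "\<epsilon> \<le> norm (refl_pt k x - y)" if "y \<in> H" for y
    using nth_add_le_refl_diff[of x k y] that \<epsilon> by (simp add: H_def halfsp_def)
  have "(\<lambda>R. integral\<^sup>L lebesgue (G R)) \<longlonglongrightarrow> integral\<^sup>L lebesgue W"
  proof (rule integral_dominated_convergence[where w = "\<lambda>y. \<bar>indicator (H - ball x \<epsilon>) y * (frac_kernel k s x y * (x $ k - y $ k))\<bar> + (\<epsilon> + 2 * x $ k) * (indicator H y * B y)"])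
    show "AE y in lebesgue. (\<lambda>R. G R y) \<longlonglongrightarrow> W y"
    proof (rule AE_I2)
      fix y :: "real^'n"
      have lim: "(\<lambda>R. max 0 (c powr - e - real (Suc R) powr - e)) \<longlonglongrightarrow> c powr - e" for c :: real
      proof -
        have "(\<lambda>R. real (Suc R) powr - e) \<longlonglongrightarrow> 0"
          using e by (intro tendsto_neg_powr filterlim_compose[OF filterlim_real_sequentially filterlim_Suc]) auto
        then have "(\<lambda>R. max 0 (c powr - e - real (Suc R) powr - e)) \<longlonglongrightarrow> max 0 (c powr - e - 0)"
          by (intro tendsto_intros)
        then show ?thesis by simp
      qed
      show "(\<lambda>R. G R y) \<longlonglongrightarrow> W y"
      proof (cases "y \<in> H")
        case False
        then show ?thesis using ballH by (auto simp: G_def W_def indicator_def)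
      next
        case True
        have l2: "(\<lambda>R. A R (refl_pt k x - y)) \<longlonglongrightarrow> B y"
          using lim[of "norm (refl_pt k x - y)"] far[OF True] by (simp add: A_def B_def)
        show ?thesis
        proof (cases "y \<in> ball x \<epsilon>")
          case y: True
          have "(\<lambda>R. A R (refl_pt k x - y) * (x $ k + y $ k)) \<longlonglongrightarrow> B y * (x $ k + y $ k)"
            by (intro tendsto_intros l2)
          then show ?thesis using y True
            by (simp add: G_def W_def A_def[of _ "x - y"] dist_norm algebra_simps)
        next
          case y: False
          have "(\<lambda>R. A R (x - y)) \<longlonglongrightarrow> norm (x - y) powr - e"
            using lim[of "norm (x - y)"] y by (simp add: A_def dist_norm)
          then have "(\<lambda>R. A R (x - y) * (x $ k - y $ k) + A R (refl_pt k x - y) * (x $ k + y $ k)) \<longlonglongrightarrow>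
             norm (x - y) powr - e * (x $ k - y $ k) + B y * (x $ k + y $ k)"
            by (intro tendsto_intros l2)
          then show ?thesis using y True
            by (simp add: G_def W_def KB algebra_simps)
        qed
      qed
    qed
    show "AE y in lebesgue. norm (G R y) \<le> \<bar>indicator (H - ball x \<epsilon>) y * (frac_kernel k s x y * (x $ k - y $ k))\<bar> + (\<epsilon> + 2 * x $ k) * (indicator H y * B y)" for R
    proof (rule AE_I2)
      fix y :: "real^'n"
      show "norm (G R y) \<le> \<bar>indicator (H - ball x \<epsilon>) y * (frac_kernel k s x y * (x $ k - y $ k))\<bar> + (\<epsilon> + 2 * x $ k) * (indicator H y * B y)"
      proof (cases "y \<in> H")
        case False then show ?thesis by (simp add: G_def)
      next
        case True
        then have yk: "y $ k > 0" by (simp add: H_def halfsp_def)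
        have b: "0 \<le> A R (refl_pt k x - y)" "A R (refl_pt k x - y) \<le> B y"
          by (auto simp: A_def B_def)
        show ?thesis
        proof (cases "y \<in> ball x \<epsilon>")
          case y: True
          have "\<bar>x $ k - y $ k\<bar> < \<epsilon>" using abs_nth_le_norm[of "x - y" k] y by (simp add: dist_norm)
          then have "x $ k + y $ k \<le> \<epsilon> + 2 * x $ k" by simp
          then have "A R (refl_pt k x - y) * (x $ k + y $ k) \<le> B y * (\<epsilon> + 2 * x $ k)"
            using b x yk by (intro mult_mono) auto
          then show ?thesis using y True b x yk
            by (simp add: G_def A_def[of _ "x - y"] dist_norm abs_mult mult.commute)
        next
          case y: False
          have ya: "\<epsilon> \<le> norm (x - y)" using y by (simp add: dist_norm)
          have "norm (x - y) \<le> norm (refl_pt k x - y)" using norm_diff_le_refl_diff[of x k y] x yk by simp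
          then have "B y \<le> norm (x - y) powr - e"
            unfolding B_def using e \<epsilon> ya by (intro powr_mono2') auto
          \<comment> \<open>Subtracting the same level and taking the positive part is 1-Lipschitz,
            so the truncated powers differ by no more than the powers themselves.\<close>
          then have "\<bar>A R (x - y) - A R (refl_pt k x - y)\<bar> \<le> frac_kernel k s x y"
            using far[OF True] ya by (auto simp: A_def KB B_def max_def)
          then have "\<bar>(A R (x - y) - A R (refl_pt k x - y)) * (x $ k - y $ k)\<bar> \<le> \<bar>frac_kernel k s x y * (x $ k - y $ k)\<bar>"
            unfolding abs_mult by (intro mult_right_mono) auto
          moreover have "\<bar>A R (refl_pt k x - y) * (2 * x $ k)\<bar> \<le> (\<epsilon> + 2 * x $ k) * B y"
            using b x \<epsilon> by (subst mult.commute) (auto simp: abs_mult intro!: mult_mono)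
          moreover have "G R y = (A R (x - y) - A R (refl_pt k x - y)) * (x $ k - y $ k) + A R (refl_pt k x - y) * (2 * x $ k)"
            using True by (simp add: G_def algebra_simps)
          ultimately show ?thesis using y True by simp
        qed
      qed
    qed
  qed (use G_meas W_meas Kint Bi in auto)
  then have W0: "integral\<^sup>L lebesgue W = 0" using G0 by (simp add: LIMSEQ_const_iff)
  have bd: "\<bar>indicator (ball x \<epsilon>) y * (B y * (x $ k - y $ k))\<bar> \<le> \<epsilon> * (indicator H y * B y)" for y
  proof (cases "y \<in> ball x \<epsilon>")
    case True
    then have "\<bar>x $ k - y $ k\<bar> \<le> \<epsilon>" using abs_nth_le_norm[of "x - y" k] by (simp add: dist_norm)
    moreover have "B y \<ge> 0" by (simp add: B_def)
    ultimately have "B y * \<bar>x $ k - y $ k\<bar> \<le> B y * \<epsilon>" by (intro mult_left_mono)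
    then show ?thesis using True ballH \<open>B y \<ge> 0\<close> by (auto simp: abs_mult mult.commute indicator_def)
  qed (use \<epsilon> in \<open>auto simp: B_def\<close>)
  have Ei: "integrable lebesgue (\<lambda>y. indicator (ball x \<epsilon>) y * (B y * (x $ k - y $ k)))"
  proof (rule Bochner_Integration.integrable_bound)
    show "integrable lebesgue (\<lambda>y. \<epsilon> * (indicator H y * B y))" using Bi by simp
    show "(\<lambda>y. indicator (ball x \<epsilon>) y * (B y * (x $ k - y $ k))) \<in> borel_measurable lebesgue"
      by (intro borel_imp_lebesgue_measurable) measurable
    show "AE y in lebesgue. norm (indicator (ball x \<epsilon>) y * (B y * (x $ k - y $ k))) \<le> norm (\<epsilon> * (indicator H y * B y))"
      using bd by (intro AE_I2) (auto intro: order_trans[OF _ abs_ge_self])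
  qed
  have "integral\<^sup>L lebesgue W = (\<integral>y. indicator (H - ball x \<epsilon>) y * (frac_kernel k s x y * (x $ k - y $ k)) \<partial>lebesgue)
      - (\<integral>y. indicator (ball x \<epsilon>) y * (B y * (x $ k - y $ k)) \<partial>lebesgue) + 2 * x $ k * J"
    unfolding W_def J using Kint Ei Bi by simp
  moreover have "\<bar>\<integral>y. indicator (ball x \<epsilon>) y * (B y * (x $ k - y $ k)) \<partial>lebesgue\<bar> \<le> (\<integral>y. \<epsilon> * (indicator H y * B y) \<partial>lebesgue)"
    using Bochner_Integration.integral_norm_bound_integral[OF Ei, of "\<lambda>y. \<epsilon> * (indicator H y * B y)"] Bi bd by simp
  moreover have "(\<integral>y. \<epsilon> * (indicator H y * B y) \<partial>lebesgue) = \<epsilon> * J" by (simp add: J)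
  ultimately show ?thesis
    using W0 unfolding set_lebesgue_integral_def H_def[symmetric] real_scaleR_def by linarith
qed

end

section \<open>Cancellation near the diagonal\<close>

lemma powr_minus_mult_sq:
  fixes a :: real
  assumes "a > 0"
  shows "a powr (- 2 * s - n) * a\<^sup>2 = a powr (2 - 2 * s - n)"
proof -
  have "a powr (- 2 * s - n) * a\<^sup>2 = a powr (- 2 * s - n) * a powr 2"
    using assms by (simp add: powr_numeral)
  also have "\<dots> = a powr (- 2 * s - n + 2)" by (rule powr_add[symmetric])
  also have "- 2 * s - n + 2 = 2 - 2 * s - n" by simp
  finally show ?thesis .
qed

text \<open>Point reflection about \<open>x\<close> in all coordinates except \<open>k\<close>. It
  preserves the half space and the distances to \<open>x\<close> and to \<open>refl_pt k x\<close>,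
  hence the kernel and the annuli; the full reflection \<open>2 *\<^sub>R x - y\<close> can leave
  the half space.\<close>

definition flip_pt :: "'n::finite \<Rightarrow> real^'n \<Rightarrow> real^'n \<Rightarrow> real^'n" where
  "flip_pt k x y = (\<chi> i. if i = k then y $ i else 2 * x $ i - y $ i)"

lemma flip_pt_preserves:
  fixes k :: "'n::finite"
  shows "flip_pt k x \<in> lebesgue \<rightarrow>\<^sub>M lebesgue" "distr lebesgue lebesgue (flip_pt k x) = lebesgue"
proof -
  have eq: "(\<lambda>y. \<chi> i. (\<chi> i. if i = k then 0 else 2 * x $ i) $ i + (if i = k then 1 else -1) * y $ i) = flip_pt k x"
    by (auto simp: vec_eq_iff fun_eq_iff flip_pt_def)
  show "flip_pt k x \<in> lebesgue \<rightarrow>\<^sub>M lebesgue" "distr lebesgue lebesgue (flip_pt k x) = lebesgue"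
    using vec_affine_preserves_lebesgue[of "\<lambda>i. if i = k then 1 else -1" "\<chi> i. if i = k then 0 else 2 * x $ i"]
    unfolding eq by simp_all
qed

lemma flip_pt_nth: "flip_pt k x y $ i = (if i = k then y $ i else 2 * x $ i - y $ i)"
  by (simp add: flip_pt_def)

lemma norm_diff_flip_pt [simp]: "norm (x - flip_pt k x y) = norm (x - y)"
proof -
  have "(norm (x - flip_pt k x y))\<^sup>2 = (norm (x - y))\<^sup>2"
    unfolding norm_sq_split[of _ k] by (auto simp: flip_pt_nth power2_commute intro!: sum.cong)
  then show ?thesis by simp
qed

lemma norm_refl_diff_flip_pt [simp]: "norm (refl_pt k x - flip_pt k x y) = norm (refl_pt k x - y)"
proof -
  have "(norm (refl_pt k x - flip_pt k x y))\<^sup>2 = (norm (refl_pt k x - y))\<^sup>2"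
    by (simp add: norm_refl_diff_sq flip_pt_nth)
  then show ?thesis by simp
qed

lemma frac_kernel_flip_pt [simp]: "frac_kernel k s x (flip_pt k x y) = frac_kernel k s x y"
  by (simp add: frac_kernel_def)

text \<open>A smooth substitute for \<open>|y - p|\<^sup>2\<close> that is even in the distinguished coordinate, so that
  \<open>y $ k\<close> times a function of it is antisymmetric and smooth across the hyperplane.\<close>

definition qfun :: "'n::finite \<Rightarrow> real^'n \<Rightarrow> real^'n \<Rightarrow> real" where
  "qfun k p y = (norm (y - p))\<^sup>2 - (y $ k - p $ k)\<^sup>2 + ((y $ k)\<^sup>2 - (p $ k)\<^sup>2)\<^sup>2"

lemma qfun_sum: "qfun k p y = (\<Sum>i\<in>UNIV - {k}. (y $ i - p $ i)\<^sup>2) + ((y $ k)\<^sup>2 - (p $ k)\<^sup>2)\<^sup>2"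
  by (simp add: qfun_def norm_sq_split[of "y - p" k])

lemma qfun_nonneg: "qfun k p y \<ge> 0"
  by (simp add: qfun_sum sum_nonneg)

lemma qfun_self [simp]: "qfun k p p = 0"
  by (simp add: qfun_sum)

lemma qfun_borel [measurable]: "qfun k p \<in> borel_measurable borel"
  unfolding qfun_def[abs_def] by measurable

lemma continuous_on_qfun [continuous_intros]: "continuous_on S (qfun k p)"
  unfolding qfun_def[abs_def] by (intro continuous_intros)

text \<open>For nonnegative entries \<open>\<bar>y $ k - p $ k\<bar>\<close> is at most
  \<open>y $ k + p $ k\<close>, so the last term of \<open>qfun\<close> dominates the fourth power
  of the normal displacement. The term \<open>sqrt b\<close> reflects that \<open>qfun\<close>
  controls this direction only to fourth order when \<open>p\<close> is near the hyperplane.\<close>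

lemma qfun_ball:
  assumes y: "y $ k \<ge> 0" and p: "p $ k \<ge> 0" and q: "qfun k p y \<le> b"
  shows "(norm (y - p))\<^sup>2 \<le> b + sqrt b"
proof -
  let ?S = "\<Sum>i\<in>UNIV - {k}. (y $ i - p $ i)\<^sup>2"
  have S: "?S \<ge> 0" by (simp add: sum_nonneg)
  have "((y $ k - p $ k)\<^sup>2)\<^sup>2 \<le> (y $ k - p $ k)\<^sup>2 * (y $ k + p $ k)\<^sup>2"
    unfolding power2_eq_square[of "(y $ k - p $ k)\<^sup>2"]
    using y p by (intro mult_left_mono abs_le_square_iff[THEN iffD1]) auto
  also have "\<dots> = ((y $ k)\<^sup>2 - (p $ k)\<^sup>2)\<^sup>2"
    by (simp add: power2_eq_square algebra_simps)
  also have "\<dots> \<le> b" using q S by (simp add: qfun_sum)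
  finally have "(y $ k - p $ k)\<^sup>2 \<le> sqrt b" by (rule real_le_rsqrt)
  moreover have "?S \<le> b" using q zero_le_power2[of "(y $ k)\<^sup>2 - (p $ k)\<^sup>2"]
    unfolding qfun_sum by linarith
  ultimately show ?thesis by (simp add: norm_sq_split[of _ k])
qed

lemma qfun_lipschitz:
  assumes D: "norm x \<le> D" "norm y \<le> D" "norm p \<le> D"
  shows "\<bar>qfun k p y - qfun k p x\<bar> \<le> (8 * D + 4 * D ^ 3) * norm (x - y)"
proof -
  have D0: "D \<ge> 0" using D(1) norm_ge_zero order_trans by blast
  have c: "\<bar>x $ k\<bar> \<le> D" "\<bar>y $ k\<bar> \<le> D" "\<bar>p $ k\<bar> \<le> D"
    using D abs_nth_le_norm[of x k] abs_nth_le_norm[of y k] abs_nth_le_norm[of p k] by linarith+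
  have h: "\<bar>y $ k - x $ k\<bar> \<le> norm (x - y)" using abs_nth_le_norm[of "x - y" k] by simp
  have 1: "\<bar>(norm (y - p))\<^sup>2 - (norm (x - p))\<^sup>2\<bar> \<le> norm (x - y) * (4 * D)"
  proof -
    have "\<bar>(norm (y - p))\<^sup>2 - (norm (x - p))\<^sup>2\<bar> = \<bar>norm (y - p) - norm (x - p)\<bar> * (norm (y - p) + norm (x - p))"
      by (simp add: power2_eq_square square_diff_square_factored abs_mult mult.commute)
    also have "\<dots> \<le> norm (x - y) * (4 * D)"
    proof (rule mult_mono)
      show "\<bar>norm (y - p) - norm (x - p)\<bar> \<le> norm (x - y)"
        using norm_triangle_ineq3[of "y - p" "x - p"] by (simp add: norm_minus_commute)
      show "norm (y - p) + norm (x - p) \<le> 4 * D"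
        using norm_triangle_ineq4[of y p] norm_triangle_ineq4[of x p] D by linarith
    qed auto
    finally show ?thesis .
  qed
  have 2: "\<bar>(y $ k - p $ k)\<^sup>2 - (x $ k - p $ k)\<^sup>2\<bar> \<le> norm (x - y) * (4 * D)"
  proof -
    have "(y $ k - p $ k)\<^sup>2 - (x $ k - p $ k)\<^sup>2 = (y $ k - x $ k) * (y $ k + x $ k - 2 * p $ k)"
      by (simp add: power2_eq_square algebra_simps)
    then have "\<bar>(y $ k - p $ k)\<^sup>2 - (x $ k - p $ k)\<^sup>2\<bar> = \<bar>y $ k - x $ k\<bar> * \<bar>y $ k + x $ k - 2 * p $ k\<bar>"
      by (simp add: abs_mult)
    also have "\<dots> \<le> norm (x - y) * (4 * D)"
      using c h by (intro mult_mono) auto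
    finally show ?thesis .
  qed
  have 3: "\<bar>((y $ k)\<^sup>2 - (p $ k)\<^sup>2)\<^sup>2 - ((x $ k)\<^sup>2 - (p $ k)\<^sup>2)\<^sup>2\<bar> \<le> norm (x - y) * (4 * D ^ 3)"
  proof -
    have sq: "(x $ k)\<^sup>2 \<le> D\<^sup>2" "(y $ k)\<^sup>2 \<le> D\<^sup>2" "(p $ k)\<^sup>2 \<le> D\<^sup>2"
      using c D0 by (simp_all add: abs_le_square_iff[symmetric])
    have "((y $ k)\<^sup>2 - (p $ k)\<^sup>2)\<^sup>2 - ((x $ k)\<^sup>2 - (p $ k)\<^sup>2)\<^sup>2 =
      (y $ k - x $ k) * ((y $ k + x $ k) * ((y $ k)\<^sup>2 + (x $ k)\<^sup>2 - 2 * (p $ k)\<^sup>2))"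
      by (simp add: power2_eq_square algebra_simps)
    then have "\<bar>((y $ k)\<^sup>2 - (p $ k)\<^sup>2)\<^sup>2 - ((x $ k)\<^sup>2 - (p $ k)\<^sup>2)\<^sup>2\<bar> =
      \<bar>y $ k - x $ k\<bar> * (\<bar>y $ k + x $ k\<bar> * \<bar>(y $ k)\<^sup>2 + (x $ k)\<^sup>2 - 2 * (p $ k)\<^sup>2\<bar>)"
      by (simp add: abs_mult)
    also have "\<dots> \<le> norm (x - y) * ((2 * D) * (2 * D\<^sup>2))"
    proof (intro mult_mono)
      have "0 \<le> (y $ k)\<^sup>2" "0 \<le> (x $ k)\<^sup>2" "0 \<le> (p $ k)\<^sup>2" by simp_all
      then show "\<bar>(y $ k)\<^sup>2 + (x $ k)\<^sup>2 - 2 * (p $ k)\<^sup>2\<bar> \<le> 2 * D\<^sup>2" using sq by linarith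
    qed (use c h D0 in auto)
    also have "(2 * D) * (2 * D\<^sup>2) = 4 * D ^ 3" by (simp add: power2_eq_square power3_eq_cube)
    finally show ?thesis .
  qed
  have "\<bar>qfun k p y - qfun k p x\<bar> \<le> norm (x - y) * (4 * D) + norm (x - y) * (4 * D) + norm (x - y) * (4 * D ^ 3)"
    using 1 2 3 unfolding qfun_def by linarith
  also have "\<dots> = (8 * D + 4 * D ^ 3) * norm (x - y)" by (simp add: algebra_simps)
  finally show ?thesis .
qed

text \<open>The flip removes the tangential first-order terms. In the normal direction, splitting
  \<open>(y $ k)\<^sup>2 - (p $ k)\<^sup>2\<close> at \<open>(x $ k)\<^sup>2\<close> leaves a cross
  term whose linear part has the factor \<open>x $ k\<close>, because \<open>qfun\<close> sees
  \<open>y $ k\<close> only through its square in that term. All else is at least quadratic in the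
  displacement.\<close>

lemma qfun_flip_sum:
  "(qfun k p y - qfun k p x) + (qfun k p (flip_pt k x y) - qfun k p x) =
    2 * ((norm (x - y))\<^sup>2 - (y $ k - x $ k)\<^sup>2 + ((y $ k)\<^sup>2 - (x $ k)\<^sup>2)\<^sup>2
       + 2 * ((x $ k)\<^sup>2 - (p $ k)\<^sup>2) * (y $ k - x $ k)\<^sup>2
       + 4 * ((x $ k)\<^sup>2 - (p $ k)\<^sup>2) * x $ k * (y $ k - x $ k))"
proof -
  have "(\<Sum>i\<in>UNIV - {k}. (y $ i - p $ i)\<^sup>2) + (\<Sum>i\<in>UNIV - {k}. (flip_pt k x y $ i - p $ i)\<^sup>2)
      - 2 * (\<Sum>i\<in>UNIV - {k}. (x $ i - p $ i)\<^sup>2) = (\<Sum>i\<in>UNIV - {k}. 2 * (x $ i - y $ i)\<^sup>2)"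
    unfolding sum_distrib_left sum.distrib[symmetric] sum_subtractf[symmetric]
    by (intro sum.cong) (auto simp: flip_pt_nth power2_eq_square algebra_simps)
  also have "\<dots> = 2 * ((norm (x - y))\<^sup>2 - (y $ k - x $ k)\<^sup>2)"
    by (simp add: norm_sq_split[of "x - y" k] sum_distrib_left power2_commute)
  finally have 1: "(\<Sum>i\<in>UNIV - {k}. (y $ i - p $ i)\<^sup>2) + (\<Sum>i\<in>UNIV - {k}. (flip_pt k x y $ i - p $ i)\<^sup>2)
      - 2 * (\<Sum>i\<in>UNIV - {k}. (x $ i - p $ i)\<^sup>2) = 2 * ((norm (x - y))\<^sup>2 - (y $ k - x $ k)\<^sup>2)" .
  have 2: "2 * (((y $ k)\<^sup>2 - (p $ k)\<^sup>2)\<^sup>2 - ((x $ k)\<^sup>2 - (p $ k)\<^sup>2)\<^sup>2) =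
     2 * (((y $ k)\<^sup>2 - (x $ k)\<^sup>2)\<^sup>2
       + 2 * ((x $ k)\<^sup>2 - (p $ k)\<^sup>2) * (y $ k - x $ k)\<^sup>2
       + 4 * ((x $ k)\<^sup>2 - (p $ k)\<^sup>2) * x $ k * (y $ k - x $ k))"
    by (simp add: power2_eq_square algebra_simps)
  show ?thesis using 1 2 unfolding qfun_sum by (simp add: flip_pt_nth algebra_simps)
qed

context
  fixes k :: "'n::finite" and s :: real
  assumes s: "0 < s" "s < 1"
begin

text \<open>Multiplied by \<open>c_const CARD('n) s\<close>, the limit is the negative of the zero
  order term of the function \<open>y $ k\<close> at \<open>x\<close>. So the operator annihilates
  the linear function.\<close>

lemma kernel_nth_diff_limit:
  fixes x :: "real^'n"
  assumes x: "x $ k > 0"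
  shows "((\<lambda>\<epsilon>. LINT y : halfsp k - ball x \<epsilon> | lebesgue. frac_kernel k s x y * (x $ k - y $ k)) \<longlongrightarrow>
     - (c_const 1 s / s / c_const CARD('n) s * (x $ k) powr (- 2 * s) * x $ k)) (at_right 0)"
proof -
  define J where "J = (LINT y : halfsp k | lebesgue. norm (refl_pt k x - y) powr - (real CARD('n) + 2 * s))"
  have c: "c_const CARD('n) s > 0" by (rule c_const_pos[OF s])
  have J: "2 * J = c_const 1 s / s / c_const CARD('n) s * (x $ k) powr (- 2 * s)"
  proof -
    have "2 * J = (2 * c_const CARD('n) s * J) / c_const CARD('n) s" using c by simp
    also have "2 * c_const CARD('n) s * J = c_const 1 s / s * (x $ k) powr (- 2 * s)"
      using integral_powr_refl(2)[OF s x] unfolding J_def .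
    finally show ?thesis by simp
  qed
  have "((\<lambda>\<epsilon>. (LINT y : halfsp k - ball x \<epsilon> | lebesgue. frac_kernel k s x y * (x $ k - y $ k)) + 2 * x $ k * J) \<longlongrightarrow> 0) (at_right 0)"
  proof (rule Lim_null_comparison)
    show "\<forall>\<^sub>F \<epsilon> in at_right 0. norm ((LINT y : halfsp k - ball x \<epsilon> | lebesgue. frac_kernel k s x y * (x $ k - y $ k)) + 2 * x $ k * J) \<le> \<epsilon> * J"
      using kernel_nth_diff_integral[OF s x] x unfolding J_def real_norm_def
      by (intro eventually_at_rightI[of 0 "x $ k"]) auto
    show "((\<lambda>\<epsilon>. \<epsilon> * J) \<longlongrightarrow> 0) (at_right 0)"
      by (rule tendsto_eq_intros refl | simp)+
  qed
  then have "((\<lambda>\<epsilon>. (LINT y : halfsp k - ball x \<epsilon> | lebesgue. frac_kernel k s x y * (x $ k - y $ k)) + 2 * x $ k * J - 2 * x $ k * J) \<longlongrightarrow> 0 - 2 * x $ k * J) (at_right 0)"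
    by (intro tendsto_intros)
  moreover have "0 - 2 * x $ k * J = - (2 * J * x $ k)" by simp
  ultimately show ?thesis unfolding J by simp
qed

text \<open>Near \<open>x\<close> the linear term of \<open>y $ k * (y $ k - x $ k)\<close> cancels by symmetry about \<open>x\<close>, except where
  \<open>\<bar>y $ k - x $ k\<bar> \<ge> x $ k\<close>; there, as in the contribution of the reflected kernel, \<open>x $ k\<close> is dominated by
  the distance.\<close>

lemma kernel_annulus_linear:
  "\<exists>C>0. \<forall>x::real^'n. \<forall>r \<epsilon>. x $ k > 0 \<and> 0 < \<epsilon> \<and> 0 < r \<longrightarrow>
     \<bar>LINT y : halfsp k \<inter> (ball x r - ball x \<epsilon>) | lebesgue. frac_kernel k s x y * y $ k * (y $ k - x $ k)\<bar>
       \<le> C * r powr (2 - 2 * s)"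
proof -
  obtain C0 where C0: "C0 > 0" and C0r: "\<And>r x::real^'n. r > 0 \<Longrightarrow>
     set_integrable lebesgue (ball x r) (\<lambda>y. norm (x - y) powr (2 - 2 * s - real CARD('n))) \<and>
     (LINT y : ball x r | lebesgue. norm (x - y) powr (2 - 2 * s - real CARD('n))) \<le> C0 * r powr (2 - 2 * s)"
    using ball_radial_integral_at[of "2 - 2 * s", where 'n='n] s by auto
  show ?thesis
  proof (intro exI[of _ "3 * C0"] conjI allI impI; (elim conjE)?)
    show "3 * C0 > 0" using C0 by simp
    fix x :: "real^'n" and r \<epsilon> :: real assume x: "x $ k > 0" and \<epsilon>: "0 < \<epsilon>" and r: "0 < r"
    define U where "U = halfsp k \<inter> (ball x r - ball x \<epsilon>)"
    have Ub [measurable]: "U \<in> sets borel" by (auto simp: U_def)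
    define f where "f y = indicator U y * (frac_kernel k s x y * y $ k * (y $ k - x $ k))" for y
    define w where "w y = norm (x - y) powr (2 - 2 * s - real CARD('n))" for y
    \<comment> \<open>\<open>g\<close> isolates the odd part: with \<open>y $ k = x $ k + h\<close>
      it is \<open>x $ k * h\<close> against the direct power alone. The rest of \<open>f\<close>,
      namely \<open>h\<^sup>2\<close> against the kernel and \<open>x $ k * h\<close> against the
      reflected power, is at most \<open>2 * w\<close>, and the average of \<open>g\<close> is at
      most \<open>w\<close>; hence the 3.\<close>
    define F where "F y = 3 * (indicator (ball x r) y * w y)" for y
    define g where "g y = indicator U y * (norm (x - y) powr (- 2 * s - real CARD('n)) * (x $ k * (y $ k - x $ k)))" for y
    have w0: "w y \<ge> 0" for y by (simp add: w_def)
    have wi: "set_integrable lebesgue (ball x r) w" using C0r[OF r, of x] by (simp add: w_def[abs_def])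
    have Upos: "y $ k > 0" "norm (x - y) \<ge> \<epsilon>" "norm (x - y) > 0" "x \<noteq> y" "norm (x - y) < r" "y \<in> ball x r" if "y \<in> U" for y
      using that \<epsilon> by (auto simp: U_def halfsp_def dist_norm)
    have wsq: "norm (x - y) powr (- 2 * s - real CARD('n)) * (norm (x - y))\<^sup>2 = w y" if "y \<in> U" for y
      unfolding w_def by (rule powr_minus_mult_sq[OF Upos(3)[OF that]])
    have hle: "\<bar>y $ k - x $ k\<bar> \<le> norm (x - y)" for y
      using abs_nth_le_norm[of "x - y" k] by simp
    have fg: "\<bar>f y - g y\<bar> \<le> 2 * (indicator (ball x r) y * w y)" for y
    proof (cases "y \<in> U")
      case True
      note U = Upos[OF True]
      define a where "a = norm (x - y)"
      define b where "b = norm (refl_pt k x - y)"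
      define A where "A = a powr (- 2 * s - real CARD('n))"
      define B where "B = b powr (- 2 * s - real CARD('n))"
      define h where "h = y $ k - x $ k"
      have a: "a > 0" using U by (simp add: a_def)
      have ab: "a \<le> b" using norm_diff_le_refl_diff[of x k y] x U by (simp add: a_def b_def)
      have xb: "x $ k \<le> b" using nth_add_le_refl_diff[of x k y] U by (simp add: b_def)
      have h: "\<bar>h\<bar> \<le> a" using hle by (simp add: h_def a_def)
      have ex: "- 2 * s - real CARD('n) = - (real CARD('n) + 2 * s)" by simp
      have K: "frac_kernel k s x y = A - B"
        unfolding frac_kernel_def A_def B_def a_def b_def ex by (simp only: powr_minus divide_inverse mult_1_left)
      have K0: "0 \<le> A - B" using frac_kernel_nonneg[OF s x U(1) U(4)] K by simp
      have B0: "B \<ge> 0" by (simp add: B_def)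
      have W: "A * a\<^sup>2 = w y" using wsq[OF True] by (simp add: A_def a_def)
      have "(A - B) * h\<^sup>2 \<le> A * a\<^sup>2"
        using h K0 B0 by (intro mult_mono) (auto simp: abs_le_square_iff[symmetric])
      \<comment> \<open>\<open>x $ k\<close> is at most the reflected distance b, and
        \<open>b powr (1 - 2 * s - n)\<close> is decreasing in b because n is at least 1.\<close>
      moreover have "B * (x $ k * \<bar>h\<bar>) \<le> A * a\<^sup>2"
      proof -
        have n1: "real CARD('n) \<ge> 1" by (simp add: Suc_le_eq)
        have "B * (x $ k * \<bar>h\<bar>) \<le> B * (b * a)"
          using xb h x B0 by (intro mult_left_mono mult_mono) auto
        also have "\<dots> = (b powr (- 2 * s - real CARD('n)) * b powr 1) * a" using a ab by (simp add: B_def)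
        also have "\<dots> = b powr (- 2 * s - real CARD('n) + 1) * a" by (simp only: powr_add)
        also have "\<dots> \<le> a powr (- 2 * s - real CARD('n) + 1) * a"
          using a ab s n1 by (intro mult_right_mono powr_mono2') (auto simp del: one_le_card_finite)
        also have "\<dots> = A * a\<^sup>2" using a by (simp add: A_def powr_add power2_eq_square)
        finally show ?thesis .
      qed
      ultimately have "\<bar>(A - B) * h\<^sup>2\<bar> + \<bar>B * (x $ k * h)\<bar> \<le> 2 * w y"
        using K0 B0 x W by (simp add: abs_mult)
      moreover have "f y - g y = (A - B) * h\<^sup>2 - B * (x $ k * h)"
      proof -
        have yk: "y $ k = x $ k + h" by (simp add: h_def)
        show ?thesis unfolding f_def g_def K A_def a_def[symmetric] yk using True
          by (simp add: power2_eq_square algebra_simps)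
      qed
      ultimately have "\<bar>f y - g y\<bar> \<le> 2 * w y" by linarith
      then show ?thesis using U by simp
    qed (simp add: f_def g_def w0)
    have gg: "\<bar>g y + g (2 *\<^sub>R x - y)\<bar> \<le> 2 * (indicator (ball x r) y * w y)" for y
    proof -
      let ?z = "2 *\<^sub>R x - y"
      have nz: "norm (x - ?z) = norm (x - y)"
        using norm_minus_commute[of x y] by (simp add: scaleR_2 algebra_simps)
      have zk: "?z $ k - x $ k = - (y $ k - x $ k)" by simp
      have bound: "\<bar>g v\<bar> \<le> indicator (ball x r) v * w v" if "\<bar>v $ k - x $ k\<bar> \<ge> x $ k" for v
      proof (cases "v \<in> U")
        case True
        have "x $ k * \<bar>v $ k - x $ k\<bar> \<le> norm (x - v) * norm (x - v)"
          using that hle[of v] x by (intro mult_mono) auto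
        then have "norm (x - v) powr (- 2 * s - real CARD('n)) * (x $ k * \<bar>v $ k - x $ k\<bar>) \<le> norm (x - v) powr (- 2 * s - real CARD('n)) * (norm (x - v))\<^sup>2"
          unfolding power2_eq_square by (intro mult_left_mono) auto
        moreover have "\<bar>g v\<bar> = norm (x - v) powr (- 2 * s - real CARD('n)) * (x $ k * \<bar>v $ k - x $ k\<bar>)"
          using True x by (simp add: g_def abs_mult)
        ultimately show ?thesis unfolding wsq[OF True] using Upos(6)[OF True] by simp
      qed (simp add: g_def w0)
      show ?thesis
      proof (cases "\<bar>y $ k - x $ k\<bar> \<ge> x $ k")
        case True
        have "\<bar>g y\<bar> \<le> indicator (ball x r) y * w y" by (rule bound[OF True])
        moreover have "\<bar>g ?z\<bar> \<le> indicator (ball x r) ?z * w ?z" by (rule bound) (use True zk in simp)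
        moreover have "indicator (ball x r) ?z * w ?z = indicator (ball x r) y * w y"
          using nz by (simp add: w_def indicator_def dist_norm)
        ultimately show ?thesis by linarith
      next
        case False
        then have "y \<in> halfsp k" "?z \<in> halfsp k" by (auto simp: halfsp_def)
        then have "?z \<in> U \<longleftrightarrow> y \<in> U" using nz by (simp add: U_def dist_norm)
        then have "g ?z = - g y" unfolding g_def nz zk by (simp add: indicator_def algebra_simps)
        then show ?thesis by (simp add: w0)
      qed
    qed
    have gi: "integrable lebesgue f"
    proof -
      \<comment> \<open>Integrability is only qualitative, so a factor \<open>1 / \<epsilon>\<close>
        is allowed here.\<close>
      have "set_integrable lebesgue (ball x r) (\<lambda>y. 4 * (real CARD('n) + 2) * x $ k / \<epsilon> * w y)"
        using wi by simp
      then have "set_integrable lebesgue U (\<lambda>y. frac_kernel k s x y * y $ k * (y $ k - x $ k))"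
      proof (rule set_integrable_dominated(1))
        fix y assume y: "y \<in> U"
        note U = Upos[OF y]
        have K0: "0 \<le> frac_kernel k s x y * y $ k" using frac_kernel_nonneg[OF s x U(1) U(4)] U by simp
        have "\<bar>y $ k - x $ k\<bar> * \<epsilon> \<le> norm (x - y) * norm (x - y)"
          using hle[of y] U \<epsilon> by (intro mult_mono) auto
        then have h2: "\<bar>y $ k - x $ k\<bar> \<le> (norm (x - y))\<^sup>2 / \<epsilon>"
          using \<epsilon> by (simp add: power2_eq_square field_simps)
        have "\<bar>frac_kernel k s x y * y $ k * (y $ k - x $ k)\<bar> = frac_kernel k s x y * y $ k * \<bar>y $ k - x $ k\<bar>"
          unfolding abs_mult[of "frac_kernel k s x y * y $ k"] using K0 by (simp only: abs_of_nonneg)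
        also have "\<dots> \<le> (4 * (real CARD('n) + 2) * x $ k * norm (x - y) powr (- 2 * s - real CARD('n))) * ((norm (x - y))\<^sup>2 / \<epsilon>)"
          using x by (intro mult_mono[OF frac_kernel_nth_le[OF s x U(1) U(4)] h2]) auto
        also have "\<dots> = 4 * (real CARD('n) + 2) * x $ k / \<epsilon> * w y"
          unfolding wsq[OF y, symmetric] by simp
        finally show "\<bar>frac_kernel k s x y * y $ k * (y $ k - x $ k)\<bar> \<le> 4 * (real CARD('n) + 2) * x $ k / \<epsilon> * w y" .
      qed (use x \<epsilon> w0 in \<open>auto simp: U_def\<close>)
      then show ?thesis by (simp add: set_integrable_def f_def[abs_def])
    qed
    have Fi: "integrable lebesgue F"
      using wi by (simp add: F_def[abs_def] set_integrable_def)
    have "\<bar>integral\<^sup>L lebesgue f\<bar> \<le> integral\<^sup>L lebesgue F"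
    proof (rule abs_integral_le_symmetrised[OF reflect_point_preserves[of x] gi Fi])
      fix y
      have "norm (x - (2 *\<^sub>R x - y)) = norm (x - y)"
        using norm_minus_commute[of x y] by (simp add: scaleR_2 algebra_simps)
      then have "indicator (ball x r) (2 *\<^sub>R x - y) * w (2 *\<^sub>R x - y) = indicator (ball x r) y * w y"
        by (simp add: w_def indicator_def dist_norm)
      then show "\<bar>f y + f (2 *\<^sub>R x - y)\<bar> \<le> 2 * F y"
        using fg[of y] fg[of "2 *\<^sub>R x - y"] gg[of y] unfolding F_def by linarith
    qed
    also have "integral\<^sup>L lebesgue F = 3 * (LINT y : ball x r | lebesgue. w y)"
      using wi by (simp add: F_def[abs_def] set_lebesgue_integral_def)
    also have "\<dots> \<le> 3 * (C0 * r powr (2 - 2 * s))"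
      using C0r[OF r, of x] by (simp add: w_def[abs_def])
    finally show "\<bar>LINT y : halfsp k \<inter> (ball x r - ball x \<epsilon>) | lebesgue. frac_kernel k s x y * y $ k * (y $ k - x $ k)\<bar>
       \<le> 3 * C0 * r powr (2 - 2 * s)"
      by (simp add: set_lebesgue_integral_def f_def[abs_def] U_def)
  qed
qed

text \<open>Symmetrising by \<open>flip_pt\<close> leaves quadratic terms and one linear term. For
  the former the kernel bound supplies the factor \<open>x $ k\<close>; the latter carries it in its
  coefficient, so the estimate of \<open>kernel_annulus_linear\<close>, which has no such factor,
  suffices.\<close>

lemma kernel_annulus_qfun:
  assumes D: "D \<ge> 1"
  shows "\<exists>C>0. \<forall>(x::real^'n) p r \<epsilon>. x $ k > 0 \<and> norm x \<le> D \<and> norm p \<le> D \<and> 0 < \<epsilon> \<and> 0 < r \<and> r \<le> 1 \<longrightarrow>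
     set_integrable lebesgue (halfsp k \<inter> (ball x r - ball x \<epsilon>)) (\<lambda>y. frac_kernel k s x y * y $ k * (qfun k p y - qfun k p x)) \<and>
     \<bar>LINT y : halfsp k \<inter> (ball x r - ball x \<epsilon>) | lebesgue. frac_kernel k s x y * y $ k * (qfun k p y - qfun k p x)\<bar>
       \<le> C * x $ k * r powr (2 - 2 * s)"
proof -
  obtain C0 where C0: "C0 > 0" and C0r: "\<And>r x::real^'n. r > 0 \<Longrightarrow>
     set_integrable lebesgue (ball x r) (\<lambda>y. norm (x - y) powr (2 - 2 * s - real CARD('n))) \<and>
     (LINT y : ball x r | lebesgue. norm (x - y) powr (2 - 2 * s - real CARD('n))) \<le> C0 * r powr (2 - 2 * s)"
    using ball_radial_integral_at[of "2 - 2 * s", where 'n='n] s by auto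
  obtain C1 where C1: "C1 > 0" and C1r: "\<And>(x::real^'n) r \<epsilon>. x $ k > 0 \<Longrightarrow> 0 < \<epsilon> \<Longrightarrow> 0 < r \<Longrightarrow>
     \<bar>LINT y : halfsp k \<inter> (ball x r - ball x \<epsilon>) | lebesgue. frac_kernel k s x y * y $ k * (y $ k - x $ k)\<bar>
       \<le> C1 * r powr (2 - 2 * s)"
    using kernel_annulus_linear by blast
  \<comment> \<open>The coefficients of the squared distance in the bounds for the quadratic terms
    of \<open>qfun_flip_sum\<close>; \<open>2 * D + 1\<close> bounds \<open>x $ k + y $ k\<close>
    because r is at most 1.\<close>
  define c2 where "c2 = 1 + (2 * D + 1)\<^sup>2 + 2 * D\<^sup>2"
  define cn where "cn = 4 * (real CARD('n) + 2)"
  define C where "C = cn * c2 * C0 + 4 * D\<^sup>2 * C1"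
  have cn: "cn > 0" by (simp add: cn_def)
  have c2: "c2 > 0" by (simp add: c2_def add_pos_nonneg)
  have C: "C > 0" using C0 C1 c2 cn D unfolding C_def by (intro add_pos_nonneg) auto
  show ?thesis
  proof (intro exI[of _ C] conjI allI impI; (elim conjE)?)
    fix x p :: "real^'n" and r \<epsilon> :: real
    assume x: "x $ k > 0" and xD: "norm x \<le> D" and pD: "norm p \<le> D" and \<epsilon>: "0 < \<epsilon>" and r: "0 < r" "r \<le> 1"
    define U where "U = halfsp k \<inter> (ball x r - ball x \<epsilon>)"
    have Ub: "U \<in> sets borel" by (auto simp: U_def)
    define w where "w y = norm (x - y) powr (2 - 2 * s - real CARD('n))" for y
    have w0: "w y \<ge> 0" for y by (simp add: w_def)
    have wi: "set_integrable lebesgue (ball x r) w" using C0r[OF r(1), of x] by (simp add: w_def[abs_def])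
    have Upos: "y $ k > 0" "norm (x - y) \<ge> \<epsilon>" "norm (x - y) > 0" "x \<noteq> y" "norm (x - y) < r" "y \<in> ball x r" if "y \<in> U" for y
      using that \<epsilon> by (auto simp: U_def halfsp_def dist_norm)
    have wsq: "norm (x - y) powr (- 2 * s - real CARD('n)) * (norm (x - y))\<^sup>2 = w y" if "y \<in> U" for y
      unfolding w_def by (rule powr_minus_mult_sq[OF Upos(3)[OF that]])
    have hle: "\<bar>y $ k - x $ k\<bar> \<le> norm (x - y)" for y
      using abs_nth_le_norm[of "x - y" k] by simp
    have K0: "0 \<le> frac_kernel k s x y * y $ k" if "y \<in> U" for y
      using frac_kernel_nonneg[OF s x Upos(1)[OF that] Upos(4)[OF that]] Upos[OF that] by simp
    have Kle: "frac_kernel k s x y * y $ k * (c * (norm (x - y))\<^sup>2) \<le> cn * x $ k * c * w y" if "y \<in> U" "c \<ge> 0" for y c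
    proof -
      have "frac_kernel k s x y * y $ k * (c * (norm (x - y))\<^sup>2) \<le>
        (cn * x $ k * norm (x - y) powr (- 2 * s - real CARD('n))) * (c * (norm (x - y))\<^sup>2)"
        using frac_kernel_nth_le[OF s x Upos(1)[OF that(1)] Upos(4)[OF that(1)]] that(2)
        unfolding cn_def by (intro mult_right_mono) auto
      then show ?thesis using wsq[OF that(1)] by (simp add: mult_ac)
    qed
    have yD: "norm y \<le> D + 1" if "y \<in> U" for y
      using Upos(5)[OF that] xD r norm_triangle_ineq4[of x "x - y"] by simp
    define L where "L = 8 * (D + 1) + 4 * (D + 1) ^ 3"
    have L: "L \<ge> 0" using D by (simp add: L_def)
    have qL: "\<bar>qfun k p y - qfun k p x\<bar> \<le> L * norm (x - y)" if "y \<in> U" for y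
      unfolding L_def using yD[OF that] xD pD by (intro qfun_lipschitz) auto
    \<comment> \<open>Outside the small ball a first power of the distance is at most its square
      over \<open>\<epsilon>\<close>. This serves integrability only; the size of these integrals is
      estimated by symmetry.\<close>
    have dom1: "\<bar>frac_kernel k s x y * y $ k * t\<bar> \<le> cn * x $ k * (l / \<epsilon>) * w y"
      if y: "y \<in> U" and t: "\<bar>t\<bar> \<le> l * norm (x - y)" and l: "l \<ge> 0" for y t l
    proof -
      note U = Upos[OF y]
      have "norm (x - y) * \<epsilon> \<le> norm (x - y) * norm (x - y)"
        using U \<epsilon> by (intro mult_left_mono) auto
      then have "norm (x - y) \<le> (norm (x - y))\<^sup>2 / \<epsilon>"
        using \<epsilon> by (simp add: power2_eq_square field_simps)
      then have "l * norm (x - y) \<le> l * ((norm (x - y))\<^sup>2 / \<epsilon>)" using l by (rule mult_left_mono)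
      then have "\<bar>t\<bar> \<le> l / \<epsilon> * (norm (x - y))\<^sup>2" using t by simp
      then have "frac_kernel k s x y * y $ k * \<bar>t\<bar> \<le> frac_kernel k s x y * y $ k * (l / \<epsilon> * (norm (x - y))\<^sup>2)"
        using K0[OF y] by (rule mult_left_mono)
      also have "\<dots> \<le> cn * x $ k * (l / \<epsilon>) * w y" using y l \<epsilon> by (intro Kle) auto
      finally show ?thesis
        unfolding abs_mult[of "frac_kernel k s x y * y $ k" t] using K0[OF y] by (simp only: abs_of_nonneg)
    qed
    have fint: "set_integrable lebesgue U (\<lambda>y. frac_kernel k s x y * y $ k * (qfun k p y - qfun k p x))"
    proof (rule set_integrable_dominated(1))
      show "set_integrable lebesgue (ball x r) (\<lambda>y. cn * x $ k * (L / \<epsilon>) * w y)" using wi by simp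
      show "\<bar>frac_kernel k s x y * y $ k * (qfun k p y - qfun k p x)\<bar> \<le> cn * x $ k * (L / \<epsilon>) * w y" if "y \<in> U" for y
        using that qL[OF that] L by (rule dom1)
      show "(\<lambda>y. frac_kernel k s x y * y $ k * (qfun k p y - qfun k p x)) \<in> borel_measurable borel" by measurable
    qed (use Ub x cn L w0 \<epsilon> in \<open>auto simp: U_def\<close>)
    define f1 where "f1 y = frac_kernel k s x y * y $ k * ((norm (x - y))\<^sup>2 - (y $ k - x $ k)\<^sup>2 + ((y $ k)\<^sup>2 - (x $ k)\<^sup>2)\<^sup>2
       + 2 * ((x $ k)\<^sup>2 - (p $ k)\<^sup>2) * (y $ k - x $ k)\<^sup>2)" for y
    define f2 where "f2 y = frac_kernel k s x y * y $ k * (y $ k - x $ k)" for y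
    have f1le: "\<bar>f1 y\<bar> \<le> cn * x $ k * c2 * w y" if y: "y \<in> U" for y
    proof -
      note U = Upos[OF y]
      let ?a = "norm (x - y)"
      have h2: "(y $ k - x $ k)\<^sup>2 \<le> ?a\<^sup>2" using hle[of y] abs_le_square_iff[of "y $ k - x $ k" ?a] by simp
      have xk: "x $ k \<le> D" using abs_nth_le_norm[of x k] xD by simp
      have yk: "y $ k \<le> D + 1" using abs_nth_le_norm[of y k] yD[OF y] by simp
      have "((y $ k)\<^sup>2 - (x $ k)\<^sup>2)\<^sup>2 = (y $ k - x $ k)\<^sup>2 * (y $ k + x $ k)\<^sup>2"
        by (simp add: power2_eq_square algebra_simps)
      also have "\<dots> \<le> ?a\<^sup>2 * (2 * D + 1)\<^sup>2"
        using x U xk yk by (intro mult_mono[OF h2 power_mono]) auto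
      finally have 1: "((y $ k)\<^sup>2 - (x $ k)\<^sup>2)\<^sup>2 \<le> ?a\<^sup>2 * (2 * D + 1)\<^sup>2" .
      have "(x $ k)\<^sup>2 \<le> D\<^sup>2" "(p $ k)\<^sup>2 \<le> D\<^sup>2"
        using abs_nth_le_norm[of x k] abs_nth_le_norm[of p k] xD pD D by (simp_all add: abs_le_square_iff[symmetric])
      then have "\<bar>(x $ k)\<^sup>2 - (p $ k)\<^sup>2\<bar> \<le> D\<^sup>2"
        using zero_le_power2[of "x $ k"] zero_le_power2[of "p $ k"] by linarith
      then have 2: "\<bar>(x $ k)\<^sup>2 - (p $ k)\<^sup>2\<bar> * (y $ k - x $ k)\<^sup>2 \<le> D\<^sup>2 * ?a\<^sup>2"
        using h2 by (intro mult_mono) auto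
      have "\<bar>?a\<^sup>2 - (y $ k - x $ k)\<^sup>2 + ((y $ k)\<^sup>2 - (x $ k)\<^sup>2)\<^sup>2 + 2 * ((x $ k)\<^sup>2 - (p $ k)\<^sup>2) * (y $ k - x $ k)\<^sup>2\<bar>
        \<le> \<bar>?a\<^sup>2 - (y $ k - x $ k)\<^sup>2\<bar> + \<bar>((y $ k)\<^sup>2 - (x $ k)\<^sup>2)\<^sup>2\<bar> + \<bar>2 * ((x $ k)\<^sup>2 - (p $ k)\<^sup>2) * (y $ k - x $ k)\<^sup>2\<bar>"
        by linarith
      also have "\<bar>?a\<^sup>2 - (y $ k - x $ k)\<^sup>2\<bar> \<le> ?a\<^sup>2" using h2 zero_le_power2[of "y $ k - x $ k"] by linarith
      also have "\<bar>((y $ k)\<^sup>2 - (x $ k)\<^sup>2)\<^sup>2\<bar> \<le> ?a\<^sup>2 * (2 * D + 1)\<^sup>2" using 1 by simp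
      also have "\<bar>2 * ((x $ k)\<^sup>2 - (p $ k)\<^sup>2) * (y $ k - x $ k)\<^sup>2\<bar> \<le> 2 * (D\<^sup>2 * ?a\<^sup>2)"
        using 2 unfolding abs_mult by simp
      finally have "\<bar>?a\<^sup>2 - (y $ k - x $ k)\<^sup>2 + ((y $ k)\<^sup>2 - (x $ k)\<^sup>2)\<^sup>2 + 2 * ((x $ k)\<^sup>2 - (p $ k)\<^sup>2) * (y $ k - x $ k)\<^sup>2\<bar>
        \<le> c2 * ?a\<^sup>2" by (simp add: c2_def algebra_simps)
      then have "\<bar>f1 y\<bar> \<le> frac_kernel k s x y * y $ k * (c2 * ?a\<^sup>2)"
        unfolding f1_def abs_mult[of "frac_kernel k s x y * y $ k"] using K0[OF y]
        by (simp only: abs_of_nonneg) (rule mult_left_mono)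
      also have "\<dots> \<le> cn * x $ k * c2 * w y" using y c2 by (intro Kle) auto
      finally show ?thesis .
    qed
    have dm: "set_integrable lebesgue (ball x r) (\<lambda>y. cn * x $ k * c2 * w y)" using wi by simp
    have f1: "set_integrable lebesgue U f1" "\<bar>LINT y : U | lebesgue. f1 y\<bar> \<le> (LINT y : ball x r | lebesgue. cn * x $ k * c2 * w y)"
    proof -
      have m: "f1 \<in> borel_measurable borel" unfolding f1_def by measurable
      show "set_integrable lebesgue U f1" "\<bar>LINT y : U | lebesgue. f1 y\<bar> \<le> (LINT y : ball x r | lebesgue. cn * x $ k * c2 * w y)"
        using set_integrable_dominated[OF dm m Ub _ f1le] x cn c2 w0 by (auto simp: U_def)
    qed
    have f2: "set_integrable lebesgue U f2"
    proof (rule set_integrable_dominated(1))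
      show "set_integrable lebesgue (ball x r) (\<lambda>y. cn * x $ k * (1 / \<epsilon>) * w y)" using wi by simp
      show "\<bar>f2 y\<bar> \<le> cn * x $ k * (1 / \<epsilon>) * w y" if "y \<in> U" for y
        unfolding f2_def using that by (rule dom1) (use hle in auto)
      show "f2 \<in> borel_measurable borel" unfolding f2_def by measurable
    qed (use Ub x cn w0 \<epsilon> in \<open>auto simp: U_def\<close>)
    let ?f = "\<lambda>y. indicator U y * (frac_kernel k s x y * y $ k * (qfun k p y - qfun k p x))"
    let ?m = "4 * ((x $ k)\<^sup>2 - (p $ k)\<^sup>2) * x $ k"
    have fi: "integrable lebesgue ?f" using fint by (simp add: set_integrable_def)
    have flipU: "flip_pt k x y \<in> U \<longleftrightarrow> y \<in> U" for y
      by (simp add: U_def halfsp_def flip_pt_nth dist_norm)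
    have half: "c * (2 * (A + m * h)) / 2 = c * A + m * (c * h)" for c A m h :: real
      by (simp add: algebra_simps)
    have sym: "(?f y + ?f (flip_pt k x y)) / 2 = indicator U y *\<^sub>R f1 y + ?m * (indicator U y *\<^sub>R f2 y)" for y
    proof (cases "y \<in> U")
      case True
      then have "?f y + ?f (flip_pt k x y) = frac_kernel k s x y * y $ k *
         ((qfun k p y - qfun k p x) + (qfun k p (flip_pt k x y) - qfun k p x))"
        using flipU[of y] by (simp add: flip_pt_nth ring_distribs)
      also have "\<dots> / 2 = f1 y + ?m * f2 y"
        unfolding qfun_flip_sum f1_def f2_def by (rule half)
      finally show ?thesis using True by simp
    qed (simp add: flipU)
    have "integral\<^sup>L lebesgue ?f = (\<integral>y. indicator U y *\<^sub>R f1 y + ?m * (indicator U y *\<^sub>R f2 y) \<partial>lebesgue)"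
      unfolding sym[symmetric] by (rule integral_symmetrised(2)[OF flip_pt_preserves fi])
    also have "\<dots> = (LINT y : U | lebesgue. f1 y) + ?m * (LINT y : U | lebesgue. f2 y)"
      unfolding set_lebesgue_integral_def using f1(1) f2 unfolding set_integrable_def
      by (subst Bochner_Integration.integral_add) auto
    finally have eq: "(LINT y : U | lebesgue. frac_kernel k s x y * y $ k * (qfun k p y - qfun k p x)) =
      (LINT y : U | lebesgue. f1 y) + ?m * (LINT y : U | lebesgue. f2 y)"
      by (simp add: set_lebesgue_integral_def)
    have "\<bar>LINT y : U | lebesgue. f1 y\<bar> \<le> cn * x $ k * c2 * (C0 * r powr (2 - 2 * s))"
    proof -
      note f1(2)
      also have "(LINT y : ball x r | lebesgue. cn * x $ k * c2 * w y) = cn * x $ k * c2 * (LINT y : ball x r | lebesgue. w y)"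
        by simp
      also have "\<dots> \<le> cn * x $ k * c2 * (C0 * r powr (2 - 2 * s))"
        using C0r[OF r(1), of x] cn x c2 by (intro mult_left_mono) (auto simp: w_def[abs_def])
      finally show ?thesis .
    qed
    moreover have "\<bar>?m * (LINT y : U | lebesgue. f2 y)\<bar> \<le> (4 * D\<^sup>2 * x $ k) * (C1 * r powr (2 - 2 * s))"
      unfolding abs_mult[of ?m]
    proof (rule mult_mono)
      have "(x $ k)\<^sup>2 \<le> D\<^sup>2" "(p $ k)\<^sup>2 \<le> D\<^sup>2"
        using abs_nth_le_norm[of x k] abs_nth_le_norm[of p k] xD pD D by (simp_all add: abs_le_square_iff[symmetric])
      then have "\<bar>(x $ k)\<^sup>2 - (p $ k)\<^sup>2\<bar> \<le> D\<^sup>2"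
        using zero_le_power2[of "x $ k"] zero_le_power2[of "p $ k"] by linarith
      then show "\<bar>?m\<bar> \<le> 4 * D\<^sup>2 * x $ k" using x by (simp add: abs_mult)
      show "\<bar>LINT y : U | lebesgue. f2 y\<bar> \<le> C1 * r powr (2 - 2 * s)"
        using C1r[OF x \<epsilon> r(1)] by (simp add: U_def f2_def[abs_def])
    qed (use x in auto)
    ultimately have "\<bar>LINT y : U | lebesgue. frac_kernel k s x y * y $ k * (qfun k p y - qfun k p x)\<bar> \<le>
      cn * x $ k * c2 * (C0 * r powr (2 - 2 * s)) + (4 * D\<^sup>2 * x $ k) * (C1 * r powr (2 - 2 * s))"
      unfolding eq by linarith
    also have "\<dots> = C * x $ k * r powr (2 - 2 * s)" by (simp add: C_def algebra_simps)
    finally show "\<bar>LINT y : halfsp k \<inter> (ball x r - ball x \<epsilon>) | lebesgue. frac_kernel k s x y * y $ k * (qfun k p y - qfun k p x)\<bar>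
       \<le> C * x $ k * r powr (2 - 2 * s)" unfolding U_def .
    show "set_integrable lebesgue (halfsp k \<inter> (ball x r - ball x \<epsilon>)) (\<lambda>y. frac_kernel k s x y * y $ k * (qfun k p y - qfun k p x))"
      using fint unfolding U_def .
  qed (rule C)
qed

end

section \<open>Continuity of the operator and the zero order term\<close>

text \<open>Constants have finite norm, since this weight decays at least like the power -n-2s-1. It
  dominates the part of the truncated integral that contains the value of \<open>u\<close> at the
  centre.\<close>

lemma weight_integrable:
  fixes k :: "'n::finite" and s :: real
  assumes s: "0 < s"
  shows "set_integrable lebesgue (halfsp k) (\<lambda>y::real^'n. y $ k / (1 + norm y powr (real CARD('n) + 2 * s + 2)))"
proof -
  define w where "w = (\<lambda>y::real^'n. norm (0 - y) powr (- (2 * s + 1) - real CARD('n)))"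
  have "set_integrable lebesgue (- ball (0::real^'n) 1) w"
  proof -
    have "set_integrable lebesgue (- ball x 1) (\<lambda>y. norm (x - y) powr (- (2 * s + 1) - real CARD('n)))" for x :: "real^'n"
      using ball_compl_radial_integral_at[of "2 * s + 1" 1, where 'n='n] s by auto
    from this[of 0] show ?thesis unfolding w_def .
  qed
  moreover have "set_integrable lebesgue (ball (0::real^'n) 1) (\<lambda>_. 1::real)"
    unfolding set_integrable_def real_scaleR_def
    by (intro integrable_mult_left) (simp flip: lmeasurable_iff_integrable)
  ultimately have "set_integrable lebesgue UNIV (\<lambda>y. indicator (ball 0 1) y * 1 + indicator (- ball 0 1) y * w y)"
    by (simp add: set_integrable_def)
  then show ?thesis
  proof (rule set_integrable_dominated(1))
    fix y :: "real^'n" assume "y \<in> halfsp k"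
    then have y: "0 < y $ k" by (simp add: halfsp_def)
    have yn: "y $ k \<le> norm y" using abs_nth_le_norm[of y k] by simp
    show "\<bar>y $ k / (1 + norm y powr (real CARD('n) + 2 * s + 2))\<bar> \<le> indicator (ball 0 1) y * 1 + indicator (- ball 0 1) y * w y"
    proof (cases "norm y < 1")
      case True
      then have "y $ k * 1 \<le> 1 * (1 + norm y powr (real CARD('n) + 2 * s + 2))"
        using y yn by (intro mult_mono) auto
      then have "y $ k / (1 + norm y powr (real CARD('n) + 2 * s + 2)) \<le> 1"
        by (simp add: divide_le_eq add_pos_nonneg)
      then show ?thesis using y True by simp
    next
      case False
      then have n: "norm y > 0" by linarith
      have "y $ k / (1 + norm y powr (real CARD('n) + 2 * s + 2)) \<le> norm y / norm y powr (real CARD('n) + 2 * s + 2)"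
        using y yn n by (intro frac_le) auto
      also have "\<dots> = norm y powr 1 / norm y powr (real CARD('n) + 2 * s + 2)" using n by simp
      also have "\<dots> = norm y powr (1 - (real CARD('n) + 2 * s + 2))" by (rule powr_diff[symmetric])
      also have "1 - (real CARD('n) + 2 * s + 2) = - (2 * s + 1) - real CARD('n)" by simp
      finally show ?thesis using y False by (simp add: w_def)
    qed
  qed (auto simp: w_def)
qed

text \<open>Off-diagonal counterpart of \<open>frac_kernel_lower\<close>: at distance at least r,
  \<open>1 + norm y\<close> is at most \<open>(2 + D) / r\<close> times the distance. The power of r
  is kept explicit because the upper barrier works with a radius that shrinks where the barrier
  blows up.\<close>

lemma frac_kernel_upper_weight:
  fixes x y :: "real^'n::finite"
  assumes s: "0 < s" "s < 1" and x: "x $ k > 0" "norm x \<le> D" and y: "y $ k > 0"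
    and r: "0 < r" "r \<le> 1" "r \<le> norm (x - y)"
  defines "e \<equiv> real CARD('n) + 2 * s"
  shows "frac_kernel k s x y \<le> 8 * (real CARD('n) + 2) * (2 + D) powr (e + 2) * r powr - (e + 2) * x $ k * (y $ k / (1 + norm y powr (e + 2)))"
proof -
  define a where "a = norm (x - y)"
  have a: "a > 0" "r \<le> a" using r unfolding a_def by linarith+
  have xy: "x \<noteq> y" using a(1) unfolding a_def by simp
  have e: "e > 0" using s by (simp add: e_def add_pos_pos)
  have D0: "D \<ge> 0" using x(2) norm_ge_zero order_trans by blast
  have "1 + norm y \<le> (1 + D) * 1 + a * 1"
    using norm_triangle_ineq4[of x "x - y"] x by (simp add: a_def)
  also have "\<dots> \<le> (1 + D) * (a / r) + a * (1 / r)"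
    using r a D0 by (intro add_mono mult_left_mono) auto
  also have "\<dots> = (2 + D) / r * a" using r by (simp add: field_simps)
  finally have le: "1 + norm y \<le> (2 + D) / r * a" .
  have "1 + norm y powr (e + 2) \<le> (1 + norm y) powr (e + 2) + (1 + norm y) powr (e + 2)"
    using e by (intro add_mono powr_mono2) (auto intro!: ge_one_powr_ge_zero)
  also have "\<dots> \<le> 2 * ((2 + D) / r * a) powr (e + 2)"
    using powr_mono2[of "e + 2" "1 + norm y" "(2 + D) / r * a"] le e by simp
  also have "\<dots> = 2 * ((2 + D) powr (e + 2) * r powr - (e + 2) * a powr (e + 2))"
    using r a D0 unfolding powr_minus by (simp add: powr_mult inverse_powr divide_inverse)
  finally have le2: "1 + norm y powr (e + 2) \<le> 2 * ((2 + D) powr (e + 2) * r powr - (e + 2) * a powr (e + 2))" .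
  have "a powr - (e + 2) * (1 + norm y powr (e + 2)) \<le> a powr - (e + 2) * (2 * ((2 + D) powr (e + 2) * r powr - (e + 2) * a powr (e + 2)))"
    by (rule mult_left_mono[OF le2]) simp
  also have "\<dots> = 2 * (2 + D) powr (e + 2) * r powr - (e + 2) * (a powr - (e + 2) * a powr (e + 2))"
    by simp
  also have "a powr - (e + 2) * a powr (e + 2) = 1" using a by (simp add: powr_add[symmetric])
  finally have "a powr - (e + 2) \<le> 2 * (2 + D) powr (e + 2) * r powr - (e + 2) * 1 / (1 + norm y powr (e + 2))"
    by (simp add: pos_le_divide_eq add_pos_nonneg)
  then have "(4 * (real CARD('n) + 2) * x $ k * y $ k) * a powr - (e + 2) \<le>
    (4 * (real CARD('n) + 2) * x $ k * y $ k) * (2 * (2 + D) powr (e + 2) * r powr - (e + 2) * 1 / (1 + norm y powr (e + 2)))"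
    using x y by (intro mult_left_mono) auto
  moreover have "frac_kernel k s x y \<le> (4 * (real CARD('n) + 2) * x $ k * y $ k) * a powr - (e + 2)"
  proof -
    have "- 2 * s - real CARD('n) - 2 = - (e + 2)" by (simp add: e_def)
    then show ?thesis using frac_kernel_le_far[OF s x(1) y xy] by (simp only: a_def)
  qed
  moreover have "(4 * (real CARD('n) + 2) * x $ k * y $ k) * (2 * (2 + D) powr (e + 2) * r powr - (e + 2) * 1 / (1 + norm y powr (e + 2))) =
    8 * (real CARD('n) + 2) * (2 + D) powr (e + 2) * r powr - (e + 2) * x $ k * (y $ k / (1 + norm y powr (e + 2)))"
    by simp
  ultimately show ?thesis by linarith
qed

section \<open>Second differences of functions of class C^(2s+\<alpha>)\<close>

lemma has_real_derivative_line:
  fixes f :: "real^'n::finite \<Rightarrow> real"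
  assumes "f differentiable (at (a + t *\<^sub>R h))"
  shows "((\<lambda>t. f (a + t *\<^sub>R h)) has_real_derivative (\<Sum>j\<in>UNIV. h $ j * dpart [j] f (a + t *\<^sub>R h))) (at t)"
proof -
  let ?D = "frechet_derivative f (at (a + t *\<^sub>R h))"
  have D: "(f has_derivative ?D) (at (a + t *\<^sub>R h))"
    using assms by (simp add: frechet_derivative_works)
  have lin: "linear ?D" using D by (rule has_derivative_linear)
  have "((\<lambda>t. a + t *\<^sub>R h) has_derivative (\<lambda>d. d *\<^sub>R h)) (at t)"
    by (auto intro!: derivative_eq_intros)
  from diff_chain_at[OF this, of f ?D] D
  have "((\<lambda>t. f (a + t *\<^sub>R h)) has_derivative (\<lambda>d. ?D (d *\<^sub>R h))) (at t)"
    by (simp add: o_def)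
  moreover have "?D (d *\<^sub>R h) = d * (\<Sum>j\<in>UNIV. h $ j * dpart [j] f (a + t *\<^sub>R h))" for d
  proof -
    have h: "(\<Sum>j\<in>UNIV. h $ j *\<^sub>R axis j 1) = h"
      using basis_expansion[of h] by (simp add: scalar_mult_eq_scaleR)
    have "?D (\<Sum>j\<in>UNIV. h $ j *\<^sub>R axis j 1) = (\<Sum>j\<in>UNIV. h $ j * ?D (axis j 1))"
      by (simp add: linear_sum[OF lin] linear_scale[OF lin])
    then have "?D h = (\<Sum>j\<in>UNIV. h $ j * ?D (axis j 1))" unfolding h .
    then show ?thesis by (simp add: linear_scale[OF lin])
  qed
  then have "(\<lambda>d. ?D (d *\<^sub>R h)) = (*) (\<Sum>j\<in>UNIV. h $ j * dpart [j] f (a + t *\<^sub>R h))"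
    by (intro ext) (simp only: mult.commute)
  ultimately show ?thesis by (simp only: has_field_derivative_def)
qed

lemma lipschitz_of_bounded_partials:
  fixes f :: "real^'n::finite \<Rightarrow> real"
  assumes S: "convex S" and d: "\<And>x. x \<in> S \<Longrightarrow> f differentiable (at x)"
    and B: "\<And>x j. x \<in> S \<Longrightarrow> \<bar>dpart [j] f x\<bar> \<le> B j"
    and ab: "a \<in> S" "b \<in> S"
  shows "\<bar>f a - f b\<bar> \<le> (\<Sum>j\<in>UNIV. B j) * norm (a - b)"
proof -
  let ?h = "b - a"
  have in_S: "a + t *\<^sub>R ?h \<in> S" if "0 \<le> t" "t \<le> 1" for t
  proof -
    have "a + t *\<^sub>R ?h = (1 - t) *\<^sub>R a + t *\<^sub>R b" by (simp add: algebra_simps)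
    then show ?thesis using S ab that by (simp add: convex_def)
  qed
  have "\<exists>z>0. z < 1 \<and> f (a + 1 *\<^sub>R ?h) - f (a + 0 *\<^sub>R ?h) = (1 - 0) * (\<Sum>j\<in>UNIV. ?h $ j * dpart [j] f (a + z *\<^sub>R ?h))"
    by (rule MVT2) (use in_S d in \<open>auto simp del: dpart.simps vector_minus_component intro!: has_real_derivative_line\<close>)
  then obtain z where z: "0 < z" "z < 1" and eq: "f b - f a = (\<Sum>j\<in>UNIV. ?h $ j * dpart [j] f (a + z *\<^sub>R ?h))"
    by auto
  have "\<bar>f b - f a\<bar> \<le> (\<Sum>j\<in>UNIV. norm ?h * B j)"
    unfolding eq
  proof (rule order_trans[OF sum_abs sum_mono])
    fix j
    show "\<bar>?h $ j * dpart [j] f (a + z *\<^sub>R ?h)\<bar> \<le> norm ?h * B j"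
      unfolding abs_mult using z B[OF in_S, of z j] abs_nth_le_norm[of ?h j] by (intro mult_mono) auto
  qed
  then show ?thesis by (simp add: sum_distrib_right norm_minus_commute abs_minus_commute mult.commute)
qed

text \<open>Mean value theorem for f(z + t h) + f(z - t h) as a function of t: its derivative is a
  combination of differences of partial derivatives at two points at distance at most 2|h|, to which
  the Hoelder bound applies.\<close>

lemma second_difference_of_holder_partials:
  fixes f :: "real^'n::finite \<Rightarrow> real"
  assumes S: "convex S" and d: "\<And>x. x \<in> S \<Longrightarrow> f differentiable (at x)" and \<beta>: "\<beta> \<ge> 0"
    and B: "\<And>x y j. x \<in> S \<Longrightarrow> y \<in> S \<Longrightarrow> \<bar>dpart [j] f x - dpart [j] f y\<bar> \<le> B j * dist x y powr \<beta>"
    and z: "z \<in> S" "z + h \<in> S" "z - h \<in> S"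
  shows "\<bar>2 * f z - f (z + h) - f (z - h)\<bar> \<le> (\<Sum>j\<in>UNIV. \<bar>B j\<bar>) * 2 powr \<beta> * norm h powr (1 + \<beta>)"
proof (cases "h = 0")
  case False
  have in1: "z + t *\<^sub>R h \<in> S" if "0 \<le> t" "t \<le> 1" for t
  proof -
    have "z + t *\<^sub>R h = (1 - t) *\<^sub>R z + t *\<^sub>R (z + h)" by (simp add: algebra_simps)
    then show ?thesis using S z that by (simp add: convex_def)
  qed
  have in2: "z + t *\<^sub>R (- h) \<in> S" if "0 \<le> t" "t \<le> 1" for t
  proof -
    have "z + t *\<^sub>R (- h) = (1 - t) *\<^sub>R z + t *\<^sub>R (z - h)" by (simp add: algebra_simps)
    then show ?thesis using S z that by (simp add: convex_def)
  qed
  define D where "D t = (\<Sum>j\<in>UNIV. h $ j * dpart [j] f (z + t *\<^sub>R h)) + (\<Sum>j\<in>UNIV. (- h) $ j * dpart [j] f (z + t *\<^sub>R (- h)))" for t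
  have "\<exists>t>0. t < 1 \<and> (f (z + 1 *\<^sub>R h) + f (z + 1 *\<^sub>R (- h))) - (f (z + 0 *\<^sub>R h) + f (z + 0 *\<^sub>R (- h))) = (1 - 0) * D t"
    unfolding D_def by (rule MVT2) (use in1 in2 d in \<open>auto intro!: DERIV_add has_real_derivative_line simp del: scaleR_minus_right dpart.simps vector_uminus_component\<close>)
  then obtain t where t: "0 < t" "t < 1" and eq: "f (z + h) + f (z - h) - 2 * f z = D t"
    by auto
  have "D t = (\<Sum>j\<in>UNIV. h $ j * (dpart [j] f (z + t *\<^sub>R h) - dpart [j] f (z + t *\<^sub>R (- h))))"
    by (simp add: D_def sum.distrib[symmetric] algebra_simps sum_subtractf)
  also have "\<bar>\<dots>\<bar> \<le> (\<Sum>j\<in>UNIV. norm h * (\<bar>B j\<bar> * (2 * norm h) powr \<beta>))"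
  proof (rule order_trans[OF sum_abs sum_mono])
    fix j
    have "dist (z + t *\<^sub>R h) (z + t *\<^sub>R (- h)) = norm ((2 * t) *\<^sub>R h)"
      by (simp add: dist_norm scaleR_2[symmetric] flip: scaleR_scaleR)
    also have "\<dots> \<le> 2 * norm h" using t by (simp add: mult_left_le_one_le)
    finally have "dist (z + t *\<^sub>R h) (z + t *\<^sub>R (- h)) powr \<beta> \<le> (2 * norm h) powr \<beta>"
      using \<beta> by (intro powr_mono2) auto
    then have "B j * dist (z + t *\<^sub>R h) (z + t *\<^sub>R (- h)) powr \<beta> \<le> \<bar>B j\<bar> * (2 * norm h) powr \<beta>"
      by (intro mult_mono) auto
    with B[OF in1 in2, of t t j] t have "\<bar>dpart [j] f (z + t *\<^sub>R h) - dpart [j] f (z + t *\<^sub>R (- h))\<bar> \<le> \<bar>B j\<bar> * (2 * norm h) powr \<beta>"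
      by simp
    then show "\<bar>h $ j * (dpart [j] f (z + t *\<^sub>R h) - dpart [j] f (z + t *\<^sub>R (- h)))\<bar> \<le> norm h * (\<bar>B j\<bar> * (2 * norm h) powr \<beta>)"
      unfolding abs_mult using abs_nth_le_norm[of h j] by (intro mult_mono) auto
  qed
  also have "\<dots> = (\<Sum>j\<in>UNIV. \<bar>B j\<bar>) * 2 powr \<beta> * norm h powr (1 + \<beta>)"
    using False by (simp add: powr_mult powr_add sum_distrib_left sum_distrib_right mult_ac)
  finally show ?thesis using eq by (simp add: abs_minus_commute algebra_simps)
qed simp

text \<open>Second differences treat all ranges of regularity alike. For integer part 0 or 1 the
  exponent is \<open>2 * s + \<alpha>\<close> itself; from 2 on the gradient is Lipschitz and the
  exponent is 2, which exceeds \<open>2 * s\<close> because s < 1. The convex set \<open>S\<close>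
  keeps the segments of the mean value theorem inside \<open>\<Omega>\<close>.\<close>

lemma C_beta_second_difference:
  fixes u :: "real^'n::finite \<Rightarrow> real"
  assumes s: "0 < s" "s < 1" and \<alpha>: "\<alpha> > 0" "2 * s + \<alpha> \<notin> \<int>" and C: "C_beta (2 * s + \<alpha>) \<Omega> u"
    and S: "S \<subseteq> \<Omega>" "convex S"
  shows "\<exists>L \<gamma>. L \<ge> 0 \<and> \<gamma> > 2 * s \<and>
    (\<forall>z h. z \<in> S \<and> z + h \<in> S \<and> z - h \<in> S \<longrightarrow> \<bar>2 * u z - u (z + h) - u (z - h)\<bar> \<le> L * norm h powr \<gamma>)"
proof -
  define m where "m = nat \<lfloor>2 * s + \<alpha>\<rfloor>"
  define g where "g = 2 * s + \<alpha> - of_int \<lfloor>2 * s + \<alpha>\<rfloor>"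
  have H: "Holder_on m g \<Omega> u" using C by (simp add: C_beta_def m_def g_def)
  have g: "0 \<le> g" "g < 1" unfolding g_def by linarith+
  have fl: "2 * s + \<alpha> = real m + g" using s \<alpha> by (simp add: m_def g_def)
  have holder: "\<exists>L. \<forall>x\<in>\<Omega>. \<forall>y\<in>\<Omega>. \<bar>dpart is u x - dpart is u y\<bar> \<le> L * dist x y powr g" if "length is = m" for "is"
    using H that unfolding Holder_on_def by blast
  have bdd: "bounded (dpart is u ` \<Omega>)" if "length is \<le> m" for "is"
    using H that unfolding Holder_on_def by blast
  have diff: "dpart is u differentiable (at x)" if "length is < m" "x \<in> \<Omega>" for "is" x
    using H that unfolding Holder_on_def Ck_on_def by blast
  consider "m = 0" | "m = 1" | "m \<ge> 2" by linarith
  then show ?thesis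
  proof cases
    case 1
    obtain L where L: "\<And>x y. x \<in> \<Omega> \<Longrightarrow> y \<in> \<Omega> \<Longrightarrow> \<bar>u x - u y\<bar> \<le> L * dist x y powr g"
      using holder[of "[]"] 1 by auto
    show ?thesis
    proof (rule exI[of _ "2 * \<bar>L\<bar>"], rule exI[of _ g], intro conjI allI impI)
      show "g > 2 * s" using fl 1 \<alpha> by simp
      fix z h assume "z \<in> S \<and> z + h \<in> S \<and> z - h \<in> S"
      then have "\<bar>u z - u (z + h)\<bar> \<le> L * norm h powr g" "\<bar>u z - u (z - h)\<bar> \<le> L * norm h powr g"
        using L[of z "z + h"] L[of z "z - h"] S by (auto simp: dist_norm)
      moreover have "L * norm h powr g \<le> \<bar>L\<bar> * norm h powr g" by (intro mult_right_mono) auto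
      ultimately show "\<bar>2 * u z - u (z + h) - u (z - h)\<bar> \<le> 2 * \<bar>L\<bar> * norm h powr g" by linarith
    qed simp
  next
    case 2
    have "\<exists>L. \<forall>x\<in>\<Omega>. \<forall>y\<in>\<Omega>. \<bar>dpart [j] u x - dpart [j] u y\<bar> \<le> L * dist x y powr g" for j
      using holder[of "[j]"] 2 by simp
    then obtain B where B: "\<And>j x y. x \<in> \<Omega> \<Longrightarrow> y \<in> \<Omega> \<Longrightarrow> \<bar>dpart [j] u x - dpart [j] u y\<bar> \<le> B j * dist x y powr g"
      by metis
    show ?thesis
    proof (rule exI[of _ "(\<Sum>j\<in>UNIV. \<bar>B j\<bar>) * 2 powr g"], rule exI[of _ "1 + g"], intro conjI allI impI)
      show "2 * s < 1 + g" using fl 2 \<alpha> by simp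
      fix z h assume z: "z \<in> S \<and> z + h \<in> S \<and> z - h \<in> S"
      show "\<bar>2 * u z - u (z + h) - u (z - h)\<bar> \<le> (\<Sum>j\<in>UNIV. \<bar>B j\<bar>) * 2 powr g * norm h powr (1 + g)"
      proof (rule second_difference_of_holder_partials[OF S(2)])
        fix x assume "x \<in> S" then show "u differentiable (at x)" using diff[of "[]" x] S 2 by auto
      qed (use B S z g in \<open>auto simp del: dpart.simps\<close>)
    qed (simp add: sum_nonneg)
  next
    case 3
    have "\<exists>B. \<forall>x\<in>\<Omega>. \<bar>dpart [i, j] u x\<bar> \<le> B" for i j
      using bdd[of "[i, j]"] 3 by (auto simp: bounded_iff simp del: dpart.simps)
    then obtain B where B: "\<And>i j x. x \<in> \<Omega> \<Longrightarrow> \<bar>dpart [i, j] u x\<bar> \<le> B i j" by metis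
    define B' where "B' j = (\<Sum>i\<in>UNIV. B i j)" for j
    have lip: "\<bar>dpart [j] u x - dpart [j] u y\<bar> \<le> B' j * dist x y powr 1" if "x \<in> S" "y \<in> S" for x y j
    proof -
      have "\<bar>dpart [j] u x - dpart [j] u y\<bar> \<le> (\<Sum>i\<in>UNIV. B i j) * norm (x - y)"
      proof (rule lipschitz_of_bounded_partials[OF S(2) _ _ that])
        show "dpart [j] u differentiable (at x)" if "x \<in> S" for x
          using diff[of "[j]" x] that S 3 by (auto simp del: dpart.simps)
        show "\<bar>dpart [i] (dpart [j] u) x\<bar> \<le> B i j" if "x \<in> S" for x i
          using B[of x i j] that S by auto
      qed
      then show ?thesis by (simp add: B'_def dist_norm)
    qed
    show ?thesis
    proof (rule exI[of _ "(\<Sum>j\<in>UNIV. \<bar>B' j\<bar>) * 2 powr 1"], rule exI[of _ "1 + 1"], intro conjI allI impI)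
      show "2 * s < 1 + 1" using s by simp
      fix z h assume z: "z \<in> S \<and> z + h \<in> S \<and> z - h \<in> S"
      show "\<bar>2 * u z - u (z + h) - u (z - h)\<bar> \<le> (\<Sum>j\<in>UNIV. \<bar>B' j\<bar>) * 2 powr 1 * norm h powr (1 + 1)"
      proof (rule second_difference_of_holder_partials[OF S(2)])
        fix x assume "x \<in> S" then show "u differentiable (at x)" using diff[of "[]" x] S 3 by auto
      qed (use lip z in \<open>auto simp del: dpart.simps\<close>)
    qed (simp add: sum_nonneg)
  qed
qed

lemma C_beta_continuous_on: "C_beta \<beta> \<Omega> u \<Longrightarrow> continuous_on \<Omega> u"
  unfolding C_beta_def Holder_on_def Ck_on_def by (metis dpart.simps(1) le0 list.size(3))

lemma C_beta_bounded: "C_beta \<beta> \<Omega> u \<Longrightarrow> bounded (u ` \<Omega>)"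
  unfolding C_beta_def Holder_on_def by (metis dpart.simps(1) le0 list.size(3))

section \<open>Truncated principal values: uniform convergence and continuity\<close>

lemma halfsp_subset_lebesgue: "halfsp k - ball x r \<in> sets lebesgue" "halfsp k \<inter> (ball x r - ball x \<epsilon>) \<in> sets lebesgue"
  by (intro sets_completionI_sets; simp)+

context
  fixes k :: "'n::finite" and s :: real
  assumes s: "0 < s" "s < 1"
begin

text \<open>Away from the hyperplane the reflected power is bounded, so only the direct power is
  singular. Reflection about \<open>z\<close> turns its contribution into a second difference of
  \<open>u\<close>, integrable because \<open>\<gamma> > 2 * s\<close>. The bound \<open>N\<close>
  does not depend on \<open>z\<close>, so the truncations are uniformly Cauchy near
  \<open>x\<close>.\<close>

lemma trunc_near:
  fixes x :: "real^'n" and u :: "real^'n \<Rightarrow> real"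
  assumes \<rho>: "0 < \<rho>" "\<rho> < 1" "2 * \<rho> < x $ k"
    and uc: "continuous_on (ball x (2 * \<rho>)) u" and ub: "\<And>y. y \<in> ball x (2 * \<rho>) \<Longrightarrow> \<bar>u y\<bar> \<le> B"
    and L: "L \<ge> 0" and \<gamma>: "\<gamma> > 2 * s"
    and sd: "\<And>z h. z \<in> ball x (2 * \<rho>) \<Longrightarrow> z + h \<in> ball x (2 * \<rho>) \<Longrightarrow> z - h \<in> ball x (2 * \<rho>) \<Longrightarrow>
        \<bar>2 * u z - u (z + h) - u (z - h)\<bar> \<le> L * norm h powr \<gamma>"
  shows "\<exists>N. (N \<longlongrightarrow> 0) (at_right (0::real)) \<and> (\<forall>z \<epsilon> \<delta>. z \<in> ball x \<rho> \<and> 0 < \<epsilon> \<and> \<epsilon> < \<delta> \<and> \<delta> < \<rho> \<and>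
      set_integrable lebesgue (halfsp k - ball z \<epsilon>) (pv_integrand k s u z) \<longrightarrow>
      \<bar>(LINT y : halfsp k - ball z \<epsilon> | lebesgue. pv_integrand k s u z y) -
       (LINT y : halfsp k - ball z \<delta> | lebesgue. pv_integrand k s u z y)\<bar> \<le> N \<delta>)"
proof -
  define e where "e = real CARD('n) + 2 * s"
  have e: "e > 0" using s by (simp add: e_def add_pos_pos)
  \<comment> \<open>Bounds the reflected power: for \<open>z\<close> within \<open>\<rho>\<close> of
    \<open>x\<close> and a point of the half space, the reflected distance is at least
    \<open>z $ k\<close>, which exceeds \<open>x $ k - \<rho>\<close>.\<close>
  define \<beta> where "\<beta> = (x $ k - \<rho>) powr - e"
  have B0: "B \<ge> 0" using ub[of x] \<rho> by (auto intro: order_trans[OF abs_ge_zero])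
  obtain C0 where C0: "C0 > 0" and C0r: "\<And>r z::real^'n. r > 0 \<Longrightarrow>
     set_integrable lebesgue (ball z r) (\<lambda>y. norm (z - y) powr (\<gamma> - 2 * s - real CARD('n))) \<and>
     (LINT y : ball z r | lebesgue. norm (z - y) powr (\<gamma> - 2 * s - real CARD('n))) \<le> C0 * r powr (\<gamma> - 2 * s)"
    using ball_radial_integral_at[of "\<gamma> - 2 * s", where 'n='n] \<gamma> by auto
  obtain C1 where C1: "C1 > 0" and C1r: "\<And>r z::real^'n. r > 0 \<Longrightarrow>
     set_integrable lebesgue (ball z r) (\<lambda>y. norm (z - y) powr (real CARD('n) - real CARD('n))) \<and>
     (LINT y : ball z r | lebesgue. norm (z - y) powr (real CARD('n) - real CARD('n))) \<le> C1 * r powr (real CARD('n))"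
    using ball_radial_integral_at[of "real CARD('n)", where 'n='n] by auto
  have one: "set_integrable lebesgue (ball z r) (\<lambda>_. 1::real)" for z :: "real^'n" and r
    unfolding set_integrable_def real_scaleR_def
    by (intro integrable_mult_left) (simp flip: lmeasurable_iff_integrable)
  have vol: "(LINT y : ball z r | lebesgue. (1::real)) \<le> C1 * r powr (real CARD('n))" if "r > 0" for z :: "real^'n" and r
  proof -
    \<comment> \<open>\<open>0 powr 0\<close> is 0, so the power with exponent zero is 1 only off
      the centre and the integrands agree almost everywhere.\<close>
    have "(LINT y : ball z r | lebesgue. (1::real)) = (LINT y : ball z r | lebesgue. norm (z - y) powr (real CARD('n) - real CARD('n)))"
      unfolding set_lebesgue_integral_def
    proof (rule integral_cong_AE)
      have "AE y in lborel. y \<noteq> z" by (rule AE_lborel_singleton)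
      then have "AE y in lebesgue. y \<noteq> z" by (rule AE_completion)
      then show "AE y in lebesgue. indicator (ball z r) y *\<^sub>R (1::real) = indicator (ball z r) y *\<^sub>R norm (z - y) powr (real CARD('n) - real CARD('n))"
        by eventually_elim simp
    qed (use one[of z r] C1r[OF that, of z] in \<open>auto simp: set_integrable_def dest: borel_measurable_integrable\<close>)
    then show ?thesis using C1r[OF that, of z] by simp
  qed
  define N where "N \<delta> = L * (C0 * \<delta> powr (\<gamma> - 2 * s)) + 4 * \<beta> * B * (C1 * \<delta> powr (real CARD('n)))" for \<delta>
  show ?thesis
  proof (intro exI[of _ N] conjI allI impI; (elim conjE)?)
    have "((\<lambda>\<delta>. L * (C0 * \<delta> powr (\<gamma> - 2 * s)) + 4 * \<beta> * B * (C1 * \<delta> powr (real CARD('n)))) \<longlongrightarrow> L * (C0 * 0 powr (\<gamma> - 2 * s)) + 4 * \<beta> * B * (C1 * 0 powr (real CARD('n)))) (at_right 0)"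
      using \<gamma> by (intro tendsto_intros tendsto_powr') (auto intro: eventually_mono[OF eventually_at_right_less])
    then show "(N \<longlongrightarrow> 0) (at_right 0)" by (simp add: N_def[abs_def])
    fix z \<epsilon> \<delta> assume z: "z \<in> ball x \<rho>" and \<epsilon>: "0 < \<epsilon>" "\<epsilon> < \<delta>" and \<delta>: "\<delta> < \<rho>"
      and int: "set_integrable lebesgue (halfsp k - ball z \<epsilon>) (pv_integrand k s u z)"
    define V where "V = ball z \<delta> - ball z \<epsilon>"
    have bz: "ball z \<delta> \<subseteq> ball x (2 * \<rho>)"
    proof
      fix y assume "y \<in> ball z \<delta>"
      then show "y \<in> ball x (2 * \<rho>)" using z \<delta> dist_triangle[of x y z] by simp
    qed
    have zk: "x $ k - \<rho> < z $ k"
      using z abs_nth_le_norm[of "x - z" k] by (simp add: dist_norm)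
    have VH: "ball z \<delta> \<subseteq> halfsp k"
    proof
      fix y assume "y \<in> ball z \<delta>"
      then have "\<bar>(z - y) $ k\<bar> < \<delta>" using abs_nth_le_norm[of "z - y" k] by (simp add: dist_norm)
      then show "y \<in> halfsp k" using zk \<delta> \<rho> by (simp add: halfsp_def)
    qed
    have split: "halfsp k - ball z \<epsilon> = (halfsp k - ball z \<delta>) \<union> V" using VH \<epsilon> by (auto simp: V_def)
    have iV: "set_integrable lebesgue V (pv_integrand k s u z)"
      using int by (rule set_integrable_subset) (auto simp: V_def split)
    have iO: "set_integrable lebesgue (halfsp k - ball z \<delta>) (pv_integrand k s u z)"
      using int by (rule set_integrable_subset) (auto simp: halfsp_subset_lebesgue split)
    have "(LINT y : halfsp k - ball z \<epsilon> | lebesgue. pv_integrand k s u z y) =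
      (LINT y : halfsp k - ball z \<delta> | lebesgue. pv_integrand k s u z y) + (LINT y : V | lebesgue. pv_integrand k s u z y)"
      unfolding split by (rule set_integral_Un) (use iV iO in \<open>auto simp: V_def\<close>)
    moreover have "\<bar>LINT y : V | lebesgue. pv_integrand k s u z y\<bar> \<le> N \<delta>"
    proof -
      define f where "f y = indicator V y * pv_integrand k s u z y" for y
      define F where "F y = (L / 2) * (indicator (ball z \<delta>) y * norm (z - y) powr (\<gamma> - 2 * s - real CARD('n))) + 2 * \<beta> * B * (indicator (ball z \<delta>) y * 1)" for y
      have fi: "integrable lebesgue f" using iV by (simp add: f_def[abs_def] set_integrable_def)
      have Fi: "integrable lebesgue F"
        using C0r[of \<delta> z] one[of z \<delta>] \<epsilon> unfolding F_def[abs_def] set_integrable_def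
        by (intro Bochner_Integration.integrable_add integrable_mult_right) auto
      have le: "\<bar>f y + f (2 *\<^sub>R z - y)\<bar> \<le> 2 * F y" for y
      proof -
        let ?v = "2 *\<^sub>R z - y"
        have nz: "norm (z - ?v) = norm (z - y)"
          using norm_minus_commute[of z y] by (simp add: scaleR_2 algebra_simps)
        have Viff: "?v \<in> V \<longleftrightarrow> y \<in> V" using nz by (simp add: V_def dist_norm)
        show ?thesis
        proof (cases "y \<in> V")
          case False
          then show ?thesis using Viff L B0 by (simp add: f_def F_def \<beta>_def)
        next
          case True
          define a where "a = norm (z - y)"
          define Bf where "Bf v = norm (refl_pt k z - v) powr - e" for v
          have "\<epsilon> \<le> norm (z - y)" using True by (simp add: V_def dist_norm)
          then have a: "a > 0" using \<epsilon> unfolding a_def by linarith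
          have yb: "y \<in> ball z \<delta>" and vb: "?v \<in> ball z \<delta>" using True Viff by (auto simp: V_def)
          have Kf: "frac_kernel k s z v = norm (z - v) powr - e - Bf v" for v
            unfolding frac_kernel_def Bf_def e_def by (simp only: powr_minus divide_inverse mult_1_left)
          have Bfle: "0 \<le> Bf v \<and> Bf v \<le> \<beta>" if "v \<in> ball z \<delta>" for v
          proof -
            have "v $ k > 0" using VH that by (auto simp: halfsp_def)
            then have "x $ k - \<rho> \<le> norm (refl_pt k z - v)" using nth_add_le_refl_diff[of z k v] zk by linarith
            then show ?thesis unfolding Bf_def \<beta>_def using \<rho> e by (auto intro!: powr_mono2')
          qed
          have up: "\<bar>u z - u v\<bar> \<le> 2 * B" if "v \<in> ball z \<delta>" for v
            using ub[of z] ub[of v] bz that \<epsilon> by (auto simp: subset_iff)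
          have eq: "f y + f ?v = a powr - e * (2 * u z - u (z + (y - z)) - u (z - (y - z))) - Bf y * (u z - u y) - Bf ?v * (u z - u ?v)"
          proof -
            have 1: "z + (y - z) = y" "z - (y - z) = ?v" by (simp_all add: scaleR_2)
            show ?thesis unfolding 1 f_def pv_integrand_def Kf nz a_def[symmetric] using True Viff
              by (simp add: algebra_simps)
          qed
          have "\<bar>2 * u z - u (z + (y - z)) - u (z - (y - z))\<bar> \<le> L * norm (y - z) powr \<gamma>"
          proof (rule sd)
            show "z \<in> ball x (2 * \<rho>)" using z \<rho> by simp
            show "z + (y - z) \<in> ball x (2 * \<rho>)" using bz yb by auto
            have "z - (y - z) = ?v" by (simp add: scaleR_2)
            then show "z - (y - z) \<in> ball x (2 * \<rho>)" using bz vb by auto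
          qed
          then have "a powr - e * \<bar>2 * u z - u (z + (y - z)) - u (z - (y - z))\<bar> \<le> a powr - e * (L * a powr \<gamma>)"
            by (intro mult_left_mono) (auto simp: a_def norm_minus_commute)
          also have "\<dots> = L * (a powr - e * a powr \<gamma>)" by simp
          also have "a powr - e * a powr \<gamma> = a powr (- e + \<gamma>)" by (rule powr_add[symmetric])
          also have "- e + \<gamma> = \<gamma> - 2 * s - real CARD('n)" by (simp add: e_def)
          finally have t1: "\<bar>a powr - e * (2 * u z - u (z + (y - z)) - u (z - (y - z)))\<bar> \<le> L * a powr (\<gamma> - 2 * s - real CARD('n))"
            by (simp add: abs_mult)
          have t2: "\<bar>Bf v * (u z - u v)\<bar> \<le> \<beta> * (2 * B)" if "v \<in> ball z \<delta>" for v
            unfolding abs_mult using Bfle[OF that] up[OF that] by (intro mult_mono) auto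
          have "\<bar>f y + f ?v\<bar> \<le> L * a powr (\<gamma> - 2 * s - real CARD('n)) + \<beta> * (2 * B) + \<beta> * (2 * B)"
            unfolding eq using t1 t2[OF yb] t2[OF vb] by linarith
          also have "\<dots> = 2 * F y" using yb by (simp add: F_def a_def)
          finally show ?thesis .
        qed
      qed
      have "\<bar>integral\<^sup>L lebesgue f\<bar> \<le> integral\<^sup>L lebesgue F"
        by (rule abs_integral_le_symmetrised[OF reflect_point_preserves[of z] fi Fi le])
      also have "integral\<^sup>L lebesgue F = (L / 2) * (LINT y : ball z \<delta> | lebesgue. norm (z - y) powr (\<gamma> - 2 * s - real CARD('n))) + 2 * \<beta> * B * (LINT y : ball z \<delta> | lebesgue. 1)"
        using C0r[of \<delta> z] one[of z \<delta>] \<epsilon> unfolding F_def[abs_def] set_integrable_def set_lebesgue_integral_def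
        by (subst Bochner_Integration.integral_add) auto
      also have "\<dots> \<le> (L / 2) * (C0 * \<delta> powr (\<gamma> - 2 * s)) + 2 * \<beta> * B * (C1 * \<delta> powr (real CARD('n)))"
        using C0r[of \<delta> z] vol[of \<delta> z] \<epsilon> L B0 by (intro add_mono mult_left_mono) (auto simp: \<beta>_def)
      also have "\<dots> \<le> N \<delta>"
        unfolding N_def using L B0 C0 C1 by (intro add_mono mult_right_mono) (auto simp: \<beta>_def)
      finally show ?thesis by (simp add: f_def[abs_def] set_lebesgue_integral_def)
    qed
    ultimately show "\<bar>(LINT y : halfsp k - ball z \<epsilon> | lebesgue. pv_integrand k s u z y) -
       (LINT y : halfsp k - ball z \<delta> | lebesgue. pv_integrand k s u z y)\<bar> \<le> N \<delta>" by simp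
  qed
qed

text \<open>With a ball of fixed radius removed, the kernel is dominated uniformly in the centre by
  the weight of the norm, so dominated convergence applies. Pointwise convergence can fail only on
  the sphere around \<open>x\<close>, a null set.\<close>

lemma trunc_continuous:
  fixes x :: "real^'n" and u :: "real^'n \<Rightarrow> real" and z :: "nat \<Rightarrow> real^'n"
  assumes uA: "in_As k s u" and x: "x $ k > 0" and ux: "isCont u x"
    and z: "z \<longlonglongrightarrow> x" and zk: "\<And>j. z j $ k > 0" and \<delta>: "0 < \<delta>" "\<delta> \<le> 1"
    and int: "\<And>j. set_integrable lebesgue (halfsp k - ball (z j) \<delta>) (pv_integrand k s u (z j))"
      "set_integrable lebesgue (halfsp k - ball x \<delta>) (pv_integrand k s u x)"
  shows "(\<lambda>j. LINT y : halfsp k - ball (z j) \<delta> | lebesgue. pv_integrand k s u (z j) y) \<longlonglongrightarrow>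
      (LINT y : halfsp k - ball x \<delta> | lebesgue. pv_integrand k s u x y)"
proof -
  define e where "e = real CARD('n) + 2 * s"
  have e: "e > 0" using s by (simp add: e_def add_pos_pos)
  have uz: "(\<lambda>j. u (z j)) \<longlonglongrightarrow> u x" using isCont_tendsto_compose[OF ux z] .
  obtain B where B: "\<And>j. \<bar>u (z j)\<bar> \<le> B"
    using convergent_imp_Bseq[OF convergentI[OF uz]] by (auto simp: Bseq_def)
  obtain D where D: "\<And>j. norm (z j) \<le> D"
    using convergent_imp_Bseq[OF convergentI[OF z]] by (auto simp: Bseq_def)
  define C where "C = 8 * (real CARD('n) + 2) * (2 + D) powr (e + 2) * \<delta> powr - (e + 2) * D"
  have D0: "D \<ge> 0" using D[of 0] norm_ge_zero order_trans by blast
  have B0: "B \<ge> 0" using B[of 0] by linarith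
  define w where "w y = C * (B * (indicator (halfsp k) y * (y $ k / (1 + norm y powr (e + 2)))) + indicator (halfsp k) y * As_weight s u k y)" for y
  have wi: "integrable lebesgue w"
    using weight_integrable[OF s(1), of k] uA unfolding w_def[abs_def] in_As_def set_integrable_def real_scaleR_def e_def
    by (intro integrable_mult_right Bochner_Integration.integrable_add) auto
  show ?thesis unfolding set_lebesgue_integral_def
  proof (rule integral_dominated_convergence[where w = w])
    have "negligible (sphere x \<delta>)" by (rule negligible_sphere)
    then have "AE y in lebesgue. y \<notin> sphere x \<delta>"
      by (intro AE_not_in) (simp add: negligible_iff_null_sets)
    then show "AE y in lebesgue. (\<lambda>j. indicator (halfsp k - ball (z j) \<delta>) y *\<^sub>R pv_integrand k s u (z j) y)
        \<longlonglongrightarrow> indicator (halfsp k - ball x \<delta>) y *\<^sub>R pv_integrand k s u x y"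
    proof eventually_elim
      case (elim y)
      have dz: "(\<lambda>j. dist (z j) y) \<longlonglongrightarrow> dist x y" by (intro tendsto_intros z)
      consider "y \<notin> halfsp k" | "y \<in> halfsp k" "dist x y < \<delta>" | "y \<in> halfsp k" "dist x y > \<delta>"
        using elim linorder_less_linear[of "dist x y" \<delta>] by auto
      then show ?case
      proof cases
        case 1 then show ?thesis by simp
      next
        case 2
        have "eventually (\<lambda>j. dist (z j) y < \<delta>) sequentially" using order_tendstoD(2)[OF dz 2(2)] .
        then have "eventually (\<lambda>j. indicator (halfsp k - ball (z j) \<delta>) y *\<^sub>R pv_integrand k s u (z j) y = 0) sequentially"
          by eventually_elim simp
        then show ?thesis using 2 by (simp add: tendsto_eventually)
      next
        case 3
        have ev: "eventually (\<lambda>j. dist (z j) y > \<delta>) sequentially" using order_tendstoD(1)[OF dz 3(2)] .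
        have n1: "norm (x - y) \<noteq> 0" using 3 \<delta> by auto
        have "y $ k > 0" using 3 by (simp add: halfsp_def)
        then have "norm (x - refl_pt k y) > 0" using nth_add_le_refl_diff[of x k y] x
          unfolding norm_refl_pt_swap by linarith
        then have n2: "norm (x - refl_pt k y) \<noteq> 0" by simp
        have "(\<lambda>j. pv_integrand k s u (z j) y) \<longlonglongrightarrow> pv_integrand k s u x y"
          unfolding pv_integrand_def frac_kernel_def norm_refl_pt_swap[symmetric]
          by (intro tendsto_intros z uz) (use n1 n2 in auto)
        then have "(\<lambda>j. indicator (halfsp k - ball (z j) \<delta>) y *\<^sub>R pv_integrand k s u (z j) y) \<longlonglongrightarrow> pv_integrand k s u x y"
          by (rule Lim_transform_eventually) (use ev 3 in \<open>auto elim!: eventually_mono\<close>)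
        then show ?thesis using 3 by simp
      qed
    qed
    show "AE y in lebesgue. norm (indicator (halfsp k - ball (z j) \<delta>) y *\<^sub>R pv_integrand k s u (z j) y) \<le> w y" for j
    proof (rule AE_I2)
      fix y
      have w0: "w y \<ge> 0"
      proof (cases "y \<in> halfsp k")
        case True
        then show ?thesis using D0 B0 by (auto simp: w_def C_def As_weight_def halfsp_def intro!: mult_nonneg_nonneg add_nonneg_nonneg)
      qed (simp add: w_def)
      show "norm (indicator (halfsp k - ball (z j) \<delta>) y *\<^sub>R pv_integrand k s u (z j) y) \<le> w y"
      proof (cases "y \<in> halfsp k - ball (z j) \<delta>")
        case False then show ?thesis using w0 by simp
      next
        case True
        then have yk: "y $ k > 0" and r: "\<delta> \<le> norm (z j - y)" by (auto simp: halfsp_def dist_norm)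
        have ne: "z j \<noteq> y" using r \<delta> by auto
        have K0: "0 \<le> frac_kernel k s (z j) y" by (rule frac_kernel_nonneg[OF s zk yk ne])
        have zD: "z j $ k \<le> D" using abs_nth_le_norm[of "z j" k] D[of j] by simp
        have "frac_kernel k s (z j) y \<le> 8 * (real CARD('n) + 2) * (2 + D) powr (e + 2) * \<delta> powr - (e + 2) * (z j) $ k * (y $ k / (1 + norm y powr (e + 2)))"
          unfolding e_def using frac_kernel_upper_weight[OF s zk D yk \<delta> r] by simp
        also have "\<dots> \<le> 8 * (real CARD('n) + 2) * (2 + D) powr (e + 2) * \<delta> powr - (e + 2) * D * (y $ k / (1 + norm y powr (e + 2)))"
          using zD yk by (intro mult_right_mono mult_left_mono) (auto intro!: divide_nonneg_nonneg add_nonneg_nonneg)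
        finally have K: "frac_kernel k s (z j) y \<le> C * (y $ k / (1 + norm y powr (e + 2)))" by (simp add: C_def)
        have C0: "C \<ge> 0" using D0 by (simp add: C_def)
        have g0: "0 \<le> C * (y $ k / (1 + norm y powr (e + 2)))"
          using C0 yk by (intro mult_nonneg_nonneg divide_nonneg_nonneg add_nonneg_nonneg) auto
        have "\<bar>pv_integrand k s u (z j) y\<bar> = frac_kernel k s (z j) y * \<bar>u (z j) - u y\<bar>"
          using K0 by (simp add: pv_integrand_def abs_mult)
        also have "\<dots> \<le> C * (y $ k / (1 + norm y powr (e + 2))) * (B + \<bar>u y\<bar>)"
          using K K0 g0 B[of j] by (intro mult_mono) auto
        also have "\<dots> = w y"
          using True by (simp add: w_def As_weight_def e_def add_divide_distrib algebra_simps)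
        finally show ?thesis using True by simp
      qed
    qed
  qed (use int wi in \<open>auto simp: set_integrable_def dest: borel_measurable_integrable\<close>)
qed

text \<open>The equation holds at every point but \<open>c\<close> is only bounded almost everywhere; continuity of the
  operator carries the bound on \<open>c u\<close> over to every point, in particular to the contact points of the
  barriers.\<close>

lemma pointwise_coefficient_bound:
  fixes u c :: "real^'n \<Rightarrow> real"
  assumes \<Omega>: "open \<Omega>" and \<alpha>: "\<alpha> > 0" "2 * s + \<alpha> \<notin> \<int>" and C: "C_beta (2 * s + \<alpha>) \<Omega> u" and uA: "in_As k s u"
    and nn: "\<And>x. x \<in> halfsp k \<Longrightarrow> u x \<ge> 0"
    and eq: "\<And>x. x \<in> \<Omega> \<inter> halfsp k \<Longrightarrow> frac_lap_at k s u x (- c x * u x)"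
    and M: "AE x in lebesgue. x \<in> \<Omega> \<inter> halfsp k \<longrightarrow> \<bar>c x\<bar> \<le> M"
    and x: "x \<in> \<Omega> \<inter> halfsp k"
  shows "\<bar>c x * u x\<bar> \<le> M * u x"
proof -
  define T where "T z \<epsilon> = (LINT y : halfsp k - ball z \<epsilon> | lebesgue. pv_integrand k s u z y)" for z \<epsilon>
  have ucont: "continuous_on \<Omega> u" using C_beta_continuous_on[OF C] .
  have xk: "x $ k > 0" using x by (simp add: halfsp_def)
  obtain r0 where r0: "r0 > 0" "ball x r0 \<subseteq> \<Omega>" using \<Omega> x by (auto simp: open_contains_ball)
  define \<rho> where "\<rho> = min (1 / 2) (min (r0 / 2) (x $ k / 4))"
  have \<rho>: "0 < \<rho>" "\<rho> < 1" "2 * \<rho> < x $ k" "2 * \<rho> \<le> r0" using r0 xk by (auto simp: \<rho>_def min_def)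
  have b\<Omega>: "ball x (2 * \<rho>) \<subseteq> \<Omega>" using r0 \<rho> by (auto simp: subset_iff)
  have bH: "ball x (2 * \<rho>) \<subseteq> halfsp k"
  proof
    fix y assume "y \<in> ball x (2 * \<rho>)"
    then have "\<bar>(x - y) $ k\<bar> < 2 * \<rho>" using abs_nth_le_norm[of "x - y" k] by (simp add: dist_norm)
    then show "y \<in> halfsp k" using \<rho> by (simp add: halfsp_def)
  qed
  obtain B where B: "\<And>y. y \<in> \<Omega> \<Longrightarrow> \<bar>u y\<bar> \<le> B" using C_beta_bounded[OF C] by (auto simp: bounded_iff)
  obtain L \<gamma> where L: "L \<ge> 0" "\<gamma> > 2 * s" and sd: "\<And>z h. z \<in> ball x (2 * \<rho>) \<Longrightarrow> z + h \<in> ball x (2 * \<rho>) \<Longrightarrow> z - h \<in> ball x (2 * \<rho>) \<Longrightarrow>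
        \<bar>2 * u z - u (z + h) - u (z - h)\<bar> \<le> L * norm h powr \<gamma>"
    using C_beta_second_difference[OF s \<alpha> C b\<Omega> convex_ball] by blast
  have ball_u: "continuous_on (ball x (2 * \<rho>)) u" using ucont b\<Omega> by (rule continuous_on_subset)
  have B': "\<bar>u y\<bar> \<le> B" if "y \<in> ball x (2 * \<rho>)" for y using that b\<Omega> B by auto
  have "\<exists>N. (N \<longlongrightarrow> 0) (at_right (0::real)) \<and> (\<forall>z \<epsilon> \<delta>. z \<in> ball x \<rho> \<and> 0 < \<epsilon> \<and> \<epsilon> < \<delta> \<and> \<delta> < \<rho> \<and>
      set_integrable lebesgue (halfsp k - ball z \<epsilon>) (pv_integrand k s u z) \<longrightarrow> \<bar>T z \<epsilon> - T z \<delta>\<bar> \<le> N \<delta>)"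
    unfolding T_def by (rule trunc_near[OF \<rho>(1-3) ball_u B' L sd])
  then obtain N where N: "(N \<longlongrightarrow> 0) (at_right (0::real))" and near0: "\<forall>z \<epsilon> \<delta>. z \<in> ball x \<rho> \<and> 0 < \<epsilon> \<and> \<epsilon> < \<delta> \<and> \<delta> < \<rho> \<and>
      set_integrable lebesgue (halfsp k - ball z \<epsilon>) (pv_integrand k s u z) \<longrightarrow> \<bar>T z \<epsilon> - T z \<delta>\<bar> \<le> N \<delta>"
    by (elim exE conjE)
  have near: "\<bar>T z \<epsilon> - T z \<delta>\<bar> \<le> N \<delta>" if "z \<in> ball x \<rho>" "0 < \<epsilon>" "\<epsilon> < \<delta>" "\<delta> < \<rho>"
      "set_integrable lebesgue (halfsp k - ball z \<epsilon>) (pv_integrand k s u z)" for z \<epsilon> \<delta>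
    using near0 that by blast
  have "\<forall>z. \<exists>l. z \<in> \<Omega> \<inter> halfsp k \<longrightarrow> (T z \<longlongrightarrow> l) (at_right 0) \<and>
      - c z * u z = c_const CARD('n) s * l + c_const 1 s / s * u z * (z $ k) powr (- 2 * s)"
    using eq unfolding frac_lap_at_def T_def by blast
  then obtain l where l: "\<And>z. z \<in> \<Omega> \<inter> halfsp k \<Longrightarrow> (T z \<longlongrightarrow> l z) (at_right 0)"
    and le: "\<And>z. z \<in> \<Omega> \<inter> halfsp k \<Longrightarrow> - c z * u z = c_const CARD('n) s * l z + c_const 1 s / s * u z * (z $ k) powr (- 2 * s)"
    by metis
  have int: "set_integrable lebesgue (halfsp k - ball z \<epsilon>) (pv_integrand k s u z)" if "z \<in> \<Omega> \<inter> halfsp k" "\<epsilon> > 0" for z \<epsilon>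
    using eq[OF that(1)] that(2) by (simp add: frac_lap_at_def)
  have lT: "\<bar>l z - T z \<delta>\<bar> \<le> N \<delta>" if z: "z \<in> ball x \<rho>" and \<delta>: "0 < \<delta>" "\<delta> < \<rho>" for z \<delta>
  proof -
    have zO: "z \<in> \<Omega> \<inter> halfsp k" using z b\<Omega> bH \<rho> by auto
    have "((\<lambda>\<epsilon>. \<bar>T z \<epsilon> - T z \<delta>\<bar>) \<longlongrightarrow> \<bar>l z - T z \<delta>\<bar>) (at_right 0)" by (intro tendsto_intros l[OF zO])
    then show ?thesis
    proof (rule tendsto_upperbound)
      show "\<forall>\<^sub>F \<epsilon> in at_right 0. \<bar>T z \<epsilon> - T z \<delta>\<bar> \<le> N \<delta>"
        by (rule eventually_at_rightI[of 0 \<delta>]) (use near[OF z _ _ \<delta>(2)] int[OF zO] \<delta> in auto)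
    qed simp
  qed
  \<comment> \<open>The points where \<open>c\<close> violates the bound form a null set, while
    balls have positive measure.\<close>
  have "\<exists>z. z \<in> ball x (\<rho> / real (Suc j)) \<and> \<bar>c z\<bar> \<le> M" for j
  proof (rule ccontr)
    let ?b = "ball x (\<rho> / real (Suc j))"
    assume "\<not> ?thesis"
    then have n: "\<And>z. z \<in> ?b \<Longrightarrow> \<not> \<bar>c z\<bar> \<le> M" by blast
    have "\<rho> / real (Suc j) \<le> \<rho> / 1" using \<rho> by (intro divide_left_mono) auto
    then have sub: "?b \<subseteq> \<Omega> \<inter> halfsp k" using b\<Omega> bH \<rho> by (auto simp: subset_iff)
    have "AE z in lebesgue. z \<notin> ?b" using M by eventually_elim (use n sub in auto)
    then have "emeasure lebesgue ?b = 0"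
      by (subst (asm) AE_iff_measurable[of ?b]) auto
    then have "measure lebesgue ?b = 0" by (simp add: measure_def)
    moreover have "measure lebesgue ?b > 0"
      using content_ball_pos[of "\<rho> / real (Suc j)" x] \<rho> by simp
    ultimately show False by simp
  qed
  then obtain z where z: "\<And>j. z j \<in> ball x (\<rho> / real (Suc j))" and zM: "\<And>j. \<bar>c (z j)\<bar> \<le> M" by metis
  have zlim: "z \<longlonglongrightarrow> x"
  proof (rule metric_tendsto_imp_tendsto)
    show "(\<lambda>j. \<rho> / real (Suc j)) \<longlonglongrightarrow> 0"
      by (intro tendsto_divide_0[OF tendsto_const] filterlim_at_top_imp_at_infinity filterlim_compose[OF filterlim_real_sequentially filterlim_Suc])
    show "\<forall>\<^sub>F j in sequentially. dist (z j) x \<le> dist (\<rho> / real (Suc j)) 0"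
      using z \<rho> by (intro always_eventually) (auto simp: dist_commute less_imp_le)
  qed
  have zb: "z j \<in> ball x \<rho>" for j
  proof -
    have "\<rho> / real (Suc j) \<le> \<rho> / 1" using \<rho> by (intro divide_left_mono) auto
    then show ?thesis using z[of j] by simp
  qed
  have zO: "z j \<in> \<Omega> \<inter> halfsp k" for j using zb[of j] b\<Omega> bH \<rho> by auto
  have ux: "isCont u x" using ucont \<Omega> x by (simp add: continuous_on_eq_continuous_at)
  have uz: "(\<lambda>j. u (z j)) \<longlonglongrightarrow> u x" using isCont_tendsto_compose[OF ux zlim] .
  have zk: "(\<lambda>j. z j $ k) \<longlonglongrightarrow> x $ k" by (intro tendsto_intros zlim)
  \<comment> \<open>Three-term estimate: the principal values differ from their
    \<open>\<delta>\<close>-truncations by at most \<open>N \<delta>\<close>, uniformly in j, and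
    for fixed \<open>\<delta>\<close> the truncations converge.\<close>
  have "(\<lambda>j. l (z j)) \<longlonglongrightarrow> l x"
  proof (rule LIMSEQ_I)
    fix \<eta> :: real assume \<eta>: "\<eta> > 0"
    have "eventually (\<lambda>\<delta>. \<bar>N \<delta>\<bar> < \<eta> / 3) (at_right 0)"
      using tendstoD[OF N, of "\<eta> / 3"] \<eta> by simp
    moreover have "eventually (\<lambda>\<delta>. 0 < \<delta> \<and> \<delta> < \<rho>) (at_right 0)"
      by (rule eventually_at_rightI[of 0 \<rho>]) (use \<rho> in auto)
    ultimately have "eventually (\<lambda>\<delta>. \<bar>N \<delta>\<bar> < \<eta> / 3 \<and> 0 < \<delta> \<and> \<delta> < \<rho>) (at_right 0)" by eventually_elim auto
    then obtain \<delta> where \<delta>: "\<bar>N \<delta>\<bar> < \<eta> / 3" "0 < \<delta>" "\<delta> < \<rho>"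
      using eventually_happens[of _ "at_right (0::real)"] by force
    have "(\<lambda>j. T (z j) \<delta>) \<longlonglongrightarrow> T x \<delta>"
      unfolding T_def
      by (rule trunc_continuous[OF uA xk ux zlim]) (use zO x \<delta> \<rho> int in \<open>auto simp: halfsp_def\<close>)
    then obtain j0 where j0: "\<And>j. j \<ge> j0 \<Longrightarrow> \<bar>T (z j) \<delta> - T x \<delta>\<bar> < \<eta> / 3"
      using LIMSEQ_D[of _ _ "\<eta> / 3"] \<eta> by (metis divide_pos_pos real_norm_def zero_less_numeral)
    show "\<exists>no. \<forall>n\<ge>no. norm (l (z n) - l x) < \<eta>"
    proof (intro exI[of _ j0] allI impI)
      fix j assume "j \<ge> j0"
      then have "\<bar>T (z j) \<delta> - T x \<delta>\<bar> < \<eta> / 3" by (rule j0)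
      moreover have "\<bar>l (z j) - T (z j) \<delta>\<bar> \<le> N \<delta>" by (rule lT[OF zb \<delta>(2,3)])
      moreover have "\<bar>l x - T x \<delta>\<bar> \<le> N \<delta>" by (rule lT) (use \<rho> \<delta> in auto)
      ultimately show "norm (l (z j) - l x) < \<eta>" using \<delta>(1) unfolding real_norm_def by linarith
    qed
  qed
  then have "(\<lambda>j. c_const CARD('n) s * l (z j) + c_const 1 s / s * u (z j) * (z j $ k) powr (- 2 * s)) \<longlonglongrightarrow>
      c_const CARD('n) s * l x + c_const 1 s / s * u x * (x $ k) powr (- 2 * s)"
    using xk by (intro tendsto_intros uz zk) auto
  then have "(\<lambda>j. - c (z j) * u (z j)) \<longlonglongrightarrow> - c x * u x"
    using le[OF zO] le[OF x] by simp
  then have "(\<lambda>j. \<bar>- c (z j) * u (z j)\<bar>) \<longlonglongrightarrow> \<bar>- c x * u x\<bar>" by (rule tendsto_rabs)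
  then have "\<bar>- c x * u x\<bar> \<le> M * u x"
  proof (rule LIMSEQ_le)
    show "(\<lambda>j. M * u (z j)) \<longlonglongrightarrow> M * u x" by (intro tendsto_intros uz)
    have "\<bar>- c (z j) * u (z j)\<bar> \<le> M * u (z j)" for j
      using mult_right_mono[OF zM, of "u (z j)" j] nn[of "z j"] zO[of j] by (simp add: abs_mult)
    then show "\<exists>N. \<forall>n\<ge>N. \<bar>- c (z n) * u (z n)\<bar> \<le> M * u (z n)" by blast
  qed
  then show ?thesis by (simp add: abs_mult)
qed

end

section \<open>Lower bound\<close>

lemma set_integral_minus_ball_limit:
  fixes f :: "'a::euclidean_space \<Rightarrow> real"
  assumes f: "set_integrable lebesgue H f" and H: "H \<in> sets borel"
  shows "((\<lambda>\<epsilon>. LINT y : H - ball x \<epsilon> | lebesgue. f y) \<longlongrightarrow> (LINT y : H | lebesgue. f y)) (at_right 0)"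
proof (rule tendsto_at_right_sequentially[of 0 1])
  fix S :: "nat \<Rightarrow> real" assume S: "\<And>n. 0 < S n" "S \<longlonglongrightarrow> 0"
  have sub: "set_integrable lebesgue (H - ball x (S n)) f" for n
    using f by (rule set_integrable_subset) (use H in \<open>auto intro: sets_completionI_sets\<close>)
  show "(\<lambda>n. LINT y : H - ball x (S n) | lebesgue. f y) \<longlonglongrightarrow> (LINT y : H | lebesgue. f y)"
    unfolding set_lebesgue_integral_def
  proof (rule integral_dominated_convergence[where w = "\<lambda>y. \<bar>indicator H y *\<^sub>R f y\<bar>"])
    have "AE y in lebesgue. y \<noteq> x" by (rule AE_completion[OF AE_lborel_singleton])
    then show "AE y in lebesgue. (\<lambda>n. indicator (H - ball x (S n)) y *\<^sub>R f y) \<longlonglongrightarrow> indicator H y *\<^sub>R f y"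
    proof eventually_elim
      case (elim y)
      then have "dist x y > 0" by simp
      from order_tendstoD(2)[OF S(2) this]
      have "eventually (\<lambda>n. indicator (H - ball x (S n)) y *\<^sub>R f y = indicator H y *\<^sub>R f y) sequentially"
        by eventually_elim (simp add: indicator_def)
      then show ?case by (rule tendsto_eventually)
    qed
  qed (use f sub in \<open>auto simp: set_integrable_def indicator_def dest: borel_measurable_integrable\<close>)
qed simp

lemma antisymmetric_zero: "in_As k s u \<Longrightarrow> x $ k = 0 \<Longrightarrow> u x = 0"
proof -
  assume u: "in_As k s u" and x: "x $ k = 0"
  have "refl_pt k x = x" using x by (simp add: refl_pt_def vec_eq_iff)
  moreover have "u (refl_pt k x) = - u x" using u by (simp add: in_As_def antisymmetric_fun_def)
  ultimately show ?thesis by simp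
qed

lemma closed_qfun_half: "closed {y. y $ k \<ge> 0 \<and> qfun k p y \<le> b}"
  by (intro closed_Collect_conj closed_Collect_le continuous_intros)

text \<open>Gathers what both barrier arguments use. The constants are chosen before
  \<open>\<Omega>\<close>, \<open>u\<close> and \<open>p\<close>, hence depend only on
  \<open>M\<close>, \<open>b\<close>, \<open>D\<close>, n and s. The equation enters only as a bound
  of the operator by \<open>M * u\<close>, so \<open>c\<close> does not appear.\<close>

definition barrier_setting ::
  "'n::finite \<Rightarrow> real \<Rightarrow> real \<Rightarrow> real \<Rightarrow> real \<Rightarrow> (real^'n) set \<Rightarrow> (real^'n \<Rightarrow> real) \<Rightarrow> real^'n \<Rightarrow> bool" where
  "barrier_setting k s M b D \<Omega> u p \<longleftrightarrow>
    p $ k > 0 \<and> (\<forall>y. y $ k \<ge> 0 \<and> qfun k p y \<le> b \<longrightarrow> y \<in> \<Omega> \<and> norm y \<le> D) \<and>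
    continuous_on \<Omega> u \<and> in_As k s u \<and> (\<forall>x\<in>halfsp k. u x \<ge> 0) \<and>
    (\<forall>x\<in>\<Omega> \<inter> halfsp k. \<exists>v. frac_lap_at k s u x v \<and> \<bar>v\<bar> \<le> M * u x)"

context
  fixes k :: "'n::finite" and s :: real
  assumes s: "0 < s" "s < 1"
begin

lemma lower_bound:
  assumes M: "M \<ge> 0" and b: "0 < b" "b \<le> 1" and D: "D \<ge> 1"
  shows "\<exists>C>0. \<forall>\<Omega> (u :: real^'n \<Rightarrow> real) p.
    barrier_setting k s M b D \<Omega> u p \<longrightarrow>
    As_norm k s u * p $ k \<le> C * u p"
proof -
  define e where "e = real CARD('n) + 2 * s"
  define cs where "cs = c_const CARD('n) s"
  define \<kappa> where "\<kappa> = c_const 1 s / s"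
  define c0 where "c0 = 2 / (2 * D) powr (e + 2)"
  define cn where "cn = 4 * (real CARD('n) + 2)"
  have cs: "cs > 0" unfolding cs_def by (rule c_const_pos[OF s])
  have \<kappa>: "\<kappa> > 0" unfolding \<kappa>_def using c_const_pos[OF s] s by simp
  have c0: "c0 > 0" using D by (simp add: c0_def)
  have cn: "cn > 0" by (simp add: cn_def)
  obtain Ck where Ck: "Ck > 0" and Ckb: "\<And>(x::real^'n) p r \<epsilon>. x $ k > 0 \<Longrightarrow> norm x \<le> D \<Longrightarrow> norm p \<le> D \<Longrightarrow> 0 < \<epsilon> \<Longrightarrow> 0 < r \<Longrightarrow> r \<le> 1 \<Longrightarrow>
     set_integrable lebesgue (halfsp k \<inter> (ball x r - ball x \<epsilon>)) (\<lambda>y. frac_kernel k s x y * y $ k * (qfun k p y - qfun k p x)) \<and>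
     \<bar>LINT y : halfsp k \<inter> (ball x r - ball x \<epsilon>) | lebesgue. frac_kernel k s x y * y $ k * (qfun k p y - qfun k p x)\<bar>
       \<le> Ck * x $ k * r powr (2 - 2 * s)"
    using kernel_annulus_qfun[OF s D, of k] by blast
  obtain C4 where C4: "C4 > 0" and C4b: "\<And>x::real^'n. set_integrable lebesgue (- ball x 1) (\<lambda>y. norm (x - y) powr (- (2 * s) - real CARD('n))) \<and>
     (LINT y : - ball x 1 | lebesgue. norm (x - y) powr (- (2 * s) - real CARD('n))) \<le> C4"
    using ball_compl_radial_integral_at[of "2 * s" 1, where 'n='n] s by auto
  define W where "W = (\<integral>y. indicator (cball (0::real^'n) D) y \<partial>lebesgue :: real)"
  have W: "W \<ge> 0" unfolding W_def by (intro integral_nonneg_AE) auto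
  have Wi: "integrable lebesgue (indicator (cball (0::real^'n) D) :: _ \<Rightarrow> real)"
    by (simp flip: lmeasurable_iff_integrable)
  \<comment> \<open>The costs per unit of \<open>\<tau> * x $ k\<close>: the mass of the barrier
    itself, which the lower bound of the kernel also sees, and the variation of
    \<open>\<zeta>\<close> inside and outside the unit ball.\<close>
  define A where "A = c0 * b * D\<^sup>2 * W + Ck + b * cn * C4"
  \<comment> \<open>The 1 is the margin of the contradiction: the estimate ends in
    \<open>Nn \<le> \<tau> * (CC - 1)\<close>, and the right side is
    \<open>Nn - \<tau>\<close>.\<close>
  define CC where "CC = (cs * A + M * b) / (cs * c0) + 1"
  have A: "A \<ge> 0" using c0 b W Ck cn C4 by (simp add: A_def)
  have CC: "CC > 0" unfolding CC_def using A M b cs c0 by (intro add_nonneg_pos divide_nonneg_pos) auto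
  show ?thesis
  proof (intro exI[of _ "CC / b"] conjI allI impI)
    show "CC / b > 0" using CC b by simp
    fix \<Omega> and u :: "real^'n \<Rightarrow> real" and p :: "real^'n"
    assume "barrier_setting k s M b D \<Omega> u p"
    then have pk: "p $ k > 0" and S\<Omega>: "\<forall>y. y $ k \<ge> 0 \<and> qfun k p y \<le> b \<longrightarrow> y \<in> \<Omega> \<and> norm y \<le> D"
      and uc: "continuous_on \<Omega> u" and uA: "in_As k s u" and nn: "\<forall>x\<in>halfsp k. u x \<ge> 0"
      and eq: "\<forall>x\<in>\<Omega> \<inter> halfsp k. \<exists>v. frac_lap_at k s u x v \<and> \<bar>v\<bar> \<le> M * u x"
      by (simp_all add: barrier_setting_def)
    define Nn where "Nn = As_norm k s u"
    define \<tau> where "\<tau> = Nn / CC"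
    define q where "q = qfun k p"
    have Wu: "set_integrable lebesgue (halfsp k) (As_weight s u k)" using uA by (simp add: in_As_def)
    have Nn0: "Nn \<ge> 0" unfolding Nn_def As_norm_def set_lebesgue_integral_def
      by (intro integral_nonneg_AE AE_I2) (auto simp: indicator_def As_weight_nonneg)
    have up0: "u p \<ge> 0" using nn pk by (simp add: halfsp_def)
    have "\<tau> * (p $ k * b) \<le> u p"
    proof (rule ccontr)
      assume "\<not> \<tau> * (p $ k * b) \<le> u p"
      then have neg: "u p < \<tau> * (p $ k * b)" by simp
      \<comment> \<open>This disposes of norm zero, where the claim reduces to
        \<open>0 \<le> u p\<close>.\<close>
      have \<tau>: "\<tau> > 0"
      proof (rule ccontr)
        assume "\<not> \<tau> > 0"
        then have "\<tau> * (p $ k * b) \<le> 0" using pk b by (intro mult_nonpos_nonneg) auto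
        then show False using neg up0 by simp
      qed
      define \<zeta> where "\<zeta> y = max 0 (b - q y)" for y
      define w where "w y = u y - \<tau> * (y $ k * \<zeta> y)" for y
      define S where "S = {y. y $ k \<ge> 0 \<and> q y \<le> b}"
      have Scl: "closed S" unfolding S_def q_def by (rule closed_qfun_half)
      have Sn: "S \<subseteq> \<Omega>" "\<And>y. y \<in> S \<Longrightarrow> norm y \<le> D" using S\<Omega> by (auto simp: S_def q_def)
      have "bounded S" unfolding bounded_iff using Sn by blast
      with Scl have Sc: "compact S" by (simp add: compact_eq_bounded_closed)
      have pS: "p \<in> S" using pk b by (simp add: S_def q_def)
      have qp: "q p = 0" by (simp add: q_def)
      have wc: "continuous_on S w" unfolding w_def \<zeta>_def q_def
        by (intro continuous_intros continuous_on_subset[OF uc Sn(1)])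
      obtain x where xS: "x \<in> S" and xmin: "\<And>y. y \<in> S \<Longrightarrow> w x \<le> w y"
        using continuous_attains_inf[OF Sc _ wc] pS by blast
      have wx: "w x < 0"
      proof -
        have "w x \<le> w p" by (rule xmin[OF pS])
        also have "\<dots> < 0" using neg b by (simp add: w_def \<zeta>_def qp)
        finally show ?thesis .
      qed
      have xk: "x $ k > 0"
      proof (rule ccontr)
        assume "\<not> x $ k > 0"
        then have "x $ k = 0" using xS by (simp add: S_def)
        then have "w x = 0" using antisymmetric_zero[OF uA] by (simp add: w_def)
        then show False using wx by simp
      qed
      have xH: "x \<in> halfsp k" using xk by (simp add: halfsp_def)
      have xD: "norm x \<le> D" and pD: "norm p \<le> D" using Sn(2) xS pS by auto
      have \<zeta>b: "0 \<le> \<zeta> y" "\<zeta> y \<le> b" for y using b qfun_nonneg[of k p y] by (auto simp: \<zeta>_def q_def)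
      have \<zeta>x: "\<zeta> x = b - q x" using xS by (simp add: \<zeta>_def S_def)
      \<comment> \<open>Off \<open>S\<close> the barrier vanishes and \<open>w\<close> equals
        \<open>u\<close>, which is nonnegative, so the negative minimum over \<open>S\<close> is
        global in the half space.\<close>
      have wmin: "w x \<le> w y" if "y \<in> halfsp k" for y
      proof (cases "y \<in> S")
        case False
        then have "\<zeta> y = 0" using that by (auto simp: S_def \<zeta>_def halfsp_def)
        then have "w y \<ge> 0" using nn that by (simp add: w_def)
        then show ?thesis using wx by simp
      qed (rule xmin)
      obtain v where v: "frac_lap_at k s u x v" "\<bar>v\<bar> \<le> M * u x" using eq xS Sn xH by blast
      define T where "T \<epsilon> = (LINT y : halfsp k - ball x \<epsilon> | lebesgue. pv_integrand k s u x y)" for \<epsilon>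
      define I where "I \<epsilon> = (LINT y : halfsp k - ball x \<epsilon> | lebesgue. frac_kernel k s x y * (x $ k - y $ k))" for \<epsilon>
      define N\<epsilon> where "N\<epsilon> \<epsilon> = (LINT y : halfsp k - ball x \<epsilon> | lebesgue. As_weight s u k y)" for \<epsilon>
      obtain L where TL: "(T \<longlongrightarrow> L) (at_right 0)" and vL: "v = cs * L + \<kappa> * u x * (x $ k) powr (- 2 * s)"
        and pvi: "\<And>\<epsilon>. \<epsilon> > 0 \<Longrightarrow> set_integrable lebesgue (halfsp k - ball x \<epsilon>) (pv_integrand k s u x)"
        using v(1) unfolding frac_lap_at_def T_def cs_def \<kappa>_def by blast
      have IL: "(I \<longlongrightarrow> - (\<kappa> / cs * (x $ k) powr (- 2 * s) * x $ k)) (at_right 0)"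
        unfolding I_def \<kappa>_def cs_def by (rule kernel_nth_diff_limit[OF s xk])
      have NL: "(N\<epsilon> \<longlongrightarrow> Nn) (at_right 0)"
        unfolding N\<epsilon>_def Nn_def As_norm_def by (rule set_integral_minus_ball_limit[OF Wu]) simp
      have key: "T \<epsilon> \<le> - (c0 * x $ k) * N\<epsilon> \<epsilon> + \<tau> * (\<zeta> x * I \<epsilon> + x $ k * A)" if \<epsilon>: "0 < \<epsilon>" "\<epsilon> < 1" for \<epsilon>
      proof -
        define H where "H = halfsp k - ball x \<epsilon>"
        define Q where "Q = halfsp k \<inter> (ball x 1 - ball x \<epsilon>)"
        define g0 where "g0 y = indicator H y * pv_integrand k s u x y" for y
        define g1 where "g1 y = indicator H y * As_weight s u k y" for y
        define g2 where "g2 y = indicator (cball (0::real^'n) D) y * (1::real)" for y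
        define g3 where "g3 y = indicator H y * (frac_kernel k s x y * (x $ k - y $ k))" for y
        define g4 where "g4 y = indicator Q y * (frac_kernel k s x y * y $ k * (q y - q x))" for y
        define g5 where "g5 y = indicator (- ball x 1) y * norm (x - y) powr (- (2 * s) - real CARD('n))" for y
        have i0: "integrable lebesgue g0" using pvi[OF \<epsilon>(1)] by (simp add: set_integrable_def g0_def[abs_def] H_def)
        have i1: "integrable lebesgue g1"
        proof -
          have "set_integrable lebesgue H (As_weight s u k)"
            unfolding H_def by (rule set_integrable_subset[OF Wu halfsp_subset_lebesgue(1)]) auto
          then show ?thesis by (simp add: set_integrable_def g1_def[abs_def])
        qed
        have i2: "integrable lebesgue g2" using Wi by (simp add: g2_def[abs_def])
        have i3: "integrable lebesgue g3" using kernel_nth_diff_integrable[OF s xk \<epsilon>(1)]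
          by (simp add: set_integrable_def g3_def[abs_def] H_def)
        have i4: "integrable lebesgue g4" and "\<bar>integral\<^sup>L lebesgue g4\<bar> \<le> Ck * x $ k"
          using Ckb[OF xk xD pD \<epsilon>(1), of 1]
          by (simp_all add: set_integrable_def set_lebesgue_integral_def g4_def[abs_def] Q_def q_def)
        then have b4: "integral\<^sup>L lebesgue g4 \<le> Ck * x $ k" by linarith
        have i5: "integrable lebesgue g5" and b5: "integral\<^sup>L lebesgue g5 \<le> C4"
          using C4b[of x] by (simp_all add: set_integrable_def set_lebesgue_integral_def g5_def[abs_def])
        \<comment> \<open>Majorant for the splitting of \<open>u x - u y\<close> into
          \<open>w x - w y\<close> and \<open>\<tau>\<close> times \<open>\<zeta> x * (x $ k - y $
          k) + y $ k * (\<zeta> x - \<zeta> y)\<close>. The linear part is kept exactly, for its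
          limit; the others are estimated.\<close>
        define G where "G y = - (c0 * x $ k) * g1 y + \<tau> * (c0 * x $ k * b * D\<^sup>2 * g2 y + \<zeta> x * g3 y + g4 y + b * cn * x $ k * g5 y)" for y
        have iG: "integrable lebesgue G" unfolding G_def
          by (intro Bochner_Integration.integrable_add integrable_mult_right i1 i2 i3 i4 i5)
        have pt: "g0 y \<le> G y" for y
        proof (cases "y \<in> H")
          case False
          then have "y \<notin> Q" using \<epsilon> by (auto simp: H_def Q_def)
          then show ?thesis using False \<tau> c0 b cn xk
            by (auto simp: g0_def G_def g1_def g2_def g3_def g4_def g5_def intro!: mult_nonneg_nonneg add_nonneg_nonneg)
        next
          case True
          then have yH: "y \<in> halfsp k" and yk: "y $ k > 0" and a: "\<epsilon> \<le> norm (x - y)" by (auto simp: H_def halfsp_def dist_norm)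
          have xy: "x \<noteq> y" using a \<epsilon> by auto
          define K where "K = frac_kernel k s x y"
          define m where "m = c0 * x $ k * y $ k / (1 + norm y powr (e + 2))"
          have K0: "K \<ge> 0" unfolding K_def by (rule frac_kernel_nonneg[OF s xk yk xy])
          have den: "1 + norm y powr (e + 2) \<ge> 1" by simp
          have m0: "m \<ge> 0" using c0 xk yk den by (simp add: m_def)
          have mK: "m \<le> K" using frac_kernel_lower[OF s xk yk xy D xD] by (simp add: m_def K_def c0_def e_def)
          have w1: "w x - w y \<le> 0" using wmin[OF yH] by simp
          \<comment> \<open>As \<open>w x - w y\<close> is nonpositive, the kernel may be lowered to
            \<open>m\<close>; this is where the whole norm of \<open>u\<close> enters. Then the
            negative \<open>w x\<close> is dropped.\<close>
          have "K * (w x - w y) \<le> m * (w x - w y)" using mK w1 by (rule mult_right_mono_neg)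
          also have "\<dots> \<le> m * (- w y)" using m0 wx by (intro mult_left_mono) auto
          also have "\<dots> = - (m * u y) + \<tau> * (m * (y $ k * \<zeta> y))" by (simp add: w_def algebra_simps)
          also have "m * u y = c0 * x $ k * As_weight s u k y"
            using nn yH by (simp add: m_def As_weight_def e_def)
          also have "\<tau> * (m * (y $ k * \<zeta> y)) \<le> \<tau> * (c0 * x $ k * b * D\<^sup>2 * g2 y)"
          proof (rule mult_left_mono)
            show "m * (y $ k * \<zeta> y) \<le> c0 * x $ k * b * D\<^sup>2 * g2 y"
            proof (cases "y \<in> S")
              case True
              have yD: "norm y \<le> D" using Sn(2)[OF True] .
              then have ykD: "y $ k \<le> D" using abs_nth_le_norm[of y k] by simp
              have "m \<le> c0 * x $ k * y $ k / 1" unfolding m_def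
                using c0 xk yk den by (intro divide_left_mono[OF den]) (auto intro: add_pos_nonneg)
              then have "m \<le> c0 * x $ k * y $ k" by simp
              also have "\<dots> \<le> c0 * x $ k * D" using c0 xk ykD by (intro mult_left_mono) auto
              finally have "m \<le> c0 * x $ k * D" .
              moreover have "y $ k * \<zeta> y \<le> D * b" using ykD yk \<zeta>b b by (intro mult_mono) auto
              ultimately have "m * (y $ k * \<zeta> y) \<le> (c0 * x $ k * D) * (D * b)"
                by (rule mult_mono) (use m0 c0 xk D yk \<zeta>b in auto)
              then show ?thesis using yD by (simp add: g2_def power2_eq_square mult_ac)
            next
              case False
              then have "\<zeta> y = 0" using yk by (auto simp: S_def \<zeta>_def)
              then show ?thesis using c0 xk b by (simp add: g2_def)
            qed
          qed (use \<tau> in simp)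
          finally have 1: "K * (w x - w y) \<le> - (c0 * x $ k * As_weight s u k y) + \<tau> * (c0 * x $ k * b * D\<^sup>2 * g2 y)" by simp
          have 2: "K * y $ k * (\<zeta> x - \<zeta> y) \<le> g4 y + b * cn * x $ k * g5 y"
          proof (cases "y \<in> ball x 1")
            case T: True
            then have "y \<in> Q" using True by (auto simp: Q_def H_def)
            \<comment> \<open>The positive part lies above \<open>b - q\<close> and touches it at
              \<open>x\<close>, so its kink has the good sign and the smooth \<open>q\<close>
              controls the difference.\<close>
            have "b - q y \<le> \<zeta> y" by (simp add: \<zeta>_def)
            then have "\<zeta> x - \<zeta> y \<le> q y - q x" using \<zeta>x by linarith
            then have "K * y $ k * (\<zeta> x - \<zeta> y) \<le> K * y $ k * (q y - q x)"
              using K0 yk by (intro mult_left_mono) auto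
            then show ?thesis using T \<open>y \<in> Q\<close> by (simp add: g4_def g5_def K_def)
          next
            case F: False
            then have "y \<notin> Q" by (simp add: Q_def)
            have "K * y $ k * (\<zeta> x - \<zeta> y) \<le> K * y $ k * b"
              using K0 yk \<zeta>b[of x] \<zeta>b[of y] by (intro mult_left_mono) auto
            also have "\<dots> \<le> (cn * x $ k * norm (x - y) powr (- (2 * s) - real CARD('n))) * b"
              using frac_kernel_nth_le[OF s xk yk xy] b by (intro mult_right_mono) (auto simp: K_def cn_def)
            finally show ?thesis using F \<open>y \<notin> Q\<close> by (simp add: g4_def g5_def mult_ac)
          qed
          have "pv_integrand k s u x y = K * (w x - w y) + \<tau> * (\<zeta> x * (K * (x $ k - y $ k)) + K * y $ k * (\<zeta> x - \<zeta> y))"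
            by (simp add: pv_integrand_def K_def w_def algebra_simps)
          also have "\<dots> \<le> (- (c0 * x $ k * As_weight s u k y) + \<tau> * (c0 * x $ k * b * D\<^sup>2 * g2 y)) +
             \<tau> * (\<zeta> x * (K * (x $ k - y $ k)) + (g4 y + b * cn * x $ k * g5 y))"
            by (rule add_mono[OF 1 mult_left_mono[OF add_left_mono[OF 2]]]) (use \<tau> in simp)
          also have "\<dots> = G y" using True by (simp add: G_def g1_def g3_def K_def algebra_simps)
          finally show ?thesis using True by (simp add: g0_def)
        qed
        have "T \<epsilon> = integral\<^sup>L lebesgue g0" by (simp add: T_def g0_def[abs_def] H_def set_lebesgue_integral_def)
        also have "\<dots> \<le> integral\<^sup>L lebesgue G" by (rule integral_mono[OF i0 iG pt])
        also have "\<dots> = - (c0 * x $ k) * integral\<^sup>L lebesgue g1 + \<tau> * (c0 * x $ k * b * D\<^sup>2 * integral\<^sup>L lebesgue g2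
            + \<zeta> x * integral\<^sup>L lebesgue g3 + integral\<^sup>L lebesgue g4 + b * cn * x $ k * integral\<^sup>L lebesgue g5)"
          unfolding G_def using i1 i2 i3 i4 i5 by simp
        also have "integral\<^sup>L lebesgue g1 = N\<epsilon> \<epsilon>" by (simp add: N\<epsilon>_def g1_def[abs_def] H_def set_lebesgue_integral_def)
        also have "integral\<^sup>L lebesgue g2 = W" by (simp add: W_def g2_def[abs_def])
        also have "integral\<^sup>L lebesgue g3 = I \<epsilon>" by (simp add: I_def g3_def[abs_def] H_def set_lebesgue_integral_def)
        also have "- (c0 * x $ k) * N\<epsilon> \<epsilon> + \<tau> * (c0 * x $ k * b * D\<^sup>2 * W
            + \<zeta> x * I \<epsilon> + integral\<^sup>L lebesgue g4 + b * cn * x $ k * integral\<^sup>L lebesgue g5) \<le>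
          - (c0 * x $ k) * N\<epsilon> \<epsilon> + \<tau> * (c0 * x $ k * b * D\<^sup>2 * W + \<zeta> x * I \<epsilon> + Ck * x $ k + b * cn * x $ k * C4)"
          using b4 b5 \<tau> b cn xk by (intro add_left_mono mult_left_mono add_mono order_refl) auto
        also have "\<dots> = - (c0 * x $ k) * N\<epsilon> \<epsilon> + \<tau> * (\<zeta> x * I \<epsilon> + x $ k * A)"
          by (simp add: A_def algebra_simps)
        finally show ?thesis .
      qed
      have Lle: "L \<le> - (c0 * x $ k) * Nn + \<tau> * (\<zeta> x * - (\<kappa> / cs * (x $ k) powr (- 2 * s) * x $ k) + x $ k * A)"
      proof (rule tendsto_le[OF _ _ TL])
        show "((\<lambda>\<epsilon>. - (c0 * x $ k) * N\<epsilon> \<epsilon> + \<tau> * (\<zeta> x * I \<epsilon> + x $ k * A)) \<longlongrightarrow>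
          - (c0 * x $ k) * Nn + \<tau> * (\<zeta> x * - (\<kappa> / cs * (x $ k) powr (- 2 * s) * x $ k) + x $ k * A)) (at_right 0)"
          by (intro tendsto_intros IL NL)
        show "\<forall>\<^sub>F \<epsilon> in at_right 0. T \<epsilon> \<le> - (c0 * x $ k) * N\<epsilon> \<epsilon> + \<tau> * (\<zeta> x * I \<epsilon> + x $ k * A)"
          by (rule eventually_at_rightI[of 0 1]) (use key in auto)
      qed simp
      define P where "P = (x $ k) powr (- 2 * s)"
      have P0: "P \<ge> 0" by (simp add: P_def)
      have ux: "u x < \<tau> * (x $ k * \<zeta> x)" using wx by (simp add: w_def)
      have "\<kappa> * u x * P \<le> \<kappa> * (\<tau> * (x $ k * \<zeta> x)) * P"
        using ux \<kappa> P0 by (intro mult_right_mono mult_left_mono) auto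
      moreover have "cs * L \<le> cs * (- (c0 * x $ k) * Nn + \<tau> * (\<zeta> x * - (\<kappa> / cs * P * x $ k) + x $ k * A))"
        using Lle cs by (intro mult_left_mono) (auto simp: P_def)
      moreover have "cs * (- (c0 * x $ k) * Nn + \<tau> * (\<zeta> x * - (\<kappa> / cs * P * x $ k) + x $ k * A)) =
        cs * (- (c0 * x $ k) * Nn + \<tau> * (x $ k * A)) - \<kappa> * (\<tau> * (x $ k * \<zeta> x)) * P"
        using cs by (simp add: field_simps)
      ultimately have "v \<le> cs * (- (c0 * x $ k) * Nn + \<tau> * (x $ k * A))"
        using vL unfolding P_def[symmetric] by linarith
      moreover have "- (M * (\<tau> * (x $ k * b))) \<le> v"
      proof -
        have "\<tau> * (x $ k * \<zeta> x) \<le> \<tau> * (x $ k * b)" using \<tau> xk \<zeta>b[of x] by (intro mult_left_mono) auto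
        then have "M * u x \<le> M * (\<tau> * (x $ k * b))" using ux M by (intro mult_left_mono) auto
        then show ?thesis using v(2) by linarith
      qed
      ultimately have "x $ k * (cs * c0 * Nn) \<le> x $ k * (\<tau> * (cs * A + M * b))"
        by (simp add: algebra_simps)
      then have 1: "cs * c0 * Nn \<le> \<tau> * (cs * A + M * b)" using xk by simp
      have "cs * A + M * b = (CC - 1) * (cs * c0)" using cs c0 by (simp add: CC_def)
      then have "cs * c0 * Nn \<le> cs * c0 * (\<tau> * (CC - 1))" using 1 by (simp add: mult_ac)
      then have "Nn \<le> \<tau> * (CC - 1)" using cs c0 by simp
      also have "\<tau> * (CC - 1) = Nn - \<tau>" using CC by (simp add: \<tau>_def field_simps)
      finally show False using \<tau> by simp
    qed
    then show "As_norm k s u * p $ k \<le> CC / b * u p"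
      using CC b by (simp add: \<tau>_def Nn_def field_simps)
  qed
qed

end

section \<open>Upper bound\<close>

text \<open>The linear coefficient must be exact, because that term becomes small only after
  symmetrisation; the quadratic constant is free. The induction multiplies by
  \<open>1 / (1 - t) \<le> 1 + t + 2 * t\<^sup>2\<close>.\<close>

lemma inverse_power_quadratic_bound:
  "\<exists>C\<ge>0. \<forall>t::real. \<bar>t\<bar> \<le> 1 / 2 \<longrightarrow> 1 / (1 - t) ^ N \<le> 1 + real N * t + C * t\<^sup>2"
proof (induction N)
  case 0
  show ?case by (intro exI[of _ 0]) simp
next
  case (Suc N)
  then obtain C where C: "C \<ge> 0" "\<And>t::real. \<bar>t\<bar> \<le> 1 / 2 \<Longrightarrow> 1 / (1 - t) ^ N \<le> 1 + real N * t + C * t\<^sup>2"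
    by blast
  define C' where "C' = 2 + 3 * real N + 4 * C"
  show ?case
  proof (intro exI[of _ C'] conjI allI impI)
    show "C' \<ge> 0" using C by (simp add: C'_def)
    fix t :: real assume t: "\<bar>t\<bar> \<le> 1 / 2"
    then have t1: "1 - t > 0" "1 / 2 \<le> 1 - t" by linarith+
    have q: "1 / (1 - t) \<le> 1 + t + 2 * t\<^sup>2"
    proof -
      have "(1 + t + 2 * t\<^sup>2) * (1 - t) - 1 = t\<^sup>2 * (1 - 2 * t)" by (simp add: power2_eq_square algebra_simps)
      also have "\<dots> \<ge> 0" using t by (intro mult_nonneg_nonneg) auto
      finally show ?thesis using t1 by (simp add: divide_le_eq)
    qed
    have q0: "0 \<le> 1 + t + 2 * t\<^sup>2" using q t1 by (meson divide_nonneg_pos order.trans zero_le_one)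
    have "1 / (1 - t) ^ Suc N = 1 / (1 - t) ^ N * (1 / (1 - t))" by simp
    also have "\<dots> \<le> 1 / (1 - t) ^ N * (1 + t + 2 * t\<^sup>2)" using t1 q by (intro mult_left_mono) auto
    also have "\<dots> \<le> (1 + real N * t + C * t\<^sup>2) * (1 + t + 2 * t\<^sup>2)" using C(2)[OF t] q0 by (intro mult_right_mono)
    also have "\<dots> = 1 + real (Suc N) * t + t\<^sup>2 * (2 + real N + C + t * (2 * real N + C) + 2 * C * t\<^sup>2)"
      by (simp add: power2_eq_square algebra_simps)
    also have "\<dots> \<le> 1 + real (Suc N) * t + t\<^sup>2 * C'"
    proof (intro add_left_mono mult_left_mono)
      have "t * (2 * real N + C) \<le> 1 / 2 * (2 * real N + C)" using t C by (intro mult_right_mono) auto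
      moreover have "t\<^sup>2 \<le> 1\<^sup>2" using t by (intro abs_le_square_iff[THEN iffD1]) auto
      then have "2 * C * t\<^sup>2 \<le> 2 * C * 1" using C by (intro mult_left_mono) auto
      moreover have "2 + n + C + X + Y \<le> 2 + 3 * n + 4 * C"
        if "X \<le> 1 / 2 * (2 * n + C)" "Y \<le> 2 * C * 1" "n \<ge> 0" for X Y n :: real
        using that C(1) by simp
      ultimately show "2 + real N + C + t * (2 * real N + C) + 2 * C * t\<^sup>2 \<le> C'"
        unfolding C'_def by simp
    qed simp
    finally show "1 / (1 - t) ^ Suc N \<le> 1 + real (Suc N) * t + C' * t\<^sup>2" by (simp add: mult.commute)
  qed
qed

section \<open>A comparison ball above the contact point\<close>

lemma ball_volume: "measure lebesgue (ball (c::real^'n::finite) r) = r powr real CARD('n) * measure lebesgue (ball (0::real^'n) 1)" if "r > 0"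
  using content_ball_conv_unit_ball[of r c] that by (simp add: powr_realpow)

lemma norm_axis: "norm (axis i c :: real^'n::finite) = \<bar>c\<bar>"
proof -
  have "(norm (axis i c :: real^'n))\<^sup>2 = \<bar>c\<bar>\<^sup>2"
    unfolding norm_sq_split[of _ i] by (simp add: axis_def)
  then show ?thesis by (rule power2_eq_imp_eq) simp_all
qed

text \<open>The ball is moved in the direction of coordinate \<open>k\<close>, so that
  \<open>y $ k\<close> is at least a multiple of r and of the reflected distance, however close
  \<open>x\<close> is to the hyperplane. The reflected kernel then cannot cancel the gain taken from
  this ball.\<close>

lemma shifted_ball:
  fixes x y :: "real^'n::finite"
  assumes x: "x $ k > 0" and r: "r > 0" and y: "y \<in> ball (x + axis k (2 * r)) (r / 2)"
  shows "x $ k + 3 / 2 * r \<le> y $ k" "r \<le> norm (x - y)" "norm (x - y) \<le> 5 / 2 * r"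
    "norm (refl_pt k x - y) \<le> 2 * (y $ k)"
proof -
  let ?z = "x + axis k (2 * r)"
  have zy: "norm (?z - y) < r / 2" using y by (simp add: dist_norm)
  have zk: "(?z - y) $ k = x $ k + 2 * r - y $ k" by (simp add: axis_def)
  have "\<bar>(?z - y) $ k\<bar> < r / 2" using abs_nth_le_norm[of "?z - y" k] zy by linarith
  then show yk: "x $ k + 3 / 2 * r \<le> y $ k" unfolding zk by linarith
  have nz: "norm (axis k (2 * r) :: real^'n) = 2 * r" using r by (simp add: norm_axis)
  have "x - y = (?z - y) - axis k (2 * r)" by simp
  then have "norm (x - y) \<le> norm (?z - y) + norm (axis k (2 * r) :: real^'n)" by (metis norm_triangle_ineq4)
  then show "norm (x - y) \<le> 5 / 2 * r" using zy nz by simp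
  have "axis k (2 * r) = (?z - y) - (x - y)" by simp
  then have "norm (axis k (2 * r) :: real^'n) \<le> norm (?z - y) + norm (x - y)" by (metis norm_triangle_ineq4)
  then show "r \<le> norm (x - y)" using zy nz r by simp
  have "refl_pt k x - y = (?z - y) - axis k (2 * r + 2 * x $ k)"
    by (simp add: vec_eq_iff refl_pt_def axis_def)
  then have "norm (refl_pt k x - y) \<le> norm (?z - y) + norm (axis k (2 * r + 2 * x $ k) :: real^'n)" by (metis norm_triangle_ineq4)
  also have "norm (axis k (2 * r + 2 * x $ k) :: real^'n) = 2 * r + 2 * x $ k" using r x by (simp add: norm_axis)
  finally show "norm (refl_pt k x - y) \<le> 2 * (y $ k)" using zy yk r by simp
qed

context
  fixes k :: "'n::finite" and s :: real
  assumes s: "0 < s" "s < 1"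
begin

text \<open>The first bound serves the linear part of the barrier and uses that \<open>y $ k\<close>
  is at least half the reflected distance. The second serves the added constant, where no factor
  \<open>y $ k\<close> helps: the reflected power is subtracted, to be repaid by the zero order
  term.\<close>

lemma frac_kernel_shifted_ball:
  fixes x y :: "real^'n"
  assumes x: "x $ k > 0" and r: "r > 0" and y: "y \<in> ball (x + axis k (2 * r)) (r / 2)"
  defines "R \<equiv> (5 / 2 * r) powr - (real CARD('n) + 2 * s)"
  shows "1 / 2 * x $ k * R \<le> frac_kernel k s x y * y $ k"
    "R - norm (refl_pt k x - y) powr - (real CARD('n) + 2 * s) \<le> frac_kernel k s x y"
proof -
  define e where "e = real CARD('n) + 2 * s"
  define a where "a = norm (x - y)"
  define b where "b = norm (refl_pt k x - y)"
  have e: "e > 0" using s by (simp add: e_def add_pos_pos)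
  note sh = shifted_ball[OF x r y]
  have yk: "y $ k > 0" using sh(1) x r by simp
  have a: "a > 0" "a \<le> 5 / 2 * r" using sh(2,3) r unfolding a_def by linarith+
  have xy: "x \<noteq> y" using a(1) unfolding a_def by auto
  have "a \<le> b" using norm_diff_le_refl_diff[of x k y] x yk by (simp add: a_def b_def)
  then have b: "b > 0" "b \<le> 2 * y $ k" using a sh(4) unfolding b_def by linarith+
  have Ra: "R \<le> a powr - e" unfolding R_def e_def[symmetric] using a e by (intro powr_mono2') auto
  have "b\<^sup>2 \<le> (2 * y $ k)\<^sup>2" using b by (intro power_mono) auto
  then have q: "1 / 4 \<le> (y $ k)\<^sup>2 / b\<^sup>2" using b by (simp add: field_simps power2_eq_square)
  have "1 / 2 * x $ k * R \<le> 1 / 2 * x $ k * a powr - e" using x Ra by (intro mult_left_mono) auto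
  also have "\<dots> = (2 * x $ k * a powr - e) * (1 / 4)" by simp
  also have "\<dots> \<le> (2 * x $ k * a powr - e) * ((y $ k)\<^sup>2 / b\<^sup>2)" using x q by (intro mult_left_mono) auto
  also have "\<dots> = 2 * (x $ k * y $ k / (a powr e * b\<^sup>2)) * y $ k"
    by (simp add: powr_minus divide_inverse power2_eq_square)
  also have "\<dots> \<le> frac_kernel k s x y * y $ k"
    using frac_kernel_bounds(1)[OF s x yk xy] yk by (intro mult_right_mono) (auto simp: a_def b_def e_def)
  finally show "1 / 2 * x $ k * R \<le> frac_kernel k s x y * y $ k" .
  have "frac_kernel k s x y = a powr - e - b powr - e"
    unfolding frac_kernel_def a_def b_def e_def by (simp only: powr_minus divide_inverse mult_1_left)
  then show "R - norm (refl_pt k x - y) powr - (real CARD('n) + 2 * s) \<le> frac_kernel k s x y"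
    using Ra by (simp add: b_def e_def)
qed

text \<open>A small \<open>\<theta>\<close> improves both errors relative to the gain: the one near
  \<open>x\<close> by \<open>\<theta>\<^sup>2\<close>, the one from \<open>M\<close> because
  \<open>r powr (- 2 * s)\<close> is at least \<open>\<theta> powr (- 2 * s)\<close>. Its only price
  is a larger constant in front of the norm.\<close>

lemma upper_bound:
  assumes M: "M \<ge> 0" and b: "0 < b" "b \<le> 1" and D: "D \<ge> 1"
  shows "\<exists>C>0. \<forall>\<Omega> (u :: real^'n \<Rightarrow> real) p.
    barrier_setting k s M b D \<Omega> u p \<longrightarrow>
    u p \<le> C * As_norm k s u * p $ k"
proof -
  define e where "e = real CARD('n) + 2 * s"
  define cs where "cs = c_const CARD('n) s"
  define \<kappa> where "\<kappa> = c_const 1 s / s"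
  define cn where "cn = 4 * (real CARD('n) + 2)"
  \<comment> \<open>Chosen so that \<open>r powr - (e + 2)\<close> is \<open>r powr - N\<close>
    times \<open>r powr (- 2 * s)\<close>: the mass of \<open>u\<close> and the gain then scale
    alike in \<open>b - q x\<close>.\<close>
  define N where "N = CARD('n) + 2"
  define \<Lambda> where "\<Lambda> = 8 * (D + 1) + 4 * (D + 1) ^ 3"
  have e: "e > 0" using s by (simp add: e_def add_pos_pos)
  have cs: "cs > 0" unfolding cs_def by (rule c_const_pos[OF s])
  have \<kappa>: "\<kappa> > 0" unfolding \<kappa>_def using c_const_pos[OF s] s by simp
  have cn: "cn > 0" by (simp add: cn_def)
  have \<Lambda>: "\<Lambda> > 0" unfolding \<Lambda>_def using D by (intro add_pos_pos) auto
  obtain Ck where Ck: "Ck > 0" and Ckb: "\<And>(x::real^'n) p r \<epsilon>. x $ k > 0 \<Longrightarrow> norm x \<le> D \<Longrightarrow> norm p \<le> D \<Longrightarrow> 0 < \<epsilon> \<Longrightarrow> 0 < r \<Longrightarrow> r \<le> 1 \<Longrightarrow>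
     set_integrable lebesgue (halfsp k \<inter> (ball x r - ball x \<epsilon>)) (\<lambda>y. frac_kernel k s x y * y $ k * (qfun k p y - qfun k p x)) \<and>
     \<bar>LINT y : halfsp k \<inter> (ball x r - ball x \<epsilon>) | lebesgue. frac_kernel k s x y * y $ k * (qfun k p y - qfun k p x)\<bar>
       \<le> Ck * x $ k * r powr (2 - 2 * s)"
    using kernel_annulus_qfun[OF s D, of k] by blast
  obtain C0 where C0: "C0 > 0" and C0b: "\<And>r x::real^'n. r > 0 \<Longrightarrow>
     set_integrable lebesgue (ball x r) (\<lambda>y. norm (x - y) powr (2 - 2 * s - real CARD('n))) \<and>
     (LINT y : ball x r | lebesgue. norm (x - y) powr (2 - 2 * s - real CARD('n))) \<le> C0 * r powr (2 - 2 * s)"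
    using ball_radial_integral_at[of "2 - 2 * s", where 'n='n] s by auto
  obtain CN where CN: "CN \<ge> 0" and CNb: "\<And>t::real. \<bar>t\<bar> \<le> 1 / 2 \<Longrightarrow> 1 / (1 - t) ^ N \<le> 1 + real N * t + CN * t\<^sup>2"
    using inverse_power_quadratic_bound[of N] by blast
  define w0 where "w0 = measure lebesgue (ball (0::real^'n) 1)"
  have w0: "w0 > 0" unfolding w0_def using content_ball_pos[of 1 "0::real^'n"] by simp
  \<comment> \<open>Volume of the comparison ball of radius \<open>r / 2\<close> times the direct
    power at distance \<open>5 / 2 * r\<close>, with the powers of r split off.\<close>
  define c1 where "c1 = (1 / 2) powr real CARD('n) * w0 * (5 / 2) powr - e"
  have c1: "c1 > 0" using w0 by (simp add: c1_def)
  define Cw where "Cw = 8 * (real CARD('n) + 2) * (2 + D) powr (e + 2)"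
  have Cw: "Cw > 0" using D by (simp add: Cw_def)
  define A2 where "A2 = real N * Ck + CN * \<Lambda>\<^sup>2 * cn * C0"
  have A2: "A2 > 0" using Ck CN cn C0 unfolding A2_def by (intro add_pos_nonneg) (auto simp: N_def)
  \<comment> \<open>In turn: \<open>q\<close> varies over the ball of radius r by at most half of
    \<open>b - q x\<close>; r stays at most 1; the error near \<open>x\<close> takes at most an
    eighth of \<open>c1\<close>; so does the term with \<open>M\<close>.\<close>
  define \<theta> where "\<theta> = min (1 / (2 * \<Lambda>)) (min 1 (min (c1 / (8 * A2)) ((c1 * cs / (8 * (M + 1))) powr (1 / (2 * s)))))"
  have \<theta>: "0 < \<theta>" "\<theta> \<le> 1" "\<theta> \<le> 1 / (2 * \<Lambda>)" "\<theta> \<le> c1 / (8 * A2)" "\<theta> \<le> (c1 * cs / (8 * (M + 1))) powr (1 / (2 * s))"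
    using \<Lambda> c1 A2 cs M by (auto simp: \<theta>_def)
  have \<theta>1: "\<Lambda> * \<theta> \<le> 1 / 2" using \<theta>(3) \<Lambda> by (simp add: field_simps)
  have \<theta>2: "\<theta>\<^sup>2 * A2 \<le> c1 / 8"
  proof -
    have "\<theta>\<^sup>2 * A2 \<le> \<theta> * A2" using \<theta> A2 by (simp add: power2_eq_square mult_left_le)
    also have "\<dots> \<le> c1 / 8" using \<theta>(4) A2 by (simp add: field_simps)
    finally show ?thesis .
  qed
  have \<theta>3: "M / cs \<le> c1 / 8 * \<theta> powr (- 2 * s)"
  proof -
    define X where "X = c1 * cs / (8 * (M + 1))"
    have X: "X > 0" using c1 cs M by (simp add: X_def)
    have "\<theta> powr (2 * s) \<le> (X powr (1 / (2 * s))) powr (2 * s)"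
      using \<theta> s unfolding X_def by (intro powr_mono2) auto
    also have "\<dots> = X powr (1 / (2 * s) * (2 * s))" by (rule powr_powr)
    also have "\<dots> = X" using s X by simp
    finally have "(M + 1) * \<theta> powr (2 * s) \<le> (M + 1) * X" using M by (intro mult_left_mono) auto
    also have "\<dots> = c1 * cs / 8" using M by (simp add: X_def field_simps)
    finally have "(M + 1) * \<theta> powr (2 * s) \<le> c1 * cs / 8" .
    moreover have "M * \<theta> powr (2 * s) \<le> (M + 1) * \<theta> powr (2 * s)" by (intro mult_right_mono) auto
    ultimately have "M * \<theta> powr (2 * s) \<le> c1 * cs / 8" by linarith
    then have "M / cs \<le> c1 / 8 / \<theta> powr (2 * s)" using \<theta> cs by (simp add: field_simps)
    moreover have "\<theta> powr (- 2 * s) = inverse (\<theta> powr (2 * s))"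
      unfolding mult_minus_left by (rule powr_minus)
    ultimately show ?thesis by (simp only: divide_inverse)
  qed
  \<comment> \<open>Read off from the final inequality, in which a quarter of \<open>c1\<close> is
    left against the mass of \<open>u\<close>.\<close>
  define C\<theta> where "C\<theta> = 4 * Cw * \<theta> powr - real N / c1"
  have C\<theta>: "C\<theta> > 0" using Cw \<theta> c1 by (simp add: C\<theta>_def)
  show ?thesis
  proof (intro exI[of _ "C\<theta> / b ^ N"] conjI allI impI)
    show "C\<theta> / b ^ N > 0" using C\<theta> b by simp
    fix \<Omega> and u :: "real^'n \<Rightarrow> real" and p :: "real^'n"
    assume "barrier_setting k s M b D \<Omega> u p"
    then have pk: "p $ k > 0" and S\<Omega>: "\<forall>y. y $ k \<ge> 0 \<and> qfun k p y \<le> b \<longrightarrow> y \<in> \<Omega> \<and> norm y \<le> D"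
      and uc: "continuous_on \<Omega> u" and uA: "in_As k s u" and nn: "\<forall>x\<in>halfsp k. u x \<ge> 0"
      and eq: "\<forall>x\<in>\<Omega> \<inter> halfsp k. \<exists>v. frac_lap_at k s u x v \<and> \<bar>v\<bar> \<le> M * u x"
      by (simp_all add: barrier_setting_def)
    define Nn where "Nn = As_norm k s u"
    define q where "q = qfun k p"
    have Wu: "set_integrable lebesgue (halfsp k) (As_weight s u k)" using uA by (simp add: in_As_def)
    have Nn0: "Nn \<ge> 0" unfolding Nn_def As_norm_def set_lebesgue_integral_def
      by (intro integral_nonneg_AE AE_I2) (auto simp: indicator_def As_weight_nonneg)
    have qp: "q p = 0" by (simp add: q_def)
    \<comment> \<open>The strict inequality keeps \<open>\<tau>\<close> positive even for norm zero;
      the closed statement follows by letting \<open>\<tau>\<close> decrease.\<close>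
    have main: "u p \<le> \<tau> * (p $ k / b ^ N)" if \<tau>: "\<tau> > C\<theta> * Nn" for \<tau>
    proof (rule ccontr)
      assume "\<not> u p \<le> \<tau> * (p $ k / b ^ N)"
      \<comment> \<open>Nothing is known yet about \<open>u y / y $ k\<close> near the hyperplane, so \<open>u\<close> is touched from above by the
        barrier plus a constant \<open>m\<close>; a positive constant on the half space contributes with the good
        sign.\<close>
      define m0 where "m0 = u p - \<tau> * (p $ k / b ^ N)"
      have m0: "m0 > 0" using \<open>\<not> _\<close> by (simp add: m0_def)
      have "C\<theta> * Nn \<ge> 0" using C\<theta> Nn0 by simp
      then have \<tau>0: "\<tau> > 0" using \<tau> by linarith
      define w where "w y = u y - \<tau> * (y $ k / (b - q y) ^ N)" for y
      define S where "S = {y. y $ k \<ge> 0 \<and> q y \<le> b}"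
      have Scl: "closed S" unfolding S_def q_def by (rule closed_qfun_half)
      have Sn: "S \<subseteq> \<Omega>" "\<And>y. y \<in> S \<Longrightarrow> norm y \<le> D" using S\<Omega> by (auto simp: S_def q_def)
      have "bounded S" unfolding bounded_iff using Sn by blast
      with Scl have Sc: "compact S" by (simp add: compact_eq_bounded_closed)
      have ucS: "continuous_on S u" using uc Sn(1) by (rule continuous_on_subset)
      \<comment> \<open>The points where \<open>u\<close> exceeds the barrier by at least
        \<open>m0\<close>, with the denominator multiplied out. This makes the set closed up to
        \<open>q y = b\<close>, where the quotient would be 0 by convention instead of infinite;
        such points drop out by themselves.\<close>
      define E where "E = {y \<in> S. m0 \<le> u y \<and> \<tau> * y $ k \<le> (b - q y) ^ N * (u y - m0)}"
      have "closed E"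
      proof -
        have "closed {y \<in> S. m0 \<le> u y}"
          using continuous_closed_preimage[OF ucS Scl, of "{m0..}"] by (simp add: vimage_def Int_def)
        moreover have "continuous_on S (\<lambda>y. (b - q y) ^ N * (u y - m0) - \<tau> * y $ k)"
          unfolding q_def by (intro continuous_intros ucS)
        from continuous_closed_preimage[OF this Scl, of "{0..}"]
        have "closed {y \<in> S. \<tau> * y $ k \<le> (b - q y) ^ N * (u y - m0)}" by (simp add: vimage_def Int_def)
        moreover have "E = {y \<in> S. m0 \<le> u y} \<inter> {y \<in> S. \<tau> * y $ k \<le> (b - q y) ^ N * (u y - m0)}" by (auto simp: E_def)
        ultimately show ?thesis by (simp only: closed_Int)
      qed
      then have "closed (S \<inter> E)" using Scl by (intro closed_Int)
      moreover have "S \<inter> E = E" by (auto simp: E_def)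
      ultimately have Ec: "compact E" using Sc compact_Int_closed[OF Sc \<open>closed E\<close>] by simp
      have pE: "p \<in> E"
      proof -
        have "\<tau> * (p $ k / b ^ N) \<ge> 0" using \<tau>0 pk b by simp
        moreover have "b ^ N * (u p - m0) = \<tau> * p $ k" using b by (simp add: m0_def)
        ultimately show ?thesis using pk b by (simp add: E_def S_def qp m0_def)
      qed
      have Epos: "y $ k > 0 \<and> q y < b" if "y \<in> E" for y
      proof -
        have yS: "y \<in> S" and um: "m0 \<le> u y" and le: "\<tau> * y $ k \<le> (b - q y) ^ N * (u y - m0)" using that by (auto simp: E_def)
        have "u y \<noteq> 0" using um m0 by simp
        then have yk: "y $ k > 0" using antisymmetric_zero[OF uA, of y] yS by (cases "y $ k = 0") (auto simp: S_def)
        have "q y \<noteq> b"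
        proof
          assume "q y = b"
          then have "\<tau> * y $ k \<le> 0" using le by (simp add: N_def)
          then show False using \<tau>0 yk by (simp add: mult_le_0_iff)
        qed
        then show ?thesis using yk yS by (simp add: S_def)
      qed
      have wc: "continuous_on E w" unfolding w_def q_def
        by (intro continuous_intros continuous_on_subset[OF ucS]) (use Epos in \<open>auto simp: E_def q_def\<close>)
      obtain x where xE: "x \<in> E" and xmax: "\<And>y. y \<in> E \<Longrightarrow> w y \<le> w x"
        using continuous_attains_sup[OF Ec _ wc] pE by blast
      define m where "m = w x"
      have "w p = m0" by (simp add: w_def m0_def qp)
      then have m: "m > 0" using xmax[OF pE] m0 by (simp add: m_def)
      have xk: "x $ k > 0" and qx: "q x < b" using Epos[OF xE] by auto
      have xS: "x \<in> S" using xE by (simp add: E_def)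
      have xH: "x \<in> halfsp k" using xk by (simp add: halfsp_def)
      have pS: "p \<in> S" using pE by (simp add: E_def)
      have xD: "norm x \<le> D" and pD: "norm p \<le> D" using Sn(2) xS pS by auto
      \<comment> \<open>Outside \<open>E\<close> the difference is below \<open>m0\<close>, which is
        at most \<open>m\<close>. So the maximum over \<open>E\<close> is one over all points of the
        half space with \<open>q y < b\<close>.\<close>
      have umax: "u y \<le> \<tau> * (y $ k / (b - q y) ^ N) + m" if y: "y \<in> halfsp k" "q y < b" for y
      proof (cases "y \<in> E")
        case True
        then show ?thesis using xmax[OF True] by (simp add: w_def m_def)
      next
        case False
        have yk: "y $ k > 0" using y by (simp add: halfsp_def)
        have "w y < m0"
        proof (rule ccontr)
          assume "\<not> w y < m0"
          then have le: "\<tau> * (y $ k / (b - q y) ^ N) \<le> u y - m0" by (simp add: w_def)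
          have "0 \<le> \<tau> * (y $ k / (b - q y) ^ N)" using \<tau>0 yk y by simp
          with le have "m0 \<le> u y" by linarith
          moreover have "\<tau> * y $ k = (b - q y) ^ N * (\<tau> * (y $ k / (b - q y) ^ N))" using y by simp
          moreover have "(b - q y) ^ N * (\<tau> * (y $ k / (b - q y) ^ N)) \<le> (b - q y) ^ N * (u y - m0)"
            using y by (intro mult_left_mono[OF le]) simp
          ultimately show False using False yk y by (simp add: E_def S_def)
        qed
        then show ?thesis using xmax[OF pE] \<open>w p = m0\<close> by (simp add: w_def m_def)
      qed

      \<comment> \<open>The operator at the contact point\<close>
      define Dq where "Dq = b - q x"
      have Dq: "0 < Dq" "Dq \<le> 1" using qx b qfun_nonneg[of k p x] by (auto simp: Dq_def q_def)
      define r where "r = \<theta> * Dq"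
      have r: "0 < r" "r \<le> 1" "r \<le> \<theta>" using \<theta> Dq by (auto simp: r_def mult_le_one mult_left_le)
      define g where "g = 1 / Dq ^ N"
      have g: "g > 0" using Dq by (simp add: g_def)
      have ux: "u x = \<tau> * g * x $ k + m" by (simp add: m_def w_def g_def Dq_def)
      obtain v where v: "frac_lap_at k s u x v" "\<bar>v\<bar> \<le> M * u x" using eq xS Sn xH by blast
      define T where "T \<epsilon> = (LINT y : halfsp k - ball x \<epsilon> | lebesgue. pv_integrand k s u x y)" for \<epsilon>
      define I where "I \<epsilon> = (LINT y : halfsp k - ball x \<epsilon> | lebesgue. frac_kernel k s x y * (x $ k - y $ k))" for \<epsilon>
      obtain L where TL: "(T \<longlongrightarrow> L) (at_right 0)" and vL: "v = cs * L + \<kappa> * u x * (x $ k) powr (- 2 * s)"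
        and pvi: "\<And>\<epsilon>. \<epsilon> > 0 \<Longrightarrow> set_integrable lebesgue (halfsp k - ball x \<epsilon>) (pv_integrand k s u x)"
        using v(1) unfolding frac_lap_at_def T_def cs_def \<kappa>_def by blast
      have IL: "(I \<longlongrightarrow> - (\<kappa> / cs * (x $ k) powr (- 2 * s) * x $ k)) (at_right 0)"
        unfolding I_def \<kappa>_def cs_def by (rule kernel_nth_diff_limit[OF s xk])
      define J where "J = (LINT y : halfsp k | lebesgue. norm (refl_pt k x - y) powr - e)"
      have J: "2 * cs * J = \<kappa> * (x $ k) powr (- 2 * s)"
        unfolding J_def cs_def \<kappa>_def e_def by (rule integral_powr_refl(2)[OF s xk])
      define R where "R = (5 / 2 * r) powr - e"
      define V where "V = ball (x + axis k (2 * r)) (r / 2)"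
      define \<rho> where "\<rho> = r powr (- 2 * s)"
      define t2 where "t2 = \<tau> * g * CN * \<Lambda>\<^sup>2 / Dq\<^sup>2 * (cn * x $ k)"
      define t1 where "t1 = \<tau> * g * real N / Dq"
      define t6 where "t6 = Cw * r powr - (e + 2) * x $ k"
      have t0: "t1 \<ge> 0" "t2 \<ge> 0" "t6 \<ge> 0" using \<tau>0 g Dq CN cn xk Cw by (auto simp: t1_def t2_def t6_def)
      define Bd where "Bd = - (t1 * (Ck * x $ k * r powr (2 - 2 * s))) - t2 * (C0 * r powr (2 - 2 * s))
          + (\<tau> * g * (1 / 2 * x $ k) + m) * (c1 * \<rho>) - m * J - t6 * Nn"
      have VR: "R * measure lebesgue V = c1 * \<rho>"
      proof -
        have "measure lebesgue V = (1 / 2 * r) powr real CARD('n) * w0"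
          unfolding V_def w0_def using ball_volume[of "r / 2" "x + axis k (2 * r)"] r by simp
        moreover have "(5 / 2 * r) powr - e = (5 / 2) powr - e * r powr - e"
          by (subst powr_mult) (use r in auto)
        moreover have "(1 / 2 * r) powr real CARD('n) = (1 / 2) powr real CARD('n) * r powr real CARD('n)"
          by (subst powr_mult) (use r in auto)
        ultimately have "R * measure lebesgue V = ((5 / 2) powr - e * r powr - e) * ((1 / 2) powr real CARD('n) * r powr real CARD('n) * w0)"
          by (simp only: R_def)
        also have "\<dots> = c1 * (r powr - e * r powr real CARD('n))" by (simp add: c1_def)
        also have "r powr - e * r powr real CARD('n) = r powr (- e + real CARD('n))" by (rule powr_add[symmetric])
        also have "- e + real CARD('n) = - 2 * s" by (simp add: e_def)
        finally show ?thesis by (simp add: \<rho>_def)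
      qed
      have key: "T \<epsilon> \<ge> \<tau> * g * I \<epsilon> + Bd" if \<epsilon>: "0 < \<epsilon>" "\<epsilon> < r" for \<epsilon>
      proof -
        define H where "H = halfsp k - ball x \<epsilon>"
        define Q where "Q = halfsp k \<inter> (ball x r - ball x \<epsilon>)"
        define g0 where "g0 y = indicator H y * pv_integrand k s u x y" for y
        define g1 where "g1 y = indicator H y * (frac_kernel k s x y * (x $ k - y $ k))" for y
        define g2 where "g2 y = indicator Q y * (frac_kernel k s x y * y $ k * (q y - q x))" for y
        define g3 where "g3 y = indicator (ball x r) y * norm (x - y) powr (2 - 2 * s - real CARD('n))" for y
        define g4 where "g4 y = indicator V y * (1::real)" for y
        define g5 where "g5 y = indicator (halfsp k) y * norm (refl_pt k x - y) powr - e" for y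
        define g6 where "g6 y = indicator (halfsp k) y * As_weight s u k y" for y
        have i0: "integrable lebesgue g0" using pvi[OF \<epsilon>(1)] by (simp add: set_integrable_def g0_def[abs_def] H_def)
        have i1: "integrable lebesgue g1" using kernel_nth_diff_integrable[OF s xk \<epsilon>(1)]
          by (simp add: set_integrable_def g1_def[abs_def] H_def)
        have i2: "integrable lebesgue g2" and "\<bar>integral\<^sup>L lebesgue g2\<bar> \<le> Ck * x $ k * r powr (2 - 2 * s)"
          using Ckb[OF xk xD pD \<epsilon>(1) r(1,2)]
          by (simp_all add: set_integrable_def set_lebesgue_integral_def g2_def[abs_def] Q_def q_def)
        then have b2: "integral\<^sup>L lebesgue g2 \<le> Ck * x $ k * r powr (2 - 2 * s)" by linarith
        have i3: "integrable lebesgue g3" and b3: "integral\<^sup>L lebesgue g3 \<le> C0 * r powr (2 - 2 * s)"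
          using C0b[OF r(1), of x] by (simp_all add: set_integrable_def set_lebesgue_integral_def g3_def[abs_def])
        have i4: "integrable lebesgue g4" unfolding g4_def V_def
          by (intro integrable_mult_left) (simp flip: lmeasurable_iff_integrable)
        have i5: "integrable lebesgue g5" using integral_powr_refl(1)[OF s xk]
          by (simp add: set_integrable_def g5_def[abs_def] e_def)
        have i6: "integrable lebesgue g6" using Wu by (simp add: set_integrable_def g6_def[abs_def])
        \<comment> \<open>Minorant of the integrand. Inside the ball of radius r it is the expanded
          barrier, whose first-order term in \<open>q\<close> is left to cancellation; outside it is
          the gain on \<open>V\<close> alone, minus the reflected power for the constant and minus
          the mass of \<open>u\<close>.\<close>
        define G where "G y = \<tau> * g * g1 y - t1 * g2 y - t2 * g3 y + (\<tau> * g * (1 / 2 * x $ k) + m) * R * g4 y - m * g5 y - t6 * g6 y" for y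
        have iG: "integrable lebesgue G" unfolding G_def
          by (intro Bochner_Integration.integrable_add Bochner_Integration.integrable_diff integrable_mult_right i1 i2 i3 i4 i5 i6)
        have Vsub: "V \<subseteq> halfsp k - ball x r"
        proof
          fix y assume "y \<in> V"
          then have "y \<in> ball (x + axis k (2 * r)) (r / 2)" by (simp add: V_def)
          from shifted_ball[OF xk r(1) this] show "y \<in> halfsp k - ball x r"
            using xk r by (simp add: halfsp_def dist_norm)
        qed
        have pt: "G y \<le> g0 y" for y
        proof (cases "y \<in> H")
          case False
          then have "y \<notin> Q" "y \<notin> V" using \<epsilon> Vsub by (auto simp: H_def Q_def)
          moreover have "0 \<le> g3 y" "0 \<le> g5 y" "0 \<le> g6 y" by (auto simp: g3_def g5_def g6_def indicator_def As_weight_nonneg)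
          then have "0 \<le> t2 * g3 y" "0 \<le> m * g5 y" "0 \<le> t6 * g6 y" using t0 m by auto
          ultimately show ?thesis using False by (simp add: g0_def G_def g1_def g2_def g4_def)
        next
          case True
          then have yH: "y \<in> halfsp k" and yk: "y $ k > 0" and a: "\<epsilon> \<le> norm (x - y)" by (auto simp: H_def halfsp_def dist_norm)
          have xy: "x \<noteq> y" using a \<epsilon> by auto
          define K where "K = frac_kernel k s x y"
          have K0: "K \<ge> 0" unfolding K_def by (rule frac_kernel_nonneg[OF s xk yk xy])
          have h5: "0 \<le> m * g5 y" and h6: "0 \<le> t6 * g6 y" using t0 m by (auto simp: g5_def g6_def indicator_def As_weight_nonneg)
          have pv: "pv_integrand k s u x y = K * (u x - u y)" by (simp add: pv_integrand_def K_def)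
          have "G y \<le> K * (u x - u y)"
          proof (cases "y \<in> ball x r")
            case T: True
            then have yQ: "y \<in> Q" "y \<notin> V" using True Vsub by (auto simp: Q_def H_def)
            have ar: "norm (x - y) < r" using T by (simp add: dist_norm)
            have yD: "norm y \<le> D + 1" using norm_triangle_ineq4[of x "x - y"] ar r xD by simp
            have lip: "\<bar>q y - q x\<bar> \<le> \<Lambda> * norm (x - y)"
              unfolding q_def \<Lambda>_def using xD pD yD by (intro qfun_lipschitz) auto
            also have "\<dots> \<le> \<Lambda> * r" using ar \<Lambda> by (intro mult_left_mono) auto
            also have "\<dots> \<le> 1 / 2 * Dq" using mult_right_mono[OF \<theta>1, of Dq] Dq by (simp add: r_def mult.assoc)
            finally have half: "\<bar>q y - q x\<bar> \<le> 1 / 2 * Dq" .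
            define t where "t = (q y - q x) / Dq"
            have t: "\<bar>t\<bar> \<le> 1 / 2" using half Dq by (simp add: t_def field_simps)
            have qy: "b - q y = Dq * (1 - t)" using Dq by (simp add: t_def Dq_def field_simps)
            have qyb: "q y < b"
            proof -
              have "0 < Dq * (1 - t)" using Dq t by (intro mult_pos_pos) auto
              then show ?thesis using qy by simp
            qed
            have "1 / (b - q y) ^ N = g * (1 / (1 - t) ^ N)" unfolding qy g_def by (simp add: power_mult_distrib)
            also have "\<dots> \<le> g * (1 + real N * t + CN * t\<^sup>2)" using CNb[OF t] g by (intro mult_left_mono) auto
            finally have gy: "1 / (b - q y) ^ N \<le> g * (1 + real N * t + CN * t\<^sup>2)" .
            have "u y \<le> \<tau> * (y $ k * (1 / (b - q y) ^ N)) + m" using umax[OF yH qyb] by simp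
            also have "\<dots> \<le> \<tau> * (y $ k * (g * (1 + real N * t + CN * t\<^sup>2))) + m"
              using gy \<tau>0 yk by (intro add_right_mono mult_left_mono) auto
            finally have "u x - u y \<ge> \<tau> * g * (x $ k - y $ k) - \<tau> * g * y $ k * (real N * t) - \<tau> * g * y $ k * (CN * t\<^sup>2)"
              unfolding ux by (simp add: algebra_simps)
            then have "K * (\<tau> * g * (x $ k - y $ k) - \<tau> * g * y $ k * (real N * t) - \<tau> * g * y $ k * (CN * t\<^sup>2)) \<le> K * (u x - u y)"
              using K0 by (rule mult_left_mono)
            moreover have "K * (\<tau> * g * y $ k * (CN * t\<^sup>2)) \<le> t2 * g3 y"
            proof -
              have "(q y - q x)\<^sup>2 \<le> (\<Lambda> * norm (x - y))\<^sup>2" using lip abs_le_square_iff[of "q y - q x" "\<Lambda> * norm (x - y)"] \<Lambda> by simp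
              then have t2le: "t\<^sup>2 \<le> \<Lambda>\<^sup>2 / Dq\<^sup>2 * (norm (x - y))\<^sup>2"
                using Dq by (simp add: t_def power_divide power_mult_distrib divide_right_mono)
              have "(K * y $ k) * (\<tau> * g * CN * t\<^sup>2) \<le> (cn * x $ k * norm (x - y) powr (- 2 * s - real CARD('n))) * (\<tau> * g * CN * (\<Lambda>\<^sup>2 / Dq\<^sup>2 * (norm (x - y))\<^sup>2))"
              proof (rule mult_mono)
                show "K * y $ k \<le> cn * x $ k * norm (x - y) powr (- 2 * s - real CARD('n))"
                  using frac_kernel_nth_le[OF s xk yk xy] by (simp add: K_def cn_def)
                show "\<tau> * g * CN * t\<^sup>2 \<le> \<tau> * g * CN * (\<Lambda>\<^sup>2 / Dq\<^sup>2 * (norm (x - y))\<^sup>2)"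
                  using t2le \<tau>0 g CN by (intro mult_left_mono) auto
              qed (use \<tau>0 g CN cn xk in auto)
              also have "\<dots> = t2 * (norm (x - y) powr (- 2 * s - real CARD('n)) * (norm (x - y))\<^sup>2)"
                by (simp add: t2_def)
              also have "norm (x - y) powr (- 2 * s - real CARD('n)) * (norm (x - y))\<^sup>2 = norm (x - y) powr (2 - 2 * s - real CARD('n))"
                using xy by (intro powr_minus_mult_sq) simp
              finally show ?thesis using T by (simp add: g3_def mult_ac)
            qed
            moreover have "K * (\<tau> * g * y $ k * (real N * t)) = t1 * g2 y"
              using yQ by (simp add: t1_def t_def g2_def K_def)
            moreover have "K * (\<tau> * g * (x $ k - y $ k)) = \<tau> * g * g1 y" using True by (simp add: g1_def K_def)
            ultimately have "\<tau> * g * g1 y - t1 * g2 y - t2 * g3 y \<le> K * (u x - u y)"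
              unfolding right_diff_distrib by linarith
            moreover have "g4 y = 0" using yQ by (simp add: g4_def)
            ultimately show ?thesis using h5 h6 unfolding G_def by simp
          next
            case F: False
            have z: "g2 y = 0" "g3 y = 0" using F by (auto simp: g2_def g3_def Q_def)
            have ar: "r \<le> norm (x - y)" using F by (simp add: dist_norm)
            \<comment> \<open>Outside the ball the barrier may give no bound, so all of
              \<open>u\<close> there is charged to the norm.\<close>
            have Ku: "K * u y \<le> t6 * g6 y"
            proof -
              have "K \<le> t6 * (y $ k / (1 + norm y powr (e + 2)))"
                using frac_kernel_upper_weight[OF s xk xD yk r(1,2) ar] by (simp add: K_def t6_def Cw_def e_def)
              then have "K * u y \<le> t6 * (y $ k / (1 + norm y powr (e + 2))) * u y"
                using nn yH by (intro mult_right_mono) auto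
              also have "\<dots> = t6 * g6 y" using nn yH by (simp add: g6_def As_weight_def e_def)
              finally show ?thesis .
            qed
            have Kux: "(\<tau> * g * (1 / 2 * x $ k) + m) * R * g4 y - m * g5 y \<le> \<tau> * g * (K * y $ k) + m * K"
            proof (cases "y \<in> V")
              case yV: True
              then have yb: "y \<in> ball (x + axis k (2 * r)) (r / 2)" by (simp add: V_def)
              have "\<tau> * g * (1 / 2 * x $ k * R) \<le> \<tau> * g * (K * y $ k)"
                using frac_kernel_shifted_ball(1)[OF xk r(1) yb] \<tau>0 g by (intro mult_left_mono) (auto simp: R_def K_def e_def)
              moreover have "m * (R - norm (refl_pt k x - y) powr - e) \<le> m * K"
                using frac_kernel_shifted_ball(2)[OF xk r(1) yb] m by (intro mult_left_mono) (auto simp: R_def K_def e_def)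
              ultimately show ?thesis using yV yH by (simp add: g4_def g5_def algebra_simps)
            next
              case False
              then show ?thesis using h5 K0 \<tau>0 g yk m by (auto simp: g4_def intro: order_trans[of _ 0])
            qed
            have "K * (u x - u y) = \<tau> * g * g1 y + (\<tau> * g * (K * y $ k) + m * K) - K * u y"
              unfolding ux using True by (simp add: g1_def K_def algebra_simps)
            then show ?thesis unfolding G_def z using Ku Kux by simp
          qed
          then show ?thesis using True by (simp add: g0_def pv)
        qed
        have "integral\<^sup>L lebesgue G \<le> integral\<^sup>L lebesgue g0" by (rule integral_mono[OF iG i0 pt])
        also have "integral\<^sup>L lebesgue g0 = T \<epsilon>" by (simp add: T_def g0_def[abs_def] H_def set_lebesgue_integral_def)
        finally have TG: "integral\<^sup>L lebesgue G \<le> T \<epsilon>" .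
        have "integral\<^sup>L lebesgue G = \<tau> * g * integral\<^sup>L lebesgue g1 - t1 * integral\<^sup>L lebesgue g2 - t2 * integral\<^sup>L lebesgue g3
          + (\<tau> * g * (1 / 2 * x $ k) + m) * R * integral\<^sup>L lebesgue g4 - m * integral\<^sup>L lebesgue g5 - t6 * integral\<^sup>L lebesgue g6"
          unfolding G_def using i1 i2 i3 i4 i5 i6 by simp
        also have "integral\<^sup>L lebesgue g1 = I \<epsilon>" by (simp add: I_def g1_def[abs_def] H_def set_lebesgue_integral_def)
        also have "integral\<^sup>L lebesgue g4 = measure lebesgue V" by (simp add: g4_def[abs_def])
        also have "integral\<^sup>L lebesgue g5 = J" by (simp add: J_def g5_def[abs_def] set_lebesgue_integral_def)
        also have "integral\<^sup>L lebesgue g6 = Nn" by (simp add: Nn_def As_norm_def g6_def[abs_def] set_lebesgue_integral_def)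
        also have "(\<tau> * g * (1 / 2 * x $ k) + m) * R * measure lebesgue V = (\<tau> * g * (1 / 2 * x $ k) + m) * (c1 * \<rho>)"
          unfolding VR[symmetric] by (rule mult.assoc)
        finally have "integral\<^sup>L lebesgue G = \<tau> * g * I \<epsilon> - t1 * integral\<^sup>L lebesgue g2 - t2 * integral\<^sup>L lebesgue g3
          + (\<tau> * g * (1 / 2 * x $ k) + m) * (c1 * \<rho>) - m * J - t6 * Nn" .
        moreover have "t1 * integral\<^sup>L lebesgue g2 \<le> t1 * (Ck * x $ k * r powr (2 - 2 * s))" using b2 t0(1) by (rule mult_left_mono)
        moreover have "t2 * integral\<^sup>L lebesgue g3 \<le> t2 * (C0 * r powr (2 - 2 * s))" using b3 t0(2) by (rule mult_left_mono)
        ultimately show ?thesis using TG unfolding Bd_def by linarith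
      qed
      have Lge: "\<tau> * g * - (\<kappa> / cs * (x $ k) powr (- 2 * s) * x $ k) + Bd \<le> L"
      proof (rule tendsto_le[OF _ TL])
        show "((\<lambda>\<epsilon>. \<tau> * g * I \<epsilon> + Bd) \<longlongrightarrow> \<tau> * g * - (\<kappa> / cs * (x $ k) powr (- 2 * s) * x $ k) + Bd) (at_right 0)"
          by (intro tendsto_intros IL)
        show "\<forall>\<^sub>F \<epsilon> in at_right 0. \<tau> * g * I \<epsilon> + Bd \<le> T \<epsilon>"
          by (rule eventually_at_rightI[of 0 r]) (use key r in auto)
      qed simp

      \<comment> \<open>Balance of gains and losses\<close>
      define P where "P = (x $ k) powr (- 2 * s)"
      have "cs * (\<tau> * g * - (\<kappa> / cs * P * x $ k) + Bd) \<le> cs * L"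
        using Lge cs by (intro mult_left_mono) (auto simp: P_def)
      moreover have "cs * (\<tau> * g * - (\<kappa> / cs * P * x $ k) + Bd) = cs * Bd - \<tau> * g * x $ k * (\<kappa> * P)"
        using cs by (simp add: field_simps)
      \<comment> \<open>The linear part cancels the limit of \<open>I\<close>. The constant leaves
        \<open>2 * m * J\<close> up to the factor \<open>cs\<close>, twice what the reflected power
        has cost.\<close>
      moreover have "\<kappa> * u x * P = \<tau> * g * x $ k * (\<kappa> * P) + m * (2 * cs * J)"
        unfolding J ux P_def by (simp add: algebra_simps)
      ultimately have "cs * Bd + m * (2 * cs * J) \<le> v" using vL unfolding P_def[symmetric] by linarith
      also have "\<dots> \<le> M * u x" using v(2) by linarith
      finally have "cs * (Bd + 2 * (m * J)) \<le> M * u x" by (simp add: algebra_simps)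
      then have 1: "Bd + 2 * (m * J) \<le> M / cs * u x" using cs by (simp add: field_simps)
      have J0: "m * J \<ge> 0" unfolding J_def set_lebesgue_integral_def using m
        by (intro mult_nonneg_nonneg integral_nonneg_AE) auto
      have \<rho>0: "\<rho> > 0" using r by (simp add: \<rho>_def)
      have \<rho>r: "r powr (2 - 2 * s) = r\<^sup>2 * \<rho>"
      proof -
        have "r powr (2 - 2 * s) = r powr (2 + - 2 * s)" by simp
        also have "\<dots> = r powr 2 * r powr (- 2 * s)" by (rule powr_add)
        finally show ?thesis using r by (simp add: \<rho>_def powr_numeral)
      qed
      have 2: "t1 * (Ck * x $ k * r powr (2 - 2 * s)) + t2 * (C0 * r powr (2 - 2 * s)) \<le> \<tau> * g * x $ k * \<rho> * (c1 / 8)"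
      proof -
        have r2: "r\<^sup>2 = \<theta>\<^sup>2 * Dq\<^sup>2" by (simp add: r_def power_mult_distrib)
        have "t1 * (Ck * x $ k * r powr (2 - 2 * s)) = \<tau> * g * x $ k * \<rho> * (\<theta>\<^sup>2 * (real N * Ck) * Dq)"
          unfolding \<rho>r r2 t1_def using Dq by (simp add: field_simps power2_eq_square)
        also have "\<dots> \<le> \<tau> * g * x $ k * \<rho> * (\<theta>\<^sup>2 * (real N * Ck) * 1)"
          using Dq \<tau>0 g xk \<rho>0 Ck by (intro mult_left_mono) auto
        finally have 3: "t1 * (Ck * x $ k * r powr (2 - 2 * s)) \<le> \<tau> * g * x $ k * \<rho> * (\<theta>\<^sup>2 * (real N * Ck))" by simp
        have 4: "t2 * (C0 * r powr (2 - 2 * s)) = \<tau> * g * x $ k * \<rho> * (\<theta>\<^sup>2 * (CN * \<Lambda>\<^sup>2 * cn * C0))"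
          unfolding \<rho>r r2 t2_def using Dq by (simp add: field_simps)
        have "t1 * (Ck * x $ k * r powr (2 - 2 * s)) + t2 * (C0 * r powr (2 - 2 * s)) \<le> \<tau> * g * x $ k * \<rho> * (\<theta>\<^sup>2 * A2)"
          using add_mono[OF 3 eq_refl[OF 4]] unfolding A2_def distrib_left .
        also have "\<dots> \<le> \<tau> * g * x $ k * \<rho> * (c1 / 8)"
          using \<theta>2 \<tau>0 g xk \<rho>0 by (intro mult_left_mono) auto
        finally show ?thesis .
      qed
      have 5: "M / cs * u x \<le> \<rho> * (c1 / 8) * (\<tau> * g * x $ k + m)"
      proof -
        have "\<theta> powr (- 2 * s) \<le> \<rho>" unfolding \<rho>_def using r s by (intro powr_mono2') auto
        then have "c1 / 8 * \<theta> powr (- 2 * s) \<le> c1 / 8 * \<rho>" using c1 by (intro mult_left_mono) auto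
        then have "M / cs \<le> \<rho> * (c1 / 8)" using \<theta>3 by (simp add: mult.commute)
        then show ?thesis unfolding ux using \<tau>0 g xk m by (intro mult_right_mono) auto
      qed
      have mp: "m * (c1 * \<rho>) > 0" using m c1 \<rho>0 by simp
      have "\<tau> * g * x $ k * \<rho> * (c1 / 4) \<le> t6 * Nn"
      proof -
        \<comment> \<open>Half of \<open>X\<close> is gained, an eighth is lost near
          \<open>x\<close> and an eighth to \<open>M\<close>, so a quarter remains. The terms in
          \<open>m\<close> add up to something nonnegative and are dropped.\<close>
        define X where "X = \<tau> * g * x $ k * \<rho> * c1"
        have e1: "(\<tau> * g * (1 / 2 * x $ k) + m) * (c1 * \<rho>) = X / 2 + m * (c1 * \<rho>)"
          by (simp add: X_def algebra_simps)
        have e2: "\<tau> * g * x $ k * \<rho> * (c1 / 8) = X / 8" "\<tau> * g * x $ k * \<rho> * (c1 / 4) = X / 4" by (simp_all add: X_def)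
        have e3: "\<rho> * (c1 / 8) * (\<tau> * g * x $ k + m) = X / 8 + m * (c1 * \<rho>) / 8" by (simp add: X_def algebra_simps)
        show ?thesis using 1 2 5 J0 mp unfolding Bd_def e1 e2 e3 by linarith
      qed
      then have "x $ k * (\<tau> * g * \<rho> * (c1 / 4)) \<le> x $ k * (Cw * r powr - (e + 2) * Nn)"
        by (simp add: t6_def mult_ac)
      then have "\<tau> * g * \<rho> * (c1 / 4) \<le> Cw * r powr - (e + 2) * Nn" using xk by simp
      also have "r powr - (e + 2) = r powr - real N * \<rho>"
      proof -
        have "- (e + 2) = - real N + - 2 * s" by (simp add: e_def N_def)
        then show ?thesis unfolding \<rho>_def by (simp only: powr_add)
      qed
      also have "r powr - real N = \<theta> powr - real N * g"
      proof -
        have "r powr - real N = \<theta> powr - real N * Dq powr - real N" unfolding r_def using \<theta> Dq by (simp add: powr_mult)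
        also have "Dq powr - real N = g" using Dq by (simp add: g_def powr_minus powr_realpow divide_inverse)
        finally show ?thesis .
      qed
      finally have "(g * \<rho>) * (\<tau> * (c1 / 4)) \<le> (g * \<rho>) * (Cw * \<theta> powr - real N * Nn)" by (simp add: mult_ac)
      then have "\<tau> * (c1 / 4) \<le> Cw * \<theta> powr - real N * Nn" using g \<rho>0 by simp
      then have "\<tau> \<le> C\<theta> * Nn" using c1 by (simp add: C\<theta>_def field_simps)
      then show False using \<tau> by simp
    qed
    have "u p \<le> C\<theta> * Nn * (p $ k / b ^ N)"
    proof (rule field_le_epsilon)
      fix \<eta> :: real assume \<eta>: "\<eta> > 0"
      define h where "h = p $ k / b ^ N"
      have h: "h > 0" using pk b by (simp add: h_def)
      have "C\<theta> * Nn < C\<theta> * Nn + \<eta> / h" using \<eta> h by simp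
      then have "u p \<le> (C\<theta> * Nn + \<eta> / h) * h" unfolding h_def by (rule main)
      also have "\<dots> = C\<theta> * Nn * h + \<eta>" using h by (simp add: field_simps)
      finally show "u p \<le> C\<theta> * Nn * (p $ k / b ^ N) + \<eta>" by (simp add: h_def)
    qed
    then show "u p \<le> C\<theta> / b ^ N * As_norm k s u * p $ k" by (simp add: Nn_def)
  qed
qed

end

section \<open>The Harnack inequality\<close>

text \<open>Over an empty set the infimum would be infinite and exceed the supremum. A point below
  the hyperplane is reflected; a point on it is moved up by openness.\<close>

lemma halfsp_symmetric_nonempty:
  fixes k :: "'n::finite"
  assumes "open S" "S \<noteq> {}" "symmetric_set k S"
  shows "S \<inter> halfsp k \<noteq> {}"
proof -
  obtain x where x: "x \<in> S" using assms by auto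
  obtain r where r: "r > 0" "ball x r \<subseteq> S" using assms x by (auto simp: open_contains_ball)
  consider "x $ k > 0" | "x $ k < 0" | "x $ k = 0" by linarith
  then show ?thesis
  proof cases
    case 1 then show ?thesis using x by (auto simp: halfsp_def)
  next
    case 2
    then have "refl_pt k x \<in> halfsp k" by (simp add: halfsp_def refl_pt_nth)
    moreover have "refl_pt k x \<in> S" using assms x by (simp add: symmetric_set_def)
    ultimately show ?thesis by auto
  next
    case 3
    let ?y = "x + axis k (r / 2)"
    have "?y \<in> ball x r" using r by (simp add: dist_norm norm_axis)
    moreover have "?y \<in> halfsp k" using 3 r by (simp add: halfsp_def axis_def)
    ultimately show ?thesis using r by blast
  qed
qed

text \<open>The 1 avoids showing that the infimum in the norm is attained, and the bound remains a
  function of the norm alone.\<close>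

lemma Linf_norm_AE_bound:
  assumes "in_Linf S c"
  shows "AE x in lebesgue. x \<in> S \<longrightarrow> \<bar>c x\<bar> \<le> max 0 (Linf_norm S c) + 1"
proof -
  define X where "X = {M. M \<ge> 0 \<and> (AE x in lebesgue. x \<in> S \<longrightarrow> \<bar>c x\<bar> \<le> M)}"
  obtain M where M: "AE x in lebesgue. x \<in> S \<longrightarrow> \<bar>c x\<bar> \<le> M" using assms by (auto simp: in_Linf_def)
  have "AE x in lebesgue. x \<in> S \<longrightarrow> \<bar>c x\<bar> \<le> max M 0" using M by eventually_elim auto
  then have "max M 0 \<in> X" by (simp add: X_def)
  then have "X \<noteq> {}" by auto
  moreover have "Inf X < max 0 (Linf_norm S c) + 1" unfolding Linf_norm_def X_def by linarith
  ultimately obtain y where y: "y \<in> X" "y < max 0 (Linf_norm S c) + 1"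
    using cInf_lessD by blast
  then have "AE x in lebesgue. x \<in> S \<longrightarrow> \<bar>c x\<bar> \<le> y" by (simp add: X_def)
  then show ?thesis by eventually_elim (use y in auto)
qed

text \<open>Compactness gives a radius d by which the closure can be enlarged inside
  \<open>\<Omega>\<close>. With \<open>sqrt b = (d / 2)\<^sup>2\<close>, the bound
  \<open>b + sqrt b\<close> of \<open>qfun_ball\<close> stays below \<open>d\<^sup>2\<close>, so one
  b serves every centre.\<close>

lemma compactly_contained_qfun_sublevel:
  assumes cc: "compact (closure S)" "closure S \<subseteq> \<Omega>" "open \<Omega>"
  obtains b where "0 < b" "b \<le> 1" "\<And>p y. p \<in> S \<Longrightarrow> p $ k \<ge> 0 \<Longrightarrow> y $ k \<ge> 0 \<Longrightarrow> qfun k p y \<le> b \<Longrightarrow> y \<in> \<Omega>"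
proof -
  obtain \<delta> where \<delta>: "\<delta> > 0" "(\<Union>x\<in>closure S. ball x \<delta>) \<subseteq> \<Omega>"
    using compact_subset_open_imp_ball_epsilon_subset[OF cc(1,3,2)] by metis
  define d where "d = min \<delta> 1"
  define b where "b = ((d / 2)\<^sup>2)\<^sup>2"
  have d: "0 < d" "d \<le> 1" "d \<le> \<delta>" using \<delta> by (auto simp: d_def)
  have d2: "(d / 2)\<^sup>2 \<le> 1" using d by (simp add: power_le_one)
  have sb: "sqrt b = (d / 2)\<^sup>2" by (simp only: b_def real_sqrt_unique[OF refl] zero_le_power2)
  have ble: "b \<le> (d / 2)\<^sup>2" unfolding b_def power2_eq_square[of "(d / 2)\<^sup>2"] using d2 by (intro mult_left_le) auto
  show ?thesis
  proof (rule that[of b])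
    show "0 < b" using d by (simp add: b_def)
    show "b \<le> 1" using ble d2 by linarith
    fix p y assume p: "p \<in> S" "p $ k \<ge> 0" and y: "y $ k \<ge> 0" "qfun k p y \<le> b"
    have "(norm (y - p))\<^sup>2 \<le> b + sqrt b" by (rule qfun_ball[OF y(1) p(2) y(2)])
    also have "\<dots> \<le> 2 * (d / 2)\<^sup>2" using ble sb by simp
    also have "\<dots> < d\<^sup>2" using d by (simp add: power2_eq_square)
    finally have "norm (y - p) < d" using d by (simp add: power_less_imp_less_base)
    then have "y \<in> ball p \<delta>" using d by (simp add: dist_norm norm_minus_commute)
    then show "y \<in> \<Omega>" using p \<delta> closure_subset by blast
  qed
qed

text \<open>The Harnack inequality is read off by passing through \<open>N\<close>: the upper
  constant times \<open>N\<close> is the product of both constants times the lower bound.\<close>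

lemma SUP_INF_ereal_bounds:
  fixes f :: "'a \<Rightarrow> real"
  assumes A: "A \<noteq> {}" and N: "N \<ge> 0" and C: "C1 > 0" "C2 > 0"
    and lo: "\<And>p. p \<in> A \<Longrightarrow> N / C1 \<le> f p" and up: "\<And>p. p \<in> A \<Longrightarrow> f p \<le> C2 * N"
  shows "ereal (N / C1) \<le> (INF p\<in>A. ereal (f p))" "(SUP p\<in>A. ereal (f p)) \<le> ereal (C2 * N)"
    "(INF p\<in>A. ereal (f p)) \<le> (SUP p\<in>A. ereal (f p))"
    "(SUP p\<in>A. ereal (f p)) \<le> ereal (C1 * C2) * (INF p\<in>A. ereal (f p))"
proof -
  show 1: "ereal (N / C1) \<le> (INF p\<in>A. ereal (f p))" by (rule INF_greatest) (simp add: lo)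
  show 2: "(SUP p\<in>A. ereal (f p)) \<le> ereal (C2 * N)" by (rule SUP_least) (simp add: up)
  show "(INF p\<in>A. ereal (f p)) \<le> (SUP p\<in>A. ereal (f p))" using A by (rule INF_le_SUP)
  note 2
  also have "ereal (C2 * N) = ereal (C1 * C2) * ereal (N / C1)" using C by simp
  also have "\<dots> \<le> ereal (C1 * C2) * (INF p\<in>A. ereal (f p))"
    using C by (intro ereal_mult_left_mono 1) simp
  finally show "(SUP p\<in>A. ereal (f p)) \<le> ereal (C1 * C2) * (INF p\<in>A. ereal (f p))" .
qed

text \<open>The constant is a function of the norm of \<open>c\<close>, chosen before
  \<open>c\<close>, \<open>u\<close> and \<open>\<alpha>\<close>, which encodes the claimed
  dependence. Supremum and infimum are taken in \<open>ereal\<close>, so finiteness of the supremum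
  is part of the conclusion.\<close>

theorem theorem1p1:
  fixes k :: "'n::finite" and s :: real and \<Omega> \<Omega>' :: "(real^'n) set"
  assumes s: "0 < s" "s < 1"
    and dom: "domain \<Omega>" "bounded \<Omega>" "symmetric_set k \<Omega>"
    and dom': "domain \<Omega>'" "bounded \<Omega>'" "symmetric_set k \<Omega>'"
    and cc: "closure \<Omega>' \<subseteq> \<Omega>"
  shows
   "(\<exists>C :: real \<Rightarrow> real. (\<forall>t. C t > 0) \<and>
      (\<forall>(c :: real^'n \<Rightarrow> real) (u :: real^'n \<Rightarrow> real) (\<alpha> :: real).
         in_Linf (\<Omega> \<inter> halfsp k) c \<and> \<alpha> > 0 \<and> 2 * s + \<alpha> \<notin> \<int> \<and>
         C_beta (2 * s + \<alpha>) \<Omega> u \<and> in_As k s u \<and> (\<forall>x\<in>halfsp k. u x \<ge> 0) \<and>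
         (\<forall>x\<in>\<Omega> \<inter> halfsp k. frac_lap_at k s u x (- c x * u x))
       \<longrightarrow> (SUP x\<in>\<Omega>' \<inter> halfsp k. ereal (u x / x $ k))
             \<le> ereal (C (Linf_norm (\<Omega> \<inter> halfsp k) c)) * (INF x\<in>\<Omega>' \<inter> halfsp k. ereal (u x / x $ k))))
  \<and> (\<exists>C :: real \<Rightarrow> real. (\<forall>t. C t > 1) \<and>
      (\<forall>(c :: real^'n \<Rightarrow> real) (u :: real^'n \<Rightarrow> real) (\<alpha> :: real).
         in_Linf (\<Omega> \<inter> halfsp k) c \<and> \<alpha> > 0 \<and> 2 * s + \<alpha> \<notin> \<int> \<and>
         C_beta (2 * s + \<alpha>) \<Omega> u \<and> in_As k s u \<and> (\<forall>x\<in>halfsp k. u x \<ge> 0) \<and>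
         (\<forall>x\<in>\<Omega> \<inter> halfsp k. frac_lap_at k s u x (- c x * u x))
       \<longrightarrow> ereal (As_norm k s u / C (Linf_norm (\<Omega> \<inter> halfsp k) c))
               \<le> (INF x\<in>\<Omega>' \<inter> halfsp k. ereal (u x / x $ k))
         \<and> (INF x\<in>\<Omega>' \<inter> halfsp k. ereal (u x / x $ k))
               \<le> (SUP x\<in>\<Omega>' \<inter> halfsp k. ereal (u x / x $ k))
         \<and> (SUP x\<in>\<Omega>' \<inter> halfsp k. ereal (u x / x $ k))
               \<le> ereal (C (Linf_norm (\<Omega> \<inter> halfsp k) c) * As_norm k s u)))"
proof -
  have \<Omega>: "open \<Omega>" using dom(1) by (simp add: domain_def)
  define A where "A = \<Omega>' \<inter> halfsp k"
  have A: "A \<noteq> {}" unfolding A_def using dom' by (intro halfsp_symmetric_nonempty) (auto simp: domain_def)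
  have "compact (closure \<Omega>')" using dom'(2) by (simp add: compact_closure)
  then obtain b where b: "0 < b" "b \<le> 1"
    and b\<Omega>: "\<And>p y. p \<in> \<Omega>' \<Longrightarrow> p $ k \<ge> 0 \<Longrightarrow> y $ k \<ge> 0 \<Longrightarrow> qfun k p y \<le> b \<Longrightarrow> y \<in> \<Omega>"
    using compactly_contained_qfun_sublevel[OF _ cc \<Omega>] by metis
  obtain D0 where D0: "\<And>y. y \<in> \<Omega> \<Longrightarrow> norm y \<le> D0" using dom(2) by (auto simp: bounded_iff)
  define D where "D = max 1 D0"
  have D: "D \<ge> 1" "\<And>y. y \<in> \<Omega> \<Longrightarrow> norm y \<le> D" using D0 by (auto simp: D_def max.coboundedI2)
  \<comment> \<open>The bound of \<open>Linf_norm_AE_bound\<close> as a function of the norm; the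
    coefficient affects the constants through it alone.\<close>
  define M where "M t = max 0 t + 1" for t :: real
  have M: "M t \<ge> 0" for t by (simp add: M_def)
  have "\<exists>C>0. \<forall>u p. barrier_setting k s (M t) b D \<Omega> u p \<longrightarrow> As_norm k s u * p $ k \<le> C * u p" for t
    using lower_bound[OF s M[of t] b D(1), of k] by meson
  then obtain C1 where C1: "\<And>t. C1 t > 0" "\<And>t u p. barrier_setting k s (M t) b D \<Omega> u p \<Longrightarrow> As_norm k s u * p $ k \<le> C1 t * u p"
    by metis
  have "\<exists>C>0. \<forall>u p. barrier_setting k s (M t) b D \<Omega> u p \<longrightarrow> u p \<le> C * As_norm k s u * p $ k" for t
    using upper_bound[OF s M[of t] b D(1), of k] by meson
  then obtain C2 where C2: "\<And>t. C2 t > 0" "\<And>t u p. barrier_setting k s (M t) b D \<Omega> u p \<Longrightarrow> u p \<le> C2 t * As_norm k s u * p $ k"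
    by metis
  have bounds: "As_norm k s u \<ge> 0 \<and> (\<forall>p\<in>A. As_norm k s u / C1 t \<le> u p / p $ k \<and> u p / p $ k \<le> C2 t * As_norm k s u)"
    if h: "in_Linf (\<Omega> \<inter> halfsp k) c \<and> \<alpha> > 0 \<and> 2 * s + \<alpha> \<notin> \<int> \<and>
         C_beta (2 * s + \<alpha>) \<Omega> u \<and> in_As k s u \<and> (\<forall>x\<in>halfsp k. u x \<ge> 0) \<and>
         (\<forall>x\<in>\<Omega> \<inter> halfsp k. frac_lap_at k s u x (- c x * u x))"
      and t: "t = Linf_norm (\<Omega> \<inter> halfsp k) c" for c u :: "real^'n \<Rightarrow> real" and \<alpha> t :: real
  proof
    show "As_norm k s u \<ge> 0" unfolding As_norm_def set_lebesgue_integral_def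
      by (intro integral_nonneg_AE AE_I2) (auto simp: indicator_def As_weight_nonneg)
    have AE: "AE x in lebesgue. x \<in> \<Omega> \<inter> halfsp k \<longrightarrow> \<bar>c x\<bar> \<le> M t"
      unfolding M_def t using h by (intro Linf_norm_AE_bound) blast
    have cb: "\<bar>c x * u x\<bar> \<le> M t * u x" if "x \<in> \<Omega> \<inter> halfsp k" for x
      by (rule pointwise_coefficient_bound[OF s \<Omega> _ _ _ _ _ _ AE that]) (use h in auto)
    have eq: "\<forall>x\<in>\<Omega> \<inter> halfsp k. \<exists>v. frac_lap_at k s u x v \<and> \<bar>v\<bar> \<le> M t * u x"
    proof
      fix x assume x: "x \<in> \<Omega> \<inter> halfsp k"
      show "\<exists>v. frac_lap_at k s u x v \<and> \<bar>v\<bar> \<le> M t * u x"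
        using h x cb[OF x] by (intro exI[of _ "- c x * u x"]) auto
    qed
    show "\<forall>p\<in>A. As_norm k s u / C1 t \<le> u p / p $ k \<and> u p / p $ k \<le> C2 t * As_norm k s u"
    proof
      fix p assume p: "p \<in> A"
      then have pk: "p $ k > 0" and p': "p \<in> \<Omega>'" by (auto simp: A_def halfsp_def)
      have "barrier_setting k s (M t) b D \<Omega> u p"
        unfolding barrier_setting_def using pk p' b\<Omega>[of p] D(2) C_beta_continuous_on h eq by (auto simp: less_imp_le)
      then have "As_norm k s u * p $ k \<le> C1 t * u p" "u p \<le> C2 t * As_norm k s u * p $ k"
        using C1(2) C2(2) by auto
      then show "As_norm k s u / C1 t \<le> u p / p $ k \<and> u p / p $ k \<le> C2 t * As_norm k s u"
        using pk C1(1)[of t] by (simp add: field_simps)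
    qed
  qed
  show ?thesis
    unfolding A_def[symmetric]
  proof (intro conjI)
    show "\<exists>C. (\<forall>t. C t > 0) \<and>
      (\<forall>c u \<alpha>. in_Linf (\<Omega> \<inter> halfsp k) c \<and> \<alpha> > 0 \<and> 2 * s + \<alpha> \<notin> \<int> \<and>
         C_beta (2 * s + \<alpha>) \<Omega> u \<and> in_As k s u \<and> (\<forall>x\<in>halfsp k. u x \<ge> 0) \<and>
         (\<forall>x\<in>\<Omega> \<inter> halfsp k. frac_lap_at k s u x (- c x * u x))
       \<longrightarrow> (SUP x\<in>A. ereal (u x / x $ k))
             \<le> ereal (C (Linf_norm (\<Omega> \<inter> halfsp k) c)) * (INF x\<in>A. ereal (u x / x $ k)))"
    proof (rule exI[of _ "\<lambda>t. C1 t * C2 t"], intro conjI allI impI)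
      show "C1 t * C2 t > 0" for t using C1 C2 by simp
      fix c u :: "real^'n \<Rightarrow> real" and \<alpha> :: real
      assume h: "in_Linf (\<Omega> \<inter> halfsp k) c \<and> \<alpha> > 0 \<and> 2 * s + \<alpha> \<notin> \<int> \<and>
         C_beta (2 * s + \<alpha>) \<Omega> u \<and> in_As k s u \<and> (\<forall>x\<in>halfsp k. u x \<ge> 0) \<and>
         (\<forall>x\<in>\<Omega> \<inter> halfsp k. frac_lap_at k s u x (- c x * u x))"
      let ?t = "Linf_norm (\<Omega> \<inter> halfsp k) c"
      show "(SUP x\<in>A. ereal (u x / x $ k)) \<le> ereal (C1 ?t * C2 ?t) * (INF x\<in>A. ereal (u x / x $ k))"
        by (rule SUP_INF_ereal_bounds(4)[OF A, of "As_norm k s u"]) (use bounds[OF h refl] C1(1) C2(1) in auto)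
    qed
    show "\<exists>C. (\<forall>t. C t > 1) \<and>
      (\<forall>c u \<alpha>. in_Linf (\<Omega> \<inter> halfsp k) c \<and> \<alpha> > 0 \<and> 2 * s + \<alpha> \<notin> \<int> \<and>
         C_beta (2 * s + \<alpha>) \<Omega> u \<and> in_As k s u \<and> (\<forall>x\<in>halfsp k. u x \<ge> 0) \<and>
         (\<forall>x\<in>\<Omega> \<inter> halfsp k. frac_lap_at k s u x (- c x * u x))
       \<longrightarrow> ereal (As_norm k s u / C (Linf_norm (\<Omega> \<inter> halfsp k) c)) \<le> (INF x\<in>A. ereal (u x / x $ k))
         \<and> (INF x\<in>A. ereal (u x / x $ k)) \<le> (SUP x\<in>A. ereal (u x / x $ k))
         \<and> (SUP x\<in>A. ereal (u x / x $ k)) \<le> ereal (C (Linf_norm (\<Omega> \<inter> halfsp k) c) * As_norm k s u))"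
    \<comment> \<open>One function above both constants and above 1.\<close>
    proof (rule exI[of _ "\<lambda>t. C1 t + C2 t + 1"], intro allI impI conjI)
      show "C1 t + C2 t + 1 > 1" for t using C1(1)[of t] C2(1)[of t] by simp
      fix c u :: "real^'n \<Rightarrow> real" and \<alpha> :: real
      assume h: "in_Linf (\<Omega> \<inter> halfsp k) c \<and> \<alpha> > 0 \<and> 2 * s + \<alpha> \<notin> \<int> \<and>
         C_beta (2 * s + \<alpha>) \<Omega> u \<and> in_As k s u \<and> (\<forall>x\<in>halfsp k. u x \<ge> 0) \<and>
         (\<forall>x\<in>\<Omega> \<inter> halfsp k. frac_lap_at k s u x (- c x * u x))"
      let ?t = "Linf_norm (\<Omega> \<inter> halfsp k) c"
      let ?C = "C1 ?t + C2 ?t + 1"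
      note B = bounds[OF h refl]
      have C: "C1 ?t > 0" "C2 ?t > 0" "?C > 0" using C1(1)[of ?t] C2(1)[of ?t] by simp_all
      have lo: "As_norm k s u / ?C \<le> u p / p $ k" if "p \<in> A" for p
      proof -
        have "As_norm k s u / ?C \<le> As_norm k s u / C1 ?t"
          using B C by (intro divide_left_mono) auto
        then show ?thesis using B that by fastforce
      qed
      have up: "u p / p $ k \<le> ?C * As_norm k s u" if "p \<in> A" for p
      proof -
        have "C2 ?t * As_norm k s u \<le> ?C * As_norm k s u"
          using B C by (intro mult_right_mono) auto
        then show ?thesis using B that by fastforce
      qed
      note R = SUP_INF_ereal_bounds[OF A conjunct1[OF B] C(3) C(3) lo up]
      show "ereal (As_norm k s u / ?C) \<le> (INF x\<in>A. ereal (u x / x $ k))" by (rule R(1))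
      show "(INF x\<in>A. ereal (u x / x $ k)) \<le> (SUP x\<in>A. ereal (u x / x $ k))" by (rule R(3))
      show "(SUP x\<in>A. ereal (u x / x $ k)) \<le> ereal (?C * As_norm k s u)" by (rule R(2))
    qed
  qed
qed

end
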